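(* Let $(X,d,m)$ be a geodesic metric measure space in which $\mathscr{E}_\infty$ is strongly displacement convex, or in which $\mathscr{E}_N$ is strongly displacement convex for some $N\in[1,\infty)$. Then for every continuous function $u\colon X\to\mathbb{R}$, every upper gradient $g$ of $u$, every point $x\in X$ and every radius $r>0$, \[ \int_{B(x,r)}|u-\langle u\rangle_{B(x,r)}|\,dm \le 4r\int_{B(x,2r)}g\,dm . \]
   Context: Standing assumptions: $(X,d,m)$ is a metric measure space, $(X,d)$ is a complete geodesic metric space, $m$ is a Borel measure on $X$ with support $X$. $B(x,r)=\{y : d(x,y)<r\}$, and $\langle u\rangle_{B} = \frac{1}{m(B)}\int_B u\,dm$ is the average of $u$ over the ball $B$ (which presupposes $0<m(B)<\infty$). Upper gradient: a Borel function $g\colon X \to [0,\infty]$ is an upper gradient of $u$ if for every constant speed curve $\gamma\colon[0,1]\to X$ with length $l(\gamma)<\infty$ one has $|u(\gamma(0))-u(\gamma(1))| \le l(\gamma)\int_0^1 g(\gamma(t))\,dt$. Wasserstein space: $\mathcal{P}(X)$ is the set of Borel probability measures on $X$, and $W_2(\mu,\nu) = \left(\inf_\sigma \int_{X\times X} d(x,y)^2\,d\sigma(x,y)\right)^{1/2}$ (possibly $+\infty$), the infimum being over $\sigma\in\mathcal{P}(X\times X)$ with first marginal $\mu$ and second marginal $\nu$. $\operatorname{Geo}(\mathcal{P}(X))$ is the set of constant speed geodesics of $(\mathcal{P}(X),W_2)$, i.e. continuous $\Gamma\colon[0,1]\to\mathcal{P}(X)$ with $W_2(\Gamma(t),\Gamma(s))=|t-s|W_2(\Gamma(0),\Gamma(1))<\infty$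 for all $s,t\in[0,1]$. Entropies: for $\mu\in\mathcal{P}(X)$ with Lebesgue decomposition $\mu=\rho m+\mu^\perp$ with respect to $m$, the Rényi entropy functional is $\mathscr{E}_N(\mu)=-\int_X\rho^{1-1/N}\,dm$ for $N\in[1,\infty)$ (the integrand being $0$ where $\rho=0$); the Shannon entropy functional is $\mathscr{E}_\infty(\mu)=\int_X\rho\log\rho\,dm$ if $\mu^\perp=0$, and $\mathscr{E}_\infty(\mu)=+\infty$ if $\mu^\perp\neq0$. Strong displacement convexity: a functional $\mathscr{F}\colon\mathcal{P}(X)\to\mathbb{R}\cup\{-\infty,\infty\}$ is strongly displacement convex if for every $\Gamma\in\operatorname{Geo}(\mathcal{P}(X))$ and all $s\in[0,1]$, $\mathscr{F}(\Gamma(s))\le(1-s)\mathscr{F}(\Gamma(0))+s\mathscr{F}(\Gamma(1))$. *)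

theory Defs
  imports "HOL-Probability.Probability"
begin

definition curve_length :: "(real \<Rightarrow> 'a::metric_space) \<Rightarrow> real \<Rightarrow> real \<Rightarrow> ennreal" where
  "curve_length \<gamma> a b =
     (SUP (n, t) \<in> {(n::nat, t::nat \<Rightarrow> real). mono_on {..n} t \<and> t ` {..n} \<subseteq> {a..b}}.
        \<Sum>i<n. ennreal (dist (\<gamma> (t i)) (\<gamma> (t (Suc i)))))"

definition constant_speed_curve :: "(real \<Rightarrow> 'a::metric_space) \<Rightarrow> bool" where
  "constant_speed_curve \<gamma> \<longleftrightarrow>
     continuous_on {0..1} \<gamma> \<and>
     (\<forall>s t. 0 \<le> s \<and> s \<le> t \<and> t \<le> 1 \<longrightarrow>
        curve_length \<gamma> s t = ennreal (t - s) * curve_length \<gamma> 0 1)"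

definition upper_gradient :: "('a::metric_space \<Rightarrow> ennreal) \<Rightarrow> ('a \<Rightarrow> real) \<Rightarrow> bool" where
  "upper_gradient g u \<longleftrightarrow>
     g \<in> borel_measurable borel \<and>
     (\<forall>\<gamma>. constant_speed_curve \<gamma> \<and> curve_length \<gamma> 0 1 < \<infinity> \<longrightarrow>
        ennreal \<bar>u (\<gamma> 0) - u (\<gamma> 1)\<bar>
          \<le> curve_length \<gamma> 0 1 * (\<integral>\<^sup>+ t\<in>{0..1}. g (\<gamma> t) \<partial>lborel))"

definition geodesic_space :: "'a::metric_space itself \<Rightarrow> bool" where
  "geodesic_space _ \<longleftrightarrow>
     (\<forall>x y :: 'a. \<exists>\<gamma> :: real \<Rightarrow> 'a. \<gamma> 0 = x \<and> \<gamma> 1 = y \<and>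
        (\<forall>s\<in>{0..1}. \<forall>t\<in>{0..1}. dist (\<gamma> s) (\<gamma> t) = \<bar>s - t\<bar> * dist x y))"

definition measure_support :: "'a::topological_space measure \<Rightarrow> 'a set" where
  "measure_support m = {x. \<forall>U. open U \<and> x \<in> U \<longrightarrow> emeasure m U > 0}"

text \<open>
  The \<open>\<sigma>\<close>-finiteness makes Lebesgue decompositions with respect to \<^term>\<open>m\<close> exist and be unique;
  it holds whenever all balls have finite measure (see \<open>sigma_finite_if_finite_balls\<close> below).
\<close>

definition geodesic_metric_measure_space :: "'a::complete_space measure \<Rightarrow> bool" where
  "geodesic_metric_measure_space m \<longleftrightarrow>
     geodesic_space TYPE('a) \<and> sets m = sets borel \<and> sigma_finite_measure m \<and>
     measure_support m = UNIV"

lemma sigma_finite_if_finite_balls: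
  fixes m :: "'a::metric_space measure"
  assumes "sets m = sets borel" and "\<And>x r. emeasure m (ball x r) < \<infinity>"
  shows "sigma_finite_measure m"
proof
  fix x :: 'a
  have sp: "space m = UNIV"
    using sets_eq_imp_space_eq[OF assms(1)] by simp
  have cover: "(\<Union>n. ball x (real n)) = UNIV"
  proof (rule UNIV_eq_I[symmetric])
    fix y
    obtain n :: nat where "dist x y < real n"
      using reals_Archimedean2 by blast
    then show "y \<in> (\<Union>n. ball x (real n))" by (metis UN_I UNIV_I mem_ball)
  qed
  have meas: "range (\<lambda>n. ball x (real n)) \<subseteq> sets m"
    unfolding assms(1) by (rule image_subsetI) (rule borel_open, rule open_ball)
  have fin: "\<forall>a\<in>range (\<lambda>n. ball x (real n)). emeasure m a \<noteq> \<infinity>"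
  proof (rule ballI)
    fix a assume "a \<in> range (\<lambda>n. ball x (real n))"
    then obtain n :: nat where "a = ball x (real n)" by blast
    then show "emeasure m a \<noteq> \<infinity>" using assms(2)[of x "real n"] by (metis less_irrefl)
  qed
  show "\<exists>A. countable A \<and> A \<subseteq> sets m \<and> \<Union> A = space m \<and> (\<forall>a\<in>A. emeasure m a \<noteq> \<infinity>)"
    using cover meas fin sp by (intro exI[of _ "range (\<lambda>n. ball x (real n))"] conjI) simp_all
qed

definition average :: "'a measure \<Rightarrow> ('a \<Rightarrow> real) \<Rightarrow> 'a set \<Rightarrow> real" where
  "average m u B = (1 / measure m B) * (LINT y:B|m. u y)"

definition borel_probs :: "'a::topological_space measure set" where
  "borel_probs = {\<mu>. prob_space \<mu> \<and> sets \<mu> = sets borel}"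

definition couplings ::
  "'a::topological_space measure \<Rightarrow> 'a measure \<Rightarrow> ('a \<times> 'a) measure set" where
  "couplings \<mu> \<nu> = {\<sigma> \<in> borel_probs. distr \<sigma> borel fst = \<mu> \<and> distr \<sigma> borel snd = \<nu>}"

definition transport_cost :: "'a::metric_space measure \<Rightarrow> 'a measure \<Rightarrow> ennreal" where
  "transport_cost \<mu> \<nu> = (INF \<sigma>\<in>couplings \<mu> \<nu>. \<integral>\<^sup>+ (x, y). ennreal ((dist x y)\<^sup>2) \<partial>\<sigma>)"

definition W2 :: "'a::metric_space measure \<Rightarrow> 'a measure \<Rightarrow> ennreal" where
  "W2 \<mu> \<nu> =
     (if transport_cost \<mu> \<nu> = \<infinity> then \<infinity> else ennreal (sqrt (enn2real (transport_cost \<mu> \<nu>))))"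

definition wasserstein_geodesics :: "(real \<Rightarrow> 'a::metric_space measure) set" where
  "wasserstein_geodesics =
     {\<Gamma>. (\<forall>t\<in>{0..1}. \<Gamma> t \<in> borel_probs) \<and>
          (\<forall>t\<in>{0..1}. ((\<lambda>s. W2 (\<Gamma> s) (\<Gamma> t)) \<longlongrightarrow> 0) (at t within {0..1})) \<and>
          W2 (\<Gamma> 0) (\<Gamma> 1) < \<infinity> \<and>
          (\<forall>s\<in>{0..1}. \<forall>t\<in>{0..1}. W2 (\<Gamma> t) (\<Gamma> s) = ennreal \<bar>t - s\<bar> * W2 (\<Gamma> 0) (\<Gamma> 1))}"

definition lebesgue_decomposition ::
  "'a measure \<Rightarrow> 'a measure \<Rightarrow> ('a \<Rightarrow> real) \<Rightarrow> 'a measure \<Rightarrow> bool" where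
  "lebesgue_decomposition m \<mu> \<rho> \<mu>s \<longleftrightarrow>
     \<rho> \<in> borel_measurable m \<and> (\<forall>x. 0 \<le> \<rho> x) \<and> sets \<mu>s = sets m \<and>
     (\<exists>S\<in>null_sets m. space m - S \<in> null_sets \<mu>s) \<and>
     (\<forall>A\<in>sets m. emeasure \<mu> A = emeasure (density m (\<lambda>x. ennreal (\<rho> x))) A + emeasure \<mu>s A)"

definition ac_density :: "'a measure \<Rightarrow> 'a measure \<Rightarrow> 'a \<Rightarrow> real" where
  "ac_density m \<mu> = (SOME \<rho>. \<exists>\<mu>s. lebesgue_decomposition m \<mu> \<rho> \<mu>s)"

definition singular_part :: "'a measure \<Rightarrow> 'a measure \<Rightarrow> 'a measure" where
  "singular_part m \<mu> = (SOME \<mu>s. \<exists>\<rho>. lebesgue_decomposition m \<mu> \<rho> \<mu>s)"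

text \<open>
  Since \<open>0 powr a = 0\<close> also for \<open>a = 0\<close>, the integrand vanishes where the density does,
  including for \<open>N = 1\<close>.
\<close>

definition renyi_entropy :: "real \<Rightarrow> 'a measure \<Rightarrow> 'a measure \<Rightarrow> ereal" where
  "renyi_entropy N m \<mu> =
     - enn2ereal (\<integral>\<^sup>+ x. ennreal (ac_density m \<mu> x powr (1 - 1 / N)) \<partial>m)"

text \<open>
  The integral of \<open>\<rho> ln \<rho>\<close> is that of its positive part minus that of its negative part. In \<^typ>\<open>ereal\<close>,
  \<open>\<infinity> - \<infinity> = \<infinity>\<close>, so the entropy is \<open>\<infinity>\<close> whenever the positive part is not integrable; this is
  the limit of the integrals over \<open>{\<rho> > \<epsilon>}\<close> as \<open>\<epsilon>\<close> tends to 0.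
\<close>

definition shannon_entropy :: "'a measure \<Rightarrow> 'a measure \<Rightarrow> ereal" where
  "shannon_entropy m \<mu> =
     (let \<rho> = ac_density m \<mu> in
      if singular_part m \<mu> = null_measure m
      then enn2ereal (\<integral>\<^sup>+ x. ennreal (\<rho> x * ln (\<rho> x)) \<partial>m)
           - enn2ereal (\<integral>\<^sup>+ x. ennreal (- (\<rho> x * ln (\<rho> x))) \<partial>m)
      else \<infinity>)"

definition strongly_displacement_convex :: "('a::metric_space measure \<Rightarrow> ereal) \<Rightarrow> bool" where
  "strongly_displacement_convex F \<longleftrightarrow>
     (\<forall>\<Gamma>\<in>wasserstein_geodesics. \<forall>s\<in>{0..1}.
        F (\<Gamma> s) \<le> ereal (1 - s) * F (\<Gamma> 0) + ereal s * F (\<Gamma> 1))"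

end

theory Submission
  imports Defs
begin

text \<open>
  Let \<open>c\<close> be a median of \<open>u\<close> on \<open>B = B(x, r)\<close> and split \<open>B\<close> into two halves of equal mass with
  \<open>u \<ge> c\<close> on one and \<open>u \<le> c\<close> on the other. The normalised restrictions of \<open>m\<close> to the halves have
  density \<open>2 / m(B)\<close>; transport one to the other along geodesics selected measurably on the support
  of an optimal coupling. If the density of an intermediate measure exceeded \<open>2 / m(B)\<close> somewhere, the
  geodesics through that place would, after normalisation, still form a Wasserstein geodesic, but
  along it the entropy would be larger in the interior than at both ends, against convexity.
  Integrating the upper gradient inequality along the transport therefore bounds the integral of
  \<open>|u - c|\<close> over \<open>B\<close> by \<open>2 r\<close> times that of \<open>g\<close> over \<open>B(x, 2 r)\<close>, and replacing the median by the
  mean costs a factor 2.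

  The space is not assumed to be separable or proper. Separability follows from the support
  condition. Optimal couplings are obtained by coding points as binary sequences, where probability
  measures are weakly compact by Helly's theorem, and the selection of geodesics exhausts the space
  of geodesics by compact sets.
\<close>

section \<open>Separability\<close>

text \<open>Only one-sided information about the entropies enters: a density at most K bounds the
  entropy above by a strictly increasing function of K, and a density at least K on a carrier bounds
  it below by the same function. Conditioning a coupling on the geodesics that meet a set S at time
  t, of total mass c, divides by c. The end measures may lose mass elsewhere, so their densities are
  at most \<open>C / c\<close>; at time t nothing over S is lost, so an excess density
  \<open>C' > C\<close> there becomes at least \<open>C' / c\<close>. This contradicts convexity,
  once it is known that a part of an optimal coupling is optimal. The ball of radius 2 r and the
  constant 2 r have the same origin: geodesics between points of B are shorter than 2 r, so each of
  their points is within r of an endpoint. The bound 2 / m(B) on the densities disappears from the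
  result, since the normalised halves carry the same factor on the other side. Separability is
  needed from the start: in a large metric space the Borel sets of pairs may exceed the product
  sigma-algebra, and maps into pairs would not be measurable.\<close>

locale dense_sequence =
  fixes q :: "nat \<Rightarrow> 'a::metric_space"
  assumes dense: "0 < e \<Longrightarrow> \<exists>i. dist (q i) x < e"
begin

text \<open>Balls with centres \<open>q i\<close> and radii 1 / (n + 1) give countably many
  rectangles from which every open set of pairs is a union, so measurability of both components
  suffices.\<close>

lemma measurable_Pair_borel [measurable (raw)]:
  fixes f g :: "'b \<Rightarrow> 'a"
  assumes [measurable]: "f \<in> borel_measurable M" "g \<in> borel_measurable M"
  shows "(\<lambda>x. (f x, g x)) \<in> borel_measurable M"
proof (rule borel_measurableI)
  fix S :: "('a \<times> 'a) set" assume S: "open S"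
  define R where "R = (\<lambda>(i, j, n). ball (q i) (1 / real (Suc n)) \<times> ball (q j) (1 / real (Suc n)))"
  have "\<exists>p. (x, y) \<in> R p \<and> R p \<subseteq> S" if xy: "(x, y) \<in> S" for x y
  proof -
    obtain e where e: "e > 0" "ball (x, y) e \<subseteq> S"
      using S xy openE by blast
    obtain n where n: "1 / real (Suc n) < e / 4"
      using nat_approx_posE[of "e/4"] e by auto
    obtain i where i: "dist (q i) x < 1 / real (Suc n)"
      using dense[of "1 / real (Suc n)" x] by auto
    obtain j where j: "dist (q j) y < 1 / real (Suc n)"
      using dense[of "1 / real (Suc n)" y] by auto
    have "dist (x, y) (x', y') < e" if "dist (q i) x' < 1 / real (Suc n)" "dist (q j) y' < 1 / real (Suc n)" for x' y'
    proof -
      have "dist x x' < e/2"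
        using dist_triangle[of x x' "q i"] that i n by (simp add: dist_commute)
      moreover have "dist y y' < e/2"
        using dist_triangle[of y y' "q j"] that j n by (simp add: dist_commute)
      moreover have "dist (x, y) (x', y') \<le> dist x x' + dist y y'"
        unfolding dist_prod_def by (simp add: sqrt_sum_squares_le_sum)
      ultimately show ?thesis by linarith
    qed
    then have "R (i, j, n) \<subseteq> S"
      using e(2) by (auto simp: subset_eq R_def)
    with i j show ?thesis
      by (intro exI[of _ "(i, j, n)"]) (auto simp: R_def)
  qed
  then have "S = (\<Union>p\<in>{p. R p \<subseteq> S}. R p)"
    by (auto; blast)
  then have "(\<lambda>x. (f x, g x)) -` S \<inter> space M = (\<Union>p\<in>{p. R p \<subseteq> S}. (\<lambda>x. (f x, g x)) -` R p \<inter> space M)"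
    by blast
  also have "\<dots> \<in> sets M"
  proof (rule sets.countable_UN', simp, rule image_subsetI)
    fix p assume "p \<in> {p. R p \<subseteq> S}"
    obtain i j n where p: "p = (i, j, n)" by (cases p)
    have "(\<lambda>x. (f x, g x)) -` R p \<inter> space M =
       (f -` ball (q i) (1 / real (Suc n)) \<inter> space M) \<inter> (g -` ball (q j) (1 / real (Suc n)) \<inter> space M)"
      unfolding p R_def by auto
    also have "\<dots> \<in> sets M"
      by (intro sets.Int measurable_sets[of _ _ borel]) auto
    finally show "(\<lambda>x. (f x, g x)) -` R p \<inter> space M \<in> sets M" .
  qed
  finally show "(\<lambda>x. (f x, g x)) -` S \<inter> space M \<in> sets M" .
qed

lemma measurable_dist [measurable (raw)]:
  fixes f g :: "'b \<Rightarrow> 'a"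
  assumes [measurable]: "f \<in> borel_measurable M" "g \<in> borel_measurable M"
  shows "(\<lambda>x. dist (f x) (g x)) \<in> borel_measurable M"
proof -
  have "(\<lambda>p::'a \<times> 'a. dist (fst p) (snd p)) \<in> borel_measurable borel"
    by (intro borel_measurable_continuous_onI continuous_intros)
  from measurable_compose[OF measurable_Pair_borel[OF assms] this] show ?thesis by simp
qed

end

lemma measurable_fst_borel [measurable]: "fst \<in> (borel :: ('a::topological_space \<times> 'b::topological_space) measure) \<rightarrow>\<^sub>M borel"
  by (intro borel_measurable_continuous_onI continuous_intros)

lemma measurable_snd_borel [measurable]: "snd \<in> (borel :: ('a::topological_space \<times> 'b::topological_space) measure) \<rightarrow>\<^sub>M borel"
  by (intro borel_measurable_continuous_onI continuous_intros)

text \<open>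
  The centres of disjoint balls of positive measure are the atoms of the push-forward of a finite
  measure, so there are only countably many of them.
\<close>

lemma countable_separated_set:
  fixes M :: "'a::metric_space measure" and S :: "'a set"
  assumes M: "finite_measure M" "sets M = sets borel"
    and pos: "\<And>x r. r > 0 \<Longrightarrow> emeasure M (ball x r) > 0"
    and e: "e > 0" and sep: "\<And>x y. x \<in> S \<Longrightarrow> y \<in> S \<Longrightarrow> x \<noteq> y \<Longrightarrow> e \<le> dist x y"
  shows "countable S"
proof -
  interpret finite_measure M by fact
  define f where "f y = (if \<exists>x\<in>S. dist x y < e/2 then Some (SOME x. x \<in> S \<and> dist x y < e/2) else None)" for y
  have uniq: "x = x'" if "x \<in> S" "x' \<in> S" "dist x y < e/2" "dist x' y < e/2" for x x' y
    using sep[of x x'] that dist_triangle[of x x' y] by (auto simp: dist_commute)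
  have f_Some: "f y = Some x \<longleftrightarrow> x \<in> S \<and> dist x y < e/2" for x y
  proof
    assume "f y = Some x"
    then show "x \<in> S \<and> dist x y < e/2"
      unfolding f_def by (metis (mono_tags, lifting) option.distinct(1) option.inject someI_ex)
  next
    assume x: "x \<in> S \<and> dist x y < e/2"
    then have "(SOME x. x \<in> S \<and> dist x y < e/2) = x"
      using uniq by (intro some_equality) auto
    then show "f y = Some x"
      using x unfolding f_def by auto
  qed
  \<comment> \<open>Arbitrary unions of balls are open, so \<open>f\<close> is measurable even for
    the full power set of a possibly uncountable range. This makes its push-forward a discrete
    measure with countably many atoms.\<close>
  have open_Some: "open {y. \<exists>x. f y = Some x \<and> Some x \<in> A}" for A
  proof -
    have "{y. \<exists>x. f y = Some x \<and> Some x \<in> A} = (\<Union>x\<in>{x\<in>S. Some x \<in> A}. ball x (e/2))"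
      by (auto simp: f_Some)
    then show ?thesis by auto
  qed
  have f: "f \<in> M \<rightarrow>\<^sub>M count_space UNIV"
  proof (rule measurableI)
    fix A :: "'a option set"
    have "f -` A = {y. \<exists>x. f y = Some x \<and> Some x \<in> A} \<union> (if None \<in> A then - {y. \<exists>x. f y = Some x \<and> Some x \<in> UNIV} else {})"
      by (auto simp: not_Some_eq split: if_splits) (metis not_Some_eq)+
    also have "\<dots> \<in> sets borel"
      using borel_open[OF open_Some] borel_open[OF open_Some[of UNIV]] by (intro sets.Un) auto
    finally show "f -` A \<inter> space M \<in> sets M"
      using M(2) sets_eq_imp_space_eq[OF M(2)] by simp
  qed auto
  interpret D: finite_measure "distr M (count_space UNIV) f"
    by (rule finite_measure_distr[OF f])
  have "measure (distr M (count_space UNIV) f) {Some x} \<noteq> 0" if x: "x \<in> S" for x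
  proof -
    have "f -` {Some x} \<inter> space M = ball x (e/2)"
      using x by (auto simp: f_Some sets_eq_imp_space_eq[OF M(2)])
    then have "emeasure (distr M (count_space UNIV) f) {Some x} > 0"
      using pos[of "e/2" x] e by (subst emeasure_distr[OF f]) auto
    then show ?thesis
      by (simp add: D.emeasure_eq_measure)
  qed
  then have "Some ` S \<subseteq> {y. measure (distr M (count_space UNIV) f) {y} \<noteq> 0}"
    by auto
  then have "countable (Some ` S)"
    using D.countable_support countable_subset by blast
  then show ?thesis
    by (rule countable_image_inj_on) auto
qed

text \<open>By Zorn's lemma: a point far from all of a maximal separated set could be added to it.
  The alternative \<open>x = z\<close> covers members of the set when \<open>e\<close> is not
  positive.\<close>

lemma ex_maximal_separated_set:
  "\<exists>S. (\<forall>x\<in>S. \<forall>y\<in>S. x \<noteq> y \<longrightarrow> e \<le> dist x y) \<and> (\<forall>z::'a::metric_space. \<exists>x\<in>S. dist x z < e \<or> x = z)"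
proof -
  let ?A = "{S. \<forall>x\<in>S. \<forall>y\<in>S. x \<noteq> y \<longrightarrow> e \<le> dist x (y::'a)}"
  have "\<exists>M\<in>?A. \<forall>X\<in>?A. M \<subseteq> X \<longrightarrow> X = M"
  proof (rule subset_Zorn')
    fix C assume C: "subset.chain ?A C"
    have sub: "C \<subseteq> ?A" 
      using C unfolding subset_chain_def by (rule conjunct1)
    have chain: "X \<subseteq> Y \<or> Y \<subseteq> X" if "X \<in> C" "Y \<in> C" for X Y
      using C that unfolding subset_chain_def by blast
    have "e \<le> dist x y" if XY: "X \<in> C" "x \<in> X" "Y \<in> C" "y \<in> Y" "x \<noteq> y" for X Y x y
    proof -
      have "X \<subseteq> Y \<or> Y \<subseteq> X" using chain[OF XY(1,3)] .
      moreover have "X \<in> ?A" "Y \<in> ?A" using XY sub by auto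
      ultimately show ?thesis
        using XY by blast
    qed
    then show "\<Union>C \<in> ?A" by blast
  qed
  then obtain S where S: "S \<in> ?A" and max: "\<And>X. X \<in> ?A \<Longrightarrow> S \<subseteq> X \<Longrightarrow> X = S"
    by (elim bexE) simp
  have "\<exists>x\<in>S. dist x z < e \<or> x = z" for z
  proof (rule ccontr)
    assume n: "\<not> ?thesis"
    then have "insert z S \<in> ?A"
      using S by (auto simp: dist_commute not_less)
    from max[OF this subset_insertI] n show False by (metis insertI1)
  qed
  with S show ?thesis by blast
qed

text \<open>A strictly positive integrable \<open>h\<close> turns \<open>M\<close> into a finite
  measure that still charges every ball. Maximal separated sets at the scales 1 / (n + 1) are then
  countable, and their union is dense.\<close>

lemma ex_dense_sequence:
  fixes M :: "'a::metric_space measure"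
  assumes "sigma_finite_measure M" and sets: "sets M = sets borel" and supp: "measure_support M = UNIV"
  shows "\<exists>q::nat \<Rightarrow> 'a. dense_sequence q"
proof -
  interpret M: sigma_finite_measure M by fact
  have sp: "space M = UNIV" using sets_eq_imp_space_eq[OF sets] by simp
  obtain h where h [measurable]: "h \<in> borel_measurable M" and hi: "integral\<^sup>N M h \<noteq> \<infinity>"
    and hp: "\<forall>x\<in>space M. 0 < h x \<and> h x < \<infinity>"
    using M.Ex_finite_integrable_function by (elim bexE conjE)
  have fin: "finite_measure (density M h)"
    using hi by (intro finite_measureI) (simp add: emeasure_density cong: nn_integral_cong)
  have pos: "emeasure (density M h) (ball x r) > 0" if "r > 0" for x r
  proof -
    have b [measurable]: "ball x r \<in> sets M" unfolding sets by simp
    have "x \<in> measure_support M"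
      by (simp add: supp)
    then have "emeasure M (ball x r) > 0"
      unfolding measure_support_def mem_Collect_eq
      by (rule allE[of _ "ball x r"]) (simp add: that)
    moreover have "h y \<noteq> 0" for y
      using hp sp by (metis UNIV_I less_irrefl)
    then have "{y \<in> space M. h y * indicator (ball x r) y \<noteq> 0} = ball x r"
      using sp by (auto split: split_indicator)
    ultimately have "(\<integral>\<^sup>+y. h y * indicator (ball x r) y \<partial>M) \<noteq> 0"
      by (subst nn_integral_0_iff) auto
    then show ?thesis
      unfolding emeasure_density[OF h b] by (rule iffD2[OF zero_less_iff_neq_zero])
  qed
  have "\<exists>S. countable S \<and> (\<forall>z::'a. \<exists>x\<in>S. dist x z < 1 / real (Suc n))" for n
  proof -
    from ex_maximal_separated_set[where 'a='a, of "1 / real (Suc n)"] obtain S where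
      S: "(\<forall>x\<in>S. \<forall>y\<in>S. x \<noteq> y \<longrightarrow> 1 / real (Suc n) \<le> dist x y) \<and>
        (\<forall>z::'a. \<exists>x\<in>S. dist x z < 1 / real (Suc n) \<or> x = z)" ..
    have "countable S"
      by (rule countable_separated_set[OF fin _ pos, of "1 / real (Suc n)"]) (use S sets in simp_all)
    moreover have "\<exists>x\<in>S. dist x z < 1 / real (Suc n)" for z
    proof -
      obtain x where "x \<in> S" "dist x z < 1 / real (Suc n) \<or> x = z" using S by blast
      then show ?thesis by (intro bexI[of _ x]) auto
    qed
    ultimately show ?thesis by blast
  qed
  then obtain S where S: "\<And>n. countable (S n)" "\<And>n z::'a. \<exists>x\<in>S n. dist x z < 1 / real (Suc n)"
    by metis
  let ?Q = "\<Union>n. S n"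
  have "countable ?Q" using S by auto
  moreover have "?Q \<noteq> {}" using S(2)[of 0] by blast
  ultimately have r: "range (from_nat_into ?Q) = ?Q"
    by (simp add: range_from_nat_into)
  have "dense_sequence (from_nat_into ?Q)"
  proof
    fix e :: real and x :: 'a assume "0 < e"
    then obtain n where n: "1 / real (Suc n) < e"
      using nat_approx_posE by auto
    obtain y where "y \<in> S n" "dist y x < 1 / real (Suc n)" using S(2) by blast
    moreover from this obtain i where "y = from_nat_into ?Q i"
      using r by blast
    ultimately show "\<exists>i. dist (from_nat_into ?Q i) x < e"
      using n by (intro exI[of _ i]) simp
  qed
  then show ?thesis by blast
qed

section \<open>Compactness of probability measures on binary sequences\<close>

abbreviation cantor :: "(nat \<Rightarrow> bool) measure" where
  "cantor \<equiv> \<Pi>\<^sub>M i\<in>UNIV. count_space UNIV"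

text \<open>Functions of the first n bits. They are continuous on the Cantor space and determine a
  finite measure, hence serve as the test functions of weak convergence.\<close>

definition finite_depth :: "nat \<Rightarrow> ((nat \<Rightarrow> bool) \<Rightarrow> 'b) \<Rightarrow> bool" where
  "finite_depth n f \<longleftrightarrow> (\<forall>\<omega> \<omega>'. (\<forall>i<n. \<omega> i = \<omega>' i) \<longrightarrow> f \<omega> = f \<omega>')"

lemma finite_depthD: "finite_depth n f \<Longrightarrow> (\<And>i. i < n \<Longrightarrow> \<omega> i = \<omega>' i) \<Longrightarrow> f \<omega> = f \<omega>'"
  unfolding finite_depth_def by blast

lemma finite_depth_fun_upd: "finite_depth (Suc n) f \<Longrightarrow> finite_depth n (\<lambda>\<omega>. f (fun_upd \<omega> n b))"
  unfolding finite_depth_def by (auto simp: less_Suc_eq)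

lemma finite_depth_measurable:
  assumes "finite_depth n (f :: (nat \<Rightarrow> bool) \<Rightarrow> real)"
  shows "f \<in> borel_measurable cantor"
  using assms
proof (induction n arbitrary: f)
  case 0
  have "f = (\<lambda>_. f (\<lambda>_. True))"
    using finite_depthD[OF 0] by fastforce
  then show ?case by (metis borel_measurable_const)
next
  case (Suc n)
  have [measurable]: "(\<lambda>\<omega>. f (fun_upd \<omega> n b)) \<in> borel_measurable cantor" for b
    by (intro Suc finite_depth_fun_upd)
  have "f = (\<lambda>\<omega>. if \<omega> n then f (fun_upd \<omega> n True) else f (fun_upd \<omega> n False))"
    by (auto simp: fun_eq_iff intro!: arg_cong[where f=f])
  also have "\<dots> \<in> borel_measurable cantor"
    by measurable
  finally show ?case .
qed

text \<open>
  Binary sequences are encoded as the points of the ternary Cantor set, on which the digits can be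
  read off by functions that are continuous on the whole line.
\<close>

definition ternary :: "(nat \<Rightarrow> bool) \<Rightarrow> real" where
  "ternary \<omega> = (\<Sum>k. 2 * of_bool (\<omega> k) * (1/3) ^ Suc k)"

text \<open>Equals 0 on [0, 1/3] and 1 on [2/3, 1], the two pieces that contain the Cantor set, and
  is linear across the gap between them.\<close>

definition leading_digit :: "real \<Rightarrow> real" where
  "leading_digit z = max 0 (min 1 (3 * z - 1))"

text \<open>On the Cantor set the iterated map removes the leading digit, so its k-th iterate brings
  digit k to the front.\<close>

definition digit :: "nat \<Rightarrow> real \<Rightarrow> real" where
  "digit k z = leading_digit (((\<lambda>z. 3 * z - 2 * leading_digit z) ^^ k) z)"

lemma ternary_summable: "summable (\<lambda>k. 2 * of_bool (\<omega> k) * (1/3) ^ Suc k :: real)"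
proof (rule summable_comparison_test')
  show "summable (\<lambda>k. 2 * (1/3) ^ Suc k :: real)"
    by (intro summable_mult) (simp add: summable_geometric)
qed auto

lemma ternary_rec: "ternary \<omega> = (2 * of_bool (\<omega> 0) + ternary (\<lambda>k. \<omega> (Suc k))) / 3"
proof -
  have "ternary \<omega> = 2 * of_bool (\<omega> 0) * (1/3) + (\<Sum>k. 2 * of_bool (\<omega> (Suc k)) * (1/3) ^ Suc (Suc k))"
    unfolding ternary_def using suminf_split_head[OF ternary_summable[of \<omega>]] by simp
  also have "(\<Sum>k. 2 * of_bool (\<omega> (Suc k)) * (1/3) ^ Suc (Suc k)) = (1/3) * ternary (\<lambda>k. \<omega> (Suc k))"
    unfolding ternary_def
    by (subst suminf_mult[OF ternary_summable, symmetric]) (simp add: algebra_simps)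
  finally show ?thesis by simp
qed

lemma ternary_bounds: "0 \<le> ternary \<omega>" "ternary \<omega> \<le> 1"
proof -
  show "0 \<le> ternary \<omega>"
    unfolding ternary_def by (intro suminf_nonneg ternary_summable) auto
  have "(\<lambda>k. 2/3 * (1/3::real) ^ k) sums (2/3 * (1 / (1 - 1/3)))"
    by (intro sums_mult geometric_sums) auto
  then have s: "(\<lambda>k. 2 * (1/3::real) ^ Suc k) sums 1" by simp
  have "ternary \<omega> \<le> (\<Sum>k. 2 * (1/3) ^ Suc k)"
    unfolding ternary_def using s by (intro suminf_le ternary_summable) (auto simp: sums_iff)
  with s show "ternary \<omega> \<le> 1" by (simp add: sums_iff)
qed

lemma digit_ternary: "digit k (ternary \<omega>) = of_bool (\<omega> k)"
proof -
  have lead: "leading_digit (ternary \<omega>) = of_bool (\<omega> 0)" for \<omega>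
    using ternary_bounds[of "\<lambda>k. \<omega> (Suc k)"] ternary_rec[of \<omega>]
    by (auto simp: leading_digit_def)
  then have step: "3 * ternary \<omega> - 2 * leading_digit (ternary \<omega>) = ternary (\<lambda>k. \<omega> (Suc k))" for \<omega>
    using ternary_rec[of \<omega>] by simp
  have "((\<lambda>z. 3 * z - 2 * leading_digit z) ^^ k) (ternary \<omega>) = ternary (\<lambda>i. \<omega> (i + k))" for \<omega>
    by (induction k arbitrary: \<omega>) (simp_all add: step)
  then show ?thesis
    unfolding digit_def by (simp add: lead)
qed

lemma continuous_digit: "continuous_on UNIV (digit k)"
proof -
  have l: "continuous_on UNIV leading_digit"
    unfolding leading_digit_def by (intro continuous_intros)
  have "continuous_on UNIV ((\<lambda>z. 3 * z - 2 * leading_digit z) ^^ k)"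
  proof (induction k)
    case (Suc k)
    have "continuous_on UNIV (\<lambda>z::real. 3 * z - 2 * leading_digit z)"
      by (intro continuous_intros l)
    then show ?case
      using Suc by (auto intro: continuous_on_compose2)
  qed (simp add: id_def)
  from continuous_on_compose2[OF l this] show ?thesis
    unfolding digit_def[abs_def] by simp
qed

lemma digit_bounds: "0 \<le> digit k z" "digit k z \<le> 1"
  by (auto simp: digit_def leading_digit_def)

text \<open>Weak convergence on the line tests only bounded continuous functions. By induction on
  the depth, the two branches at the last bit are interpolated with the continuous digit as weight.
  Agreement is stated for all reals whose digits are 0 or 1, because that is the property which
  passes to weak limits.\<close>

lemma finite_depth_continuous_extension:
  assumes "finite_depth n (f :: (nat \<Rightarrow> bool) \<Rightarrow> real)"
  shows "\<exists>\<phi> B. continuous_on UNIV \<phi> \<and> (\<forall>z. \<bar>\<phi> z\<bar> \<le> B) \<and>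
    (\<forall>z. (\<forall>k. digit k z \<in> {0, 1}) \<longrightarrow> \<phi> z = f (\<lambda>k. digit k z = 1))"
  using assms
proof (induction n arbitrary: f)
  case 0
  show ?case
    by (rule exI[of _ "\<lambda>_. f (\<lambda>_. True)"], rule exI[of _ "\<bar>f (\<lambda>_. True)\<bar>"])
       (auto intro: finite_depthD[OF 0])
next
  case (Suc n)
  have "\<exists>\<phi> B. continuous_on UNIV \<phi> \<and> (\<forall>z. \<bar>\<phi> z\<bar> \<le> B) \<and>
    (\<forall>z. (\<forall>k. digit k z \<in> {0, 1}) \<longrightarrow> \<phi> z = f (fun_upd (\<lambda>k. digit k z = 1) n b))" for b
    by (intro Suc finite_depth_fun_upd)
  then obtain \<phi> B where \<phi>: "\<And>b::bool. continuous_on UNIV (\<phi> b)" "\<And>b z. \<bar>\<phi> b z\<bar> \<le> B b"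
    "\<And>b z. (\<And>k. digit k z \<in> {0, 1}) \<Longrightarrow> \<phi> b z = f (fun_upd (\<lambda>k. digit k z = 1) n b)"
    by metis
  show ?case
  proof (intro exI conjI allI impI)
    show "continuous_on UNIV (\<lambda>z. digit n z * \<phi> True z + (1 - digit n z) * \<phi> False z)"
      by (intro continuous_intros \<phi> continuous_digit)
    show "\<bar>digit n z * \<phi> True z + (1 - digit n z) * \<phi> False z\<bar> \<le> B True + B False" for z
    proof -
      have "\<bar>digit n z * \<phi> True z + (1 - digit n z) * \<phi> False z\<bar>
         \<le> \<bar>digit n z\<bar> * \<bar>\<phi> True z\<bar> + \<bar>1 - digit n z\<bar> * \<bar>\<phi> False z\<bar>"
        by (simp add: abs_mult[symmetric] abs_triangle_ineq)
      also have "\<dots> \<le> 1 * B True + 1 * B False"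
        using \<phi>(2)[of True z] \<phi>(2)[of False z] digit_bounds[of n z]
        by (intro add_mono mult_mono) auto
      finally show ?thesis by simp
    qed
    fix z assume d: "\<forall>k. digit k z \<in> {0, 1}"
    then have "digit n z = 0 \<or> digit n z = 1" by auto
    moreover have "\<phi> b z = f (\<lambda>k. digit k z = 1)" if "b = (digit n z = 1)" for b
      using \<phi>(3)[of z b] d that by (simp add: fun_upd_triv[of "\<lambda>k. digit k z = 1" n])
    ultimately show "digit n z * \<phi> True z + (1 - digit n z) * \<phi> False z = f (\<lambda>k. digit k z = 1)"
      by auto
  qed
qed

text \<open>The ternary images live in [0, 1] and are therefore tight, so a subsequence converges
  weakly on the line. Its limit is carried back to binary sequences by reading off digits.\<close>

lemma cantor_weak_compactness:
  fixes N :: "nat \<Rightarrow> (nat \<Rightarrow> bool) measure"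
  assumes N: "\<And>n. prob_space (N n)" and sets_N: "\<And>n. sets (N n) = sets cantor"
  shows "\<exists>r T. strict_mono r \<and> prob_space T \<and> sets T = sets cantor \<and>
    (\<forall>n (f::(nat \<Rightarrow> bool) \<Rightarrow> real). finite_depth n f \<longrightarrow> (\<lambda>k. \<integral>\<omega>. f \<omega> \<partial>N (r k)) \<longlonglongrightarrow> (\<integral>\<omega>. f \<omega> \<partial>T))"
proof -
  note sets_N [measurable_cong]
  have tern [measurable]: "ternary \<in> borel_measurable cantor"
    unfolding ternary_def[abs_def] by measurable
  have [measurable]: "digit k \<in> borel_measurable borel" for k
    by (intro borel_measurable_continuous_onI continuous_digit)
  define \<mu> where "\<mu> n = distr (N n) borel ternary" for n
  interpret N: prob_space "N n" for n by (rule N)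
  have \<mu>: "real_distribution (\<mu> n)" for n
    unfolding \<mu>_def by (intro N.real_distribution_distr) measurable
  have "tight \<mu>"
    unfolding tight_def
  proof (intro conjI allI impI \<mu>)
    fix \<epsilon> :: real assume "\<epsilon> > 0"
    \<comment> \<open>The intervals in \<open>tight\<close> are open on the left, so the left end
      has to lie below 0, the code of the constantly false sequence.\<close>
    have "measure (\<mu> n) {-1<..1} = 1" for n
    proof -
      have "-1 < ternary \<omega> \<and> ternary \<omega> \<le> 1" for \<omega>
        using ternary_bounds[of \<omega>] by linarith
      then have "ternary -` {-1<..1} \<inter> space (N n) = space (N n)" by auto
      then show ?thesis
        unfolding \<mu>_def by (subst measure_distr) (auto simp: N.prob_space)
    qed
    with \<open>\<epsilon> > 0\<close> show "\<exists>a b. a < b \<and> (\<forall>n. 1 - \<epsilon> < measure (\<mu> n) {a<..b})"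
      by (intro exI[of _ "-1"] exI[of _ 1]) auto
  qed
  from tight_imp_convergent_subsubsequence[OF this strict_mono_id] obtain r \<tau> where
    r: "strict_mono r" and \<tau>: "real_distribution \<tau>" and conv: "weak_conv_m (\<mu> \<circ> id \<circ> r) \<tau>"
    by blast
  have \<mu>r: "real_distribution ((\<mu> \<circ> id \<circ> r) k)" for k using \<mu> by simp
  interpret \<tau>: real_distribution \<tau> by (rule \<tau>)
  have lim: "(\<lambda>k. \<integral>\<omega>. \<phi> (ternary \<omega>) \<partial>N (r k)) \<longlonglongrightarrow> (\<integral>z. \<phi> z \<partial>\<tau>)"
    if \<phi>: "continuous_on UNIV \<phi>" "\<And>z. \<bar>\<phi> z\<bar> \<le> B" for \<phi> :: "real \<Rightarrow> real" and B
  proof -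
    have [measurable]: "\<phi> \<in> borel_measurable borel"
      by (intro borel_measurable_continuous_onI \<phi>)
    have "(\<lambda>n. integral\<^sup>L ((\<mu> \<circ> id \<circ> r) n) \<phi>) \<longlonglongrightarrow> integral\<^sup>L \<tau> \<phi>"
      by (rule weak_conv_imp_integral_bdd_continuous_conv[OF \<mu>r \<tau> conv, of \<phi> B])
         (use \<phi> in \<open>auto simp: continuous_on_eq_continuous_at\<close>)
    moreover have "integral\<^sup>L ((\<mu> \<circ> id \<circ> r) n) \<phi> = (\<integral>\<omega>. \<phi> (ternary \<omega>) \<partial>N (r n))" for n
      unfolding \<mu>_def by (simp add: integral_distr)
    ultimately show ?thesis by simp
  qed
  \<comment> \<open>The nonnegative continuous function d (1 - d) of the digit d vanishes on all
    ternary codes. Its integral is 0 along the sequence, hence also in the limit.\<close>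
  have "AE z in \<tau>. digit k z \<in> {0, 1}" for k
  proof -
    let ?\<phi> = "\<lambda>z. digit k z * (1 - digit k z)"
    have "(\<lambda>j. \<integral>\<omega>. ?\<phi> (ternary \<omega>) \<partial>N (r j)) \<longlonglongrightarrow> (\<integral>z. ?\<phi> z \<partial>\<tau>)"
      by (rule lim[of _ 1])
         (auto intro!: continuous_intros continuous_digit mult_le_one simp: abs_mult digit_bounds)
    moreover have "?\<phi> (ternary \<omega>) = 0" for \<omega>
      by (simp add: digit_ternary)
    ultimately have "(\<integral>z. ?\<phi> z \<partial>\<tau>) = 0"
      by (simp add: LIMSEQ_const_iff)
    moreover have "integrable \<tau> ?\<phi>"
      by (rule \<tau>.integrable_const_bound[of _ 1])
         (auto intro!: mult_le_one simp: abs_mult digit_bounds)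
    ultimately have "AE z in \<tau>. ?\<phi> z = 0"
      by (subst (asm) integral_nonneg_eq_0_iff_AE) (auto simp: digit_bounds)
    then show ?thesis by eventually_elim auto
  qed
  then have digits: "AE z in \<tau>. \<forall>k. digit k z \<in> {0, 1}"
    by (subst AE_all_countable) blast
  have [measurable]: "(\<lambda>z k. digit k z = 1) \<in> borel \<rightarrow>\<^sub>M cantor"
    by (rule measurable_PiM_single') auto
  define T where "T = distr \<tau> cantor (\<lambda>z k. digit k z = 1)"
  have "prob_space T"
    unfolding T_def by (rule \<tau>.prob_space_distr) measurable
  moreover have "sets T = sets cantor" unfolding T_def by simp
  moreover have "(\<lambda>k. \<integral>\<omega>. f \<omega> \<partial>N (r k)) \<longlonglongrightarrow> (\<integral>\<omega>. f \<omega> \<partial>T)"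
    if f: "finite_depth n f" for n and f :: "(nat \<Rightarrow> bool) \<Rightarrow> real"
  proof -
    obtain \<phi> B where \<phi>: "continuous_on UNIV \<phi>" "\<And>z. \<bar>\<phi> z\<bar> \<le> B"
      "\<And>z. (\<And>k. digit k z \<in> {0, 1}) \<Longrightarrow> \<phi> z = f (\<lambda>k. digit k z = 1)"
      using finite_depth_continuous_extension[OF f] by metis
    have [measurable]: "\<phi> \<in> borel_measurable borel"
      by (intro borel_measurable_continuous_onI \<phi>)
    have [measurable]: "f \<in> borel_measurable cantor"
      by (rule finite_depth_measurable[OF f])
    have "\<phi> (ternary \<omega>) = f \<omega>" for \<omega>
      using \<phi>(3)[of "ternary \<omega>"] by (simp add: digit_ternary)
    moreover have "(\<integral>z. \<phi> z \<partial>\<tau>) = (\<integral>\<omega>. f \<omega> \<partial>T)"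
    proof -
      have "(\<integral>\<omega>. f \<omega> \<partial>T) = (\<integral>z. f (\<lambda>k. digit k z = 1) \<partial>\<tau>)"
        unfolding T_def by (rule integral_distr) measurable
      also have "\<dots> = (\<integral>z. \<phi> z \<partial>\<tau>)"
        by (rule integral_cong_AE) (use digits in \<open>auto simp: \<phi>(3)\<close>)
      finally show ?thesis ..
    qed
    ultimately show ?thesis
      using lim[OF \<phi>(1,2)] by simp
  qed
  ultimately show ?thesis
    using r by blast
qed

section \<open>Existence of optimal couplings\<close>

lemma finite_depth_bounded:
  assumes "finite_depth n (f :: (nat \<Rightarrow> bool) \<Rightarrow> real)"
  shows "\<exists>B. \<forall>\<omega>. \<bar>f \<omega>\<bar> \<le> B"
proof -
  obtain \<phi> B where B: "\<And>z. \<bar>\<phi> z\<bar> \<le> B"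
      "\<And>z. (\<And>k. digit k z \<in> {0, 1}) \<Longrightarrow> \<phi> z = f (\<lambda>k. digit k z = 1)"
    using finite_depth_continuous_extension[OF assms] by metis
  have "\<phi> (ternary \<omega>) = f \<omega>" for \<omega>
    using B(2)[of "ternary \<omega>"] by (simp add: digit_ternary)
  with B(1) show ?thesis by metis
qed

lemma finite_depth_integrable:
  assumes "finite_depth n (f :: (nat \<Rightarrow> bool) \<Rightarrow> real)" "finite_measure P" "sets P = sets cantor"
  shows "integrable P f"
proof -
  interpret finite_measure P by fact
  note assms(3)[measurable_cong]
  obtain B where "\<forall>\<omega>. \<bar>f \<omega>\<bar> \<le> B" using finite_depth_bounded[OF assms(1)] ..
  moreover have [measurable]: "f \<in> borel_measurable cantor" by (rule finite_depth_measurable[OF assms(1)])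
  ultimately show ?thesis by (intro integrable_const_bound[of _ B]) auto
qed

text \<open>Indicators of cylinders have finite depth, and cylinders form an intersection-stable
  generator.\<close>

lemma cantor_measure_eqI:
  assumes P: "finite_measure P" "sets P = sets cantor" and Q: "finite_measure Q" "sets Q = sets cantor"
    and eq: "\<And>n (f :: (nat \<Rightarrow> bool) \<Rightarrow> real). finite_depth n f \<Longrightarrow> (\<integral>\<omega>. f \<omega> \<partial>P) = (\<integral>\<omega>. f \<omega> \<partial>Q)"
  shows "P = Q"
proof (rule measure_eqI_PiM_infinite[OF P(2) Q(2)])
  interpret P: finite_measure P by fact
  interpret Q: finite_measure Q by fact
  fix A :: "nat \<Rightarrow> bool set" and J :: "nat set"
  assume J: "finite J"
  let ?X = "prod_emb UNIV (\<lambda>i. count_space UNIV) J (Pi\<^sub>E J A)"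
  have X: "?X = {\<omega>. \<forall>i\<in>J. \<omega> i \<in> A i}"
    by (auto simp: prod_emb_def PiE_iff space_PiM extensional_def)
  have "?X \<in> sets cantor"
    using J by (intro measurable_prod_emb sets_PiM_I_finite) auto
  \<comment> \<open>Inserting 0 keeps \<open>Max\<close> meaningful when \<open>J\<close> is
    empty.\<close>
  moreover have "finite_depth (Suc (Max (insert 0 J))) (indicat_real ?X)"
    unfolding finite_depth_def X
  proof (intro allI impI)
    fix \<omega> \<omega>' :: "nat \<Rightarrow> bool" assume *: "\<forall>i<Suc (Max (insert 0 J)). \<omega> i = \<omega>' i"
    have "\<omega> i = \<omega>' i" if "i \<in> J" for i
      using * J that by (auto simp: less_Suc_eq_le)
    then show "indicat_real {\<omega>. \<forall>i\<in>J. \<omega> i \<in> A i} \<omega> = indicat_real {\<omega>. \<forall>i\<in>J. \<omega> i \<in> A i} \<omega>'"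
      by (auto simp: indicator_def)
  qed
  ultimately have "measure P ?X = measure Q ?X"
    using eq P(2) Q(2) by fastforce
  then show "emeasure P ?X = emeasure Q ?X"
    by (simp add: P.emeasure_eq_measure Q.emeasure_eq_measure)
qed (rule P)

section \<open>Coding the points of a separable space by binary sequences\<close>

lemma geometric_Cauchy:
  fixes f :: "nat \<Rightarrow> 'a::metric_space"
  assumes "\<And>n. dist (f (Suc n)) (f n) \<le> 2 * (1/2) ^ n"
  shows "Cauchy f"
proof -
  \<comment> \<open>The step bound 2 (1/2)^n is the difference 4 (1/2)^n - 4 (1/2)^(n+1), so the sum
    telescopes.\<close>
  have *: "dist (f (n + k)) (f n) \<le> 4 * (1/2) ^ n - 4 * (1/2) ^ (n + k)" for n k
  proof (induction k)
    case (Suc k)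
    have "dist (f (n + Suc k)) (f n) \<le> dist (f (Suc (n + k))) (f (n + k)) + dist (f (n + k)) (f n)"
      by (simp add: dist_triangle)
    then show ?case
      using Suc assms[of "n + k"] by simp
  qed simp
  show ?thesis
  proof (rule CauchyI')
    fix e :: real assume "e > 0"
    then obtain M where M: "(1/2) ^ M < e / 4"
      using real_arch_pow_inv[of "e/4" "1/2"] by auto
    have "dist (f m) (f n) < e" if mn: "M \<le> m" "m < n" for m n
    proof -
      obtain k where k: "n = m + k" using mn by (metis less_imp_add_positive)
      have "dist (f m) (f n) \<le> 4 * (1/2) ^ m - 4 * (1/2) ^ (m + k)"
        using *[of m k] by (simp add: k dist_commute)
      also have "\<dots> \<le> 4 * (1/2) ^ m" by simp
      also have "\<dots> \<le> 4 * (1/2) ^ M"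
        using mn by (intro mult_left_mono power_decreasing) auto
      finally show ?thesis using M by simp
    qed
    then show "\<exists>M. \<forall>m\<ge>M. \<forall>n>m. dist (f m) (f n) < e" by blast
  qed
qed

context dense_sequence
begin

definition code :: "'a \<Rightarrow> nat \<Rightarrow> bool" where
  "code x k \<longleftrightarrow> (case prod_decode k of (i, j) \<Rightarrow> dist (q i) x < (1/2) ^ j)"

definition index :: "nat \<Rightarrow> (nat \<Rightarrow> bool) \<Rightarrow> nat" where
  "index j \<omega> = (LEAST i. \<omega> (prod_encode (i, j)))"

text \<open>
  The index is only updated when this keeps the approximations Cauchy, so that the decoding below
  converges for every binary sequence and not only for those in the range of the coding.
\<close>

primrec stable_index :: "nat \<Rightarrow> (nat \<Rightarrow> bool) \<Rightarrow> nat" where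
  "stable_index 0 \<omega> = index 0 \<omega>"
| "stable_index (Suc j) \<omega> =
     (if dist (q (index (Suc j) \<omega>)) (q (stable_index j \<omega>)) \<le> 2 * (1/2) ^ j
      then index (Suc j) \<omega> else stable_index j \<omega>)"

lemma code_measurable [measurable]: "code \<in> borel \<rightarrow>\<^sub>M cantor"
proof (rule measurable_PiM_single')
  fix k
  obtain i j where k: "prod_decode k = (i, j)" by fastforce
  show "(\<lambda>x. code x k) \<in> borel \<rightarrow>\<^sub>M count_space UNIV"
    unfolding code_def k prod.case by (rule borel_measurable_pred_less) auto
qed auto

lemma index_measurable [measurable]: "index j \<in> cantor \<rightarrow>\<^sub>M count_space UNIV"
  unfolding index_def[abs_def] by measurable

lemma stable_index_measurable [measurable]: "stable_index j \<in> cantor \<rightarrow>\<^sub>M count_space UNIV"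
proof (induction j)
  case (Suc j)
  note [measurable] = Suc
  show ?case
    unfolding stable_index.simps[abs_def] by measurable
qed (simp add: index_measurable)

lemma dist_index_code: "dist (q (index j (code x))) x < (1/2) ^ j"
proof -
  have "\<exists>i. code x (prod_encode (i, j))"
    using dense[of "(1/2) ^ j" x] by (auto simp: code_def)
  from LeastI_ex[OF this] show ?thesis
    unfolding index_def by (simp add: code_def)
qed

text \<open>For genuine codes the update test always passes: consecutive approximations are within
  (1/2)^(j+1) + (1/2)^j of each other, which is below the threshold 2 (1/2)^j.\<close>

lemma stable_index_code: "stable_index j (code x) = index j (code x)"
proof (induction j)
  case (Suc j)
  have "dist (q (index (Suc j) (code x))) (q (index j (code x)))
      \<le> dist (q (index (Suc j) (code x))) x + dist (q (index j (code x))) x"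
    by (rule dist_triangle2)
  also have "\<dots> \<le> (1/2) ^ Suc j + (1/2) ^ j"
    using dist_index_code[of "Suc j" x] dist_index_code[of j x] by linarith
  also have "\<dots> \<le> 2 * (1/2) ^ j" by simp
  finally show ?case by (simp add: Suc)
qed simp

text \<open>The search for the least true bit stops at a known true bit, so it inspects only
  finitely many bits. This is what makes truncated costs functions of finite depth.\<close>

lemma index_cong:
  assumes "i0 \<le> n" "\<omega> (prod_encode (i0, j))"
    and "\<And>i. i \<le> n \<Longrightarrow> \<omega> (prod_encode (i, j)) = \<omega>' (prod_encode (i, j))"
  shows "index j \<omega> = index j \<omega>'"
proof -
  let ?P = "\<lambda>i. \<omega> (prod_encode (i, j))"
  have L: "?P (index j \<omega>)" "index j \<omega> \<le> i0"
    unfolding index_def using assms(2) by (auto intro: LeastI Least_le)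
  have "(LEAST i. \<omega>' (prod_encode (i, j))) = index j \<omega>"
  proof (rule Least_equality)
    show "\<omega>' (prod_encode (index j \<omega>, j))"
      using L assms by (metis order.trans)
    fix i assume i: "\<omega>' (prod_encode (i, j))"
    show "index j \<omega> \<le> i"
    proof (cases "i \<le> n")
      case True
      then have "?P i" using i assms(3) by blast
      then show ?thesis unfolding index_def by (rule Least_le)
    next
      case False
      then show ?thesis using L assms(1) by linarith
    qed
  qed
  then show ?thesis by (simp add: index_def)
qed

lemma convergent_stable_index: "Cauchy (\<lambda>j. q (stable_index j \<omega>))"
  by (rule geometric_Cauchy) auto

end

text \<open>The left inverse is total: completeness provides the limit of the stable approximations
  for every sequence, so arbitrary measures on sequences can be pushed forward.\<close>

lemma ex_measurable_decoding:
  fixes q :: "nat \<Rightarrow> 'a::complete_space"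
  assumes "dense_sequence q"
  shows "\<exists>decode. decode \<in> borel_measurable cantor \<and> (\<forall>x. decode (dense_sequence.code q x) = x)"
proof -
  interpret dense_sequence q by fact
  let ?d = "\<lambda>\<omega>. lim (\<lambda>j. q (stable_index j \<omega>))"
  have lim: "(\<lambda>j. q (stable_index j \<omega>)) \<longlonglongrightarrow> ?d \<omega>" for \<omega>
    using convergent_stable_index[of \<omega>] Cauchy_convergent convergent_LIMSEQ_iff by blast
  have "?d \<in> borel_measurable cantor"
  proof (rule borel_measurable_LIMSEQ_metric[OF _ lim])
    show "(\<lambda>\<omega>. q (stable_index j \<omega>)) \<in> borel_measurable cantor" for j
      by (rule measurable_compose[OF stable_index_measurable]) simp
  qed
  moreover have "?d (code x) = x" for x
  proof (rule LIMSEQ_unique[OF lim])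
    have "(\<lambda>j. dist (q (index j (code x))) x) \<longlonglongrightarrow> 0"
    proof (rule tendsto_sandwich[of "\<lambda>_. 0" _ _ "\<lambda>j. (1/2) ^ j"])
      show "(\<lambda>j. (1/2::real) ^ j) \<longlonglongrightarrow> 0" by (rule LIMSEQ_power_zero) simp
    qed (auto intro!: always_eventually less_imp_le dist_index_code)
    then show "(\<lambda>j. q (stable_index j (code x))) \<longlonglongrightarrow> x"
      unfolding stable_index_code by (subst (asm) tendsto_dist_iff[symmetric])
  qed
  ultimately show ?thesis by blast
qed

definition coupling_cost :: "('a::metric_space \<times> 'a) measure \<Rightarrow> ennreal" where
  "coupling_cost \<sigma> = (\<integral>\<^sup>+ p. ennreal ((dist (fst p) (snd p))\<^sup>2) \<partial>\<sigma>)"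

lemma transport_cost_eq_INF: "transport_cost \<mu> \<nu> = (INF \<sigma>\<in>couplings \<mu> \<nu>. coupling_cost \<sigma>)"
  unfolding transport_cost_def coupling_cost_def case_prod_unfold ..

lemma couplingsD:
  assumes "\<sigma> \<in> couplings \<mu> \<nu>"
  shows "prob_space \<sigma>" "sets \<sigma> = sets borel" "distr \<sigma> borel fst = \<mu>" "distr \<sigma> borel snd = \<nu>"
  using assms by (auto simp: couplings_def borel_probs_def)

text \<open>A minimising sequence of couplings, coded by binary sequences, has a weak limit. All its
  members have the same marginals, so the limit has exactly the coded marginals. Hence almost every
  sequence under the limit behaves like a code and can be decoded. The cost is lower semicontinuous
  because finite-depth functions approximate it from below.\<close>

theorem ex_optimal_coupling:
  fixes q :: "nat \<Rightarrow> 'a::complete_space"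
  assumes q: "dense_sequence q" and fin: "transport_cost \<mu> (\<nu> :: 'a measure) < \<infinity>"
    and \<mu>: "sets \<mu> = sets borel" and \<nu>: "sets \<nu> = sets borel"
  shows "\<exists>\<sigma>\<in>couplings \<mu> \<nu>. coupling_cost \<sigma> = transport_cost \<mu> \<nu>"
proof -
  interpret dense_sequence q by fact
  note \<mu> [measurable_cong] \<nu> [measurable_cong]
  obtain decode where dec [measurable]: "decode \<in> borel_measurable cantor" and decode: "\<And>x. decode (code x) = x"
    using ex_measurable_decoding[OF q] by blast
  let ?tc = "transport_cost \<mu> \<nu>"
  have "\<exists>\<sigma>\<in>couplings \<mu> \<nu>. coupling_cost \<sigma> < ?tc + ennreal (1 / Suc n)" for n
  proof -
    have "?tc < ?tc + ennreal (1 / Suc n)"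
      using fin by (simp add: ennreal_add_left_cancel_less)
    then show ?thesis
      by (subst (asm) transport_cost_eq_INF) (auto simp: INF_less_iff)
  qed
  then obtain \<sigma> where \<sigma>: "\<And>n. \<sigma> n \<in> couplings \<mu> \<nu>" and
    cost: "\<And>n. coupling_cost (\<sigma> n) < ?tc + ennreal (1 / Suc n)"
    by metis
  note \<sigma>D = couplingsD[OF \<sigma>]
  note \<sigma>D(2)[measurable_cong]
  \<comment> \<open>The codes of the two points are interleaved, the first on even and the second on
    odd positions.\<close>
  define F where "F p = (\<lambda>k. if even k then code (fst p) (k div 2) else code (snd p) (k div 2))" for p
  have code_k [measurable]: "Measurable.pred borel (\<lambda>x. code x k)" for k
    using measurable_compose[OF code_measurable measurable_component_singleton[of k]] by simp
  have [measurable]: "F \<in> borel \<rightarrow>\<^sub>M cantor"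
  proof (rule measurable_PiM_single')
    show "(\<lambda>p. F p k) \<in> borel \<rightarrow>\<^sub>M count_space UNIV" for k
      unfolding F_def by measurable
  qed auto
  define N where "N n = distr (\<sigma> n) cantor F" for n
  have "prob_space (N n)" for n
    unfolding N_def by (rule prob_space.prob_space_distr[OF \<sigma>D(1)]) measurable
  moreover have "sets (N n) = sets cantor" for n
    unfolding N_def by simp
  ultimately obtain r T where r: "strict_mono r" and T: "prob_space T" and
    sets_T [measurable_cong]: "sets T = sets cantor" and
    lim: "\<And>n f::(nat \<Rightarrow> bool) \<Rightarrow> real. finite_depth n f \<Longrightarrow> (\<lambda>k. \<integral>\<omega>. f \<omega> \<partial>N (r k)) \<longlonglongrightarrow> (\<integral>\<omega>. f \<omega> \<partial>T)"
    using cantor_weak_compactness[of N] by blast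
  interpret T: prob_space T by fact
  define ev where "ev \<omega> = (\<lambda>k. \<omega> (2 * k))" for \<omega> :: "nat \<Rightarrow> bool"
  define od where "od \<omega> = (\<lambda>k. \<omega> (2 * k + 1))" for \<omega> :: "nat \<Rightarrow> bool"
  have ev [measurable]: "ev \<in> cantor \<rightarrow>\<^sub>M cantor" and od [measurable]: "od \<in> cantor \<rightarrow>\<^sub>M cantor"
    unfolding ev_def od_def by (auto intro!: measurable_PiM_single')
  have evF: "ev (F p) = code (fst p)" and odF: "od (F p) = code (snd p)" for p
    unfolding ev_def od_def F_def by auto
  \<comment> \<open>Finite-depth integrals of a marginal are constant along the sequence, so the
    limit inherits the marginal itself. The first n even, or odd, bits are among the first 2 n
    bits.\<close>
  have marg: "distr T cantor e = distr \<rho> cantor code"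
    if e: "\<And>n f::(nat \<Rightarrow> bool) \<Rightarrow> real. finite_depth n f \<Longrightarrow> finite_depth (2 * n) (\<lambda>\<omega>. f (e \<omega>))"
      and [measurable]: "e \<in> cantor \<rightarrow>\<^sub>M cantor" and eF: "\<And>p. e (F p) = code (h p)"
      and [measurable]: "h \<in> borel \<rightarrow>\<^sub>M borel" and \<rho>: "\<And>n. distr (\<sigma> n) borel h = \<rho>"
    for e h \<rho>
  proof -
    have "prob_space \<rho>"
      unfolding \<rho>[of 0, symmetric] by (rule prob_space.prob_space_distr[OF \<sigma>D(1)]) measurable
    then interpret \<rho>: prob_space \<rho> .
    have sets_\<rho> [measurable_cong]: "sets \<rho> = sets borel"
      unfolding \<rho>[of 0, symmetric] by simp
    show ?thesis
    proof (rule cantor_measure_eqI)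
      show "finite_measure (distr T cantor e)" by (rule T.finite_measure_distr) measurable
      show "finite_measure (distr \<rho> cantor code)" by (rule \<rho>.finite_measure_distr) measurable
      fix n and f :: "(nat \<Rightarrow> bool) \<Rightarrow> real" assume f: "finite_depth n f"
      note [measurable] = finite_depth_measurable[OF f]
      have "(\<integral>\<omega>. f (e \<omega>) \<partial>N k) = (\<integral>x. f (code x) \<partial>\<rho>)" for k
      proof -
        have "(\<integral>\<omega>. f (e \<omega>) \<partial>N k) = (\<integral>p. f (code (h p)) \<partial>\<sigma> k)"
          unfolding N_def by (subst integral_distr) (auto simp: eF)
        also have "\<dots> = (\<integral>x. f (code x) \<partial>\<rho>)"
          unfolding \<rho>[of k, symmetric] by (subst integral_distr) auto
        finally show ?thesis .
      qed
      with lim[OF e[OF f]] have "(\<integral>\<omega>. f (e \<omega>) \<partial>T) = (\<integral>x. f (code x) \<partial>\<rho>)"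
        by (simp add: LIMSEQ_const_iff)
      then show "(\<integral>\<omega>. f \<omega> \<partial>distr T cantor e) = (\<integral>\<omega>. f \<omega> \<partial>distr \<rho> cantor code)"
        by (simp add: integral_distr)
    qed simp_all
  qed
  have fd_ev: "finite_depth (2 * n) (\<lambda>\<omega>. f (ev \<omega>))" and fd_od: "finite_depth (2 * n) (\<lambda>\<omega>. f (od \<omega>))"
    if "finite_depth n f" for n and f :: "(nat \<Rightarrow> bool) \<Rightarrow> real"
    using that unfolding finite_depth_def ev_def od_def by auto
  have marg_ev: "distr T cantor ev = distr \<mu> cantor code"
    by (rule marg[of _ fst]) (auto simp: \<sigma>D evF fd_ev)
  have marg_od: "distr T cantor od = distr \<nu> cantor code"
    by (rule marg[of _ snd]) (auto simp: \<sigma>D odF fd_od)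
  define H where "H \<omega> = (decode (ev \<omega>), decode (od \<omega>))" for \<omega>
  have [measurable]: "H \<in> cantor \<rightarrow>\<^sub>M borel"
    unfolding H_def by measurable
  define \<tau> where "\<tau> = distr T borel H"
  have "prob_space \<tau>"
    unfolding \<tau>_def by (rule T.prob_space_distr) measurable
  moreover have dd: "distr (distr \<rho> cantor code) borel decode = \<rho>" if "sets \<rho> = sets borel" for \<rho> :: "'a measure"
  proof -
    note that [measurable_cong]
    show ?thesis
      by (subst distr_distr) (auto simp: comp_def decode intro: distr_id2[OF that[symmetric]])
  qed
  have "distr \<tau> borel fst = \<mu>"
  proof -
    have "distr \<tau> borel fst = distr (distr T cantor ev) borel decode"
      unfolding \<tau>_def by (subst (1 2) distr_distr) (auto simp: comp_def H_def)
    then show ?thesis by (simp add: marg_ev dd \<mu>)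
  qed
  moreover have "distr \<tau> borel snd = \<nu>"
  proof -
    have "distr \<tau> borel snd = distr (distr T cantor od) borel decode"
      unfolding \<tau>_def by (subst (1 2) distr_distr) (auto simp: comp_def H_def)
    then show ?thesis by (simp add: marg_od dd \<nu>)
  qed
  ultimately have "\<tau> \<in> couplings \<mu> \<nu>"
    by (simp add: couplings_def borel_probs_def \<tau>_def)
  moreover have "coupling_cost \<tau> \<le> ?tc"
  proof -
    \<comment> \<open>Each centre approximates its point up to (1/2)^j. Subtracting both errors
      makes this a lower bound for the true distance of coded points.\<close>
    define a where "a j \<omega> = max 0 (dist (q (index j (ev \<omega>))) (q (index j (od \<omega>))) - 2 * (1/2) ^ j)" for j \<omega>
    \<comment> \<open>The guard says that both searches succeed among the first I + 1 centres;
      without it the indices would depend on infinitely many bits.\<close>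
    define G where "G I j \<omega> \<longleftrightarrow> (\<exists>i\<le>I. ev \<omega> (prod_encode (i, j))) \<and> (\<exists>i\<le>I. od \<omega> (prod_encode (i, j)))" for I j \<omega>
    define s where "s I j \<omega> = (if G I j \<omega> then (a j \<omega>)\<^sup>2 else 0)" for I j \<omega>
    have [measurable]: "(\<lambda>\<omega>. q (index j \<omega>)) \<in> cantor \<rightarrow>\<^sub>M borel" for j
      by (rule measurable_compose[OF index_measurable]) simp
    have [measurable]: "a j \<in> borel_measurable cantor" for j
      unfolding a_def[abs_def] by measurable
    \<comment> \<open>The summand 1 accounts for the odd positions; the even positions used are one
      lower.\<close>
    have "finite_depth (Suc (Max ((\<lambda>i. 2 * prod_encode (i, j) + 1) ` {..I}))) (s I j)" for I j
      unfolding finite_depth_def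
    proof (intro allI impI)
      fix \<omega> \<omega>' :: "nat \<Rightarrow> bool"
      assume eq: "\<forall>i<Suc (Max ((\<lambda>i. 2 * prod_encode (i, j) + 1) ` {..I})). \<omega> i = \<omega>' i"
      have le: "2 * prod_encode (i, j) + 1 \<le> Max ((\<lambda>i. 2 * prod_encode (i, j) + 1) ` {..I})" if "i \<le> I" for i
        using that by (intro Max_ge) auto
      have e: "ev \<omega> (prod_encode (i, j)) = ev \<omega>' (prod_encode (i, j))"
        "od \<omega> (prod_encode (i, j)) = od \<omega>' (prod_encode (i, j))" if "i \<le> I" for i
        using le[OF that] eq by (auto simp: ev_def od_def)
      then have "G I j \<omega> = G I j \<omega>'"
        unfolding G_def by auto
      moreover have "a j \<omega> = a j \<omega>'" if "G I j \<omega>"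
      proof -
        obtain i1 i2 where "i1 \<le> I" "ev \<omega> (prod_encode (i1, j))" "i2 \<le> I" "od \<omega> (prod_encode (i2, j))"
          using \<open>G I j \<omega>\<close> unfolding G_def by blast
        then have "index j (ev \<omega>) = index j (ev \<omega>')" "index j (od \<omega>) = index j (od \<omega>')"
          using index_cong[of i1 I "ev \<omega>" j "ev \<omega>'"] index_cong[of i2 I "od \<omega>" j "od \<omega>'"] e by blast+
        then show ?thesis by (simp add: a_def)
      qed
      ultimately show "s I j \<omega> = s I j \<omega>'"
        by (simp add: s_def)
    qed
    then have fd: "\<exists>n. finite_depth n (s I j)" for I j by blast
    have s_meas [measurable]: "s I j \<in> borel_measurable cantor" for I j
      using fd finite_depth_measurable by blast
    have s_nn: "0 \<le> s I j \<omega>" for I j \<omega> by (simp add: s_def)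
    have s_le: "s I j (F p) \<le> (dist (fst p) (snd p))\<^sup>2" for I j p
    proof -
      have "dist (q (index j (code (fst p)))) (q (index j (code (snd p))))
          \<le> dist (q (index j (code (fst p)))) (fst p) + dist (fst p) (snd p) + dist (q (index j (code (snd p)))) (snd p)"
        by (metis (no_types, opaque_lifting) add_mono_thms_linordered_semiring(3) dist_commute dist_triangle order_trans)
      then have "a j (F p) \<le> dist (fst p) (snd p)"
        using dist_index_code[of j "fst p"] dist_index_code[of j "snd p"]
        unfolding a_def evF odF by auto
      then have "(a j (F p))\<^sup>2 \<le> (dist (fst p) (snd p))\<^sup>2"
        by (intro power_mono) (auto simp: a_def)
      then show ?thesis by (auto simp: s_def)
    qed
    have step: "(\<integral>\<^sup>+\<omega>. ennreal (s I j \<omega>) \<partial>T) \<le> ?tc" for I j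
    proof -
      obtain n where n: "finite_depth n (s I j)" using fd by blast
      have "ennreal (\<integral>\<omega>. s I j \<omega> \<partial>N (r k)) \<le> ?tc + ennreal (1 / Suc (r k))" for k
      proof -
        have "ennreal (\<integral>\<omega>. s I j \<omega> \<partial>N (r k)) = (\<integral>\<^sup>+\<omega>. ennreal (s I j \<omega>) \<partial>N (r k))"
        proof (rule nn_integral_eq_integral[symmetric])
          show "integrable (N (r k)) (s I j)"
            unfolding N_def
            by (intro finite_depth_integrable[OF n] prob_space.finite_measure prob_space.prob_space_distr[OF \<sigma>D(1)]) auto
        qed (simp add: s_nn)
        also have "\<dots> = (\<integral>\<^sup>+p. ennreal (s I j (F p)) \<partial>\<sigma> (r k))"
          unfolding N_def by (subst nn_integral_distr) auto
        also have "\<dots> \<le> coupling_cost (\<sigma> (r k))"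
          unfolding coupling_cost_def by (intro nn_integral_mono ennreal_leI s_le)
        also have "\<dots> \<le> ?tc + ennreal (1 / Suc (r k))"
          by (rule less_imp_le[OF cost])
        finally show ?thesis .
      qed
      moreover have "(\<lambda>k. ennreal (\<integral>\<omega>. s I j \<omega> \<partial>N (r k))) \<longlonglongrightarrow> ennreal (\<integral>\<omega>. s I j \<omega> \<partial>T)"
        by (intro tendsto_ennrealI lim[OF n])
      moreover have "(\<lambda>k. ?tc + ennreal (1 / Suc (r k))) \<longlonglongrightarrow> ?tc + ennreal 0"
      proof (intro tendsto_add tendsto_const tendsto_ennrealI)
        have "(\<lambda>n. 1 / real (Suc n)) \<longlonglongrightarrow> 0" by (rule LIMSEQ_Suc[OF lim_1_over_n])
        from LIMSEQ_subseq_LIMSEQ[OF this r] show "(\<lambda>k. 1 / real (Suc (r k))) \<longlonglongrightarrow> 0"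
          by (simp add: comp_def)
      qed
      ultimately have "ennreal (\<integral>\<omega>. s I j \<omega> \<partial>T) \<le> ?tc + ennreal 0"
        using LIMSEQ_le by blast
      moreover have "(\<integral>\<^sup>+\<omega>. ennreal (s I j \<omega>) \<partial>T) = ennreal (\<integral>\<omega>. s I j \<omega> \<partial>T)"
        by (rule nn_integral_eq_integral)
           (auto simp: s_nn intro!: finite_depth_integrable[OF n] T.finite_measure_axioms sets_T)
      ultimately show ?thesis by simp
    qed
    \<comment> \<open>The approximation properties hold for every code, hence almost surely for the
      coded marginal, which is also the marginal of \<open>T\<close>.\<close>
    have good: "AE \<omega> in T. \<forall>j. (\<exists>i. e \<omega> (prod_encode (i, j))) \<and> dist (q (index j (e \<omega>))) (decode (e \<omega>)) \<le> (1/2) ^ j"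
      if e: "e \<in> cantor \<rightarrow>\<^sub>M cantor" and m: "distr T cantor e = distr \<rho> cantor code" and [measurable_cong]: "sets \<rho> = sets borel"
      for e and \<rho> :: "'a measure"
    proof -
      let ?P = "\<lambda>\<omega>. \<forall>j. (\<exists>i. \<omega> (prod_encode (i, j))) \<and> dist (q (index j \<omega>)) (decode \<omega>) \<le> (1/2) ^ j"
      have "?P (code x)" for x
        using dist_index_code[of _ x] dense[of "(1/2) ^ _" x]
        by (auto simp: decode less_imp_le code_def)
      then have "AE \<omega> in distr \<rho> cantor code. ?P \<omega>"
        by (subst AE_distr_iff) auto
      then show ?thesis
        unfolding m[symmetric] by (rule AE_distrD[rotated]) (use e in measurable)
    qed
    \<comment> \<open>The supremum over I removes the guard and the limit in j removes the error.
      Monotone convergence and Fatou's lemma then transfer the bounds of \<open>step\<close> to the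
      cost.\<close>
    have "AE \<omega> in T. ennreal ((dist (fst (H \<omega>)) (snd (H \<omega>)))\<^sup>2) = liminf (\<lambda>j. SUP I. ennreal (s I j \<omega>))"
      using good[OF ev marg_ev \<mu>] good[OF od marg_od \<nu>]
    proof eventually_elim
      case (elim \<omega>)
      have "(\<lambda>j. q (index j (ev \<omega>))) \<longlonglongrightarrow> decode (ev \<omega>)"
        by (rule tendsto_dist_iff[THEN iffD2], rule tendsto_sandwich[of "\<lambda>_. 0" _ _ "\<lambda>j. (1/2) ^ j"])
           (use elim in \<open>auto intro!: LIMSEQ_power_zero\<close>)
      moreover have "(\<lambda>j. q (index j (od \<omega>))) \<longlonglongrightarrow> decode (od \<omega>)"
        by (rule tendsto_dist_iff[THEN iffD2], rule tendsto_sandwich[of "\<lambda>_. 0" _ _ "\<lambda>j. (1/2) ^ j"])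
           (use elim in \<open>auto intro!: LIMSEQ_power_zero\<close>)
      moreover have "(\<lambda>j. (1/2::real) ^ j) \<longlonglongrightarrow> 0" by (rule LIMSEQ_power_zero) simp
      ultimately have "(\<lambda>j. (a j \<omega>)\<^sup>2) \<longlonglongrightarrow> (max 0 (dist (decode (ev \<omega>)) (decode (od \<omega>)) - 2 * 0))\<^sup>2"
        unfolding a_def by (intro tendsto_intros) simp_all
      then have "(\<lambda>j. ennreal ((a j \<omega>)\<^sup>2)) \<longlonglongrightarrow> ennreal ((dist (fst (H \<omega>)) (snd (H \<omega>)))\<^sup>2)"
        by (intro tendsto_ennrealI) (simp add: H_def)
      then have "liminf (\<lambda>j. ennreal ((a j \<omega>)\<^sup>2)) = ennreal ((dist (fst (H \<omega>)) (snd (H \<omega>)))\<^sup>2)"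
        by (rule lim_imp_Liminf[OF sequentially_bot])
      moreover have "(SUP I. ennreal (s I j \<omega>)) = ennreal ((a j \<omega>)\<^sup>2)" for j
      proof (rule antisym)
        show "(SUP I. ennreal (s I j \<omega>)) \<le> ennreal ((a j \<omega>)\<^sup>2)"
          by (rule SUP_least) (auto simp: s_def)
        obtain i1 i2 where "ev \<omega> (prod_encode (i1, j))" "od \<omega> (prod_encode (i2, j))"
          using elim by blast
        then have "G (max i1 i2) j \<omega>" unfolding G_def by (metis max.cobounded1 max.cobounded2)
        then have "ennreal ((a j \<omega>)\<^sup>2) = ennreal (s (max i1 i2) j \<omega>)" by (simp add: s_def)
        also have "\<dots> \<le> (SUP I. ennreal (s I j \<omega>))" by (rule SUP_upper) simp
        finally show "ennreal ((a j \<omega>)\<^sup>2) \<le> (SUP I. ennreal (s I j \<omega>))" .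
      qed
      ultimately show ?case
        by simp
    qed
    then have "coupling_cost \<tau> = (\<integral>\<^sup>+\<omega>. liminf (\<lambda>j. SUP I. ennreal (s I j \<omega>)) \<partial>T)"
      unfolding coupling_cost_def \<tau>_def by (subst nn_integral_distr) (auto intro: nn_integral_cong_AE)
    also have "\<dots> \<le> liminf (\<lambda>j. \<integral>\<^sup>+\<omega>. (SUP I. ennreal (s I j \<omega>)) \<partial>T)"
      by (intro nn_integral_liminf) measurable
    also have "\<dots> \<le> ?tc"
    proof -
      have "(\<integral>\<^sup>+\<omega>. (SUP I. ennreal (s I j \<omega>)) \<partial>T) = (SUP I. \<integral>\<^sup>+\<omega>. ennreal (s I j \<omega>) \<partial>T)" for j
      proof (rule nn_integral_monotone_convergence_SUP)
        show "incseq (\<lambda>I \<omega>. ennreal (s I j \<omega>))"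
        proof (intro incseq_SucI le_funI ennreal_leI)
          fix I \<omega>
          have "G I j \<omega> \<Longrightarrow> G (Suc I) j \<omega>" unfolding G_def using le_Suc_eq by blast
          then show "s I j \<omega> \<le> s (Suc I) j \<omega>" by (auto simp: s_def)
        qed
      qed measurable
      then have "(\<integral>\<^sup>+\<omega>. (SUP I. ennreal (s I j \<omega>)) \<partial>T) \<le> ?tc" for j
        using step by (simp add: SUP_least)
      then have "liminf (\<lambda>j. \<integral>\<^sup>+\<omega>. (SUP I. ennreal (s I j \<omega>)) \<partial>T) \<le> liminf (\<lambda>_::nat. ?tc)"
        by (intro Liminf_mono) auto
      then show ?thesis by (simp add: Liminf_const)
    qed
    finally show ?thesis .
  qed
  moreover have "?tc \<le> coupling_cost \<tau>"
    using \<open>\<tau> \<in> couplings \<mu> \<nu>\<close> unfolding transport_cost_eq_INF by (rule INF_lower)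
  ultimately show ?thesis by (meson antisym)
qed

section \<open>Measurable selection of geodesics\<close>

text \<open>
  A sequence of points \<open>z k \<in> A k\<close> is totally bounded when \<open>A (Suc k)\<close> is covered by finitely many
  balls of radius \<open>1 / (k + 1)\<close>. Choosing the covers so that the outer measure of the images stays
  large yields a compact set whose image has almost full measure.
\<close>

lemma ex_compact_lift:
  fixes p :: "'z::complete_space \<Rightarrow> 'w::metric_space" and c :: "nat \<Rightarrow> 'z"
  assumes G: "closed G" and dense: "\<And>z e. z \<in> G \<Longrightarrow> 0 < e \<Longrightarrow> \<exists>i. dist (c i) z < e"
    and p: "continuous_on UNIV p" and surj: "p ` G = UNIV"
    and P: "finite_measure P" "sets P = sets borel" and a: "a < emeasure P UNIV"
  shows "\<exists>K\<subseteq>G. compact K \<and> a \<le> emeasure P (p ` K)"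
proof -
  interpret finite_measure P by fact
  have spP: "space P = UNIV" using sets_eq_imp_space_eq[OF P(2)] by simp
  let ?Q = "\<lambda>k A A'. \<exists>n. A' = {z\<in>A. \<exists>i\<le>n. dist z (c i) \<le> 1 / Suc k}"
  \<comment> \<open>The outer measure is used because the image of a closed set that is not compact
    need not be Borel.\<close>
  have "\<exists>A. \<forall>k. (closed (A k) \<and> A k \<subseteq> G \<and> a < outer_measure_of P (p ` A k)) \<and> ?Q k (A k) (A (Suc k))"
  proof (rule dependent_nat_choice)
    have "UNIV \<in> sets P" using spP sets.top by metis
    then show "\<exists>A. closed A \<and> A \<subseteq> G \<and> a < outer_measure_of P (p ` A)"
      using G surj a by (intro exI[of _ G]) simp
    fix A :: "'z set" and k :: nat
    assume A: "closed A \<and> A \<subseteq> G \<and> a < outer_measure_of P (p ` A)"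
    let ?A = "\<lambda>n. {z\<in>A. \<exists>i\<le>n. dist z (c i) \<le> 1 / Suc k}"
    have "z \<in> (\<Union>n. ?A n)" if "z \<in> A" for z
    proof -
      have "z \<in> G" using A that by blast
      then obtain i where "dist (c i) z < 1 / Suc k"
        using dense[of z "1 / Suc k"] by auto
      then show ?thesis
        using that by (auto simp: dist_commute intro!: exI[of _ i])
    qed
    then have "(\<Union>n. ?A n) = A" by auto
    then have "outer_measure_of P (p ` A) = outer_measure_of P (\<Union>n. p ` ?A n)"
      by (simp only: image_UN[symmetric])
    \<comment> \<open>Outer measures are continuous along increasing sequences of arbitrary sets, so
      finitely many balls already retain an image of outer measure above \<open>a\<close>.\<close>
    also have "\<dots> = (SUP n. outer_measure_of P (p ` ?A n))"
    proof (rule SUP_outer_measure_of_incseq[symmetric])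
      show "incseq (\<lambda>n. p ` ?A n)"
        by (intro incseq_SucI image_mono) (auto intro: le_SucI)
    qed (simp add: spP)
    finally have "a < (SUP n. outer_measure_of P (p ` ?A n))" using A by simp
    then obtain n where n: "a < outer_measure_of P (p ` ?A n)"
      by (auto simp: less_SUP_iff)
    have "?A n = A \<inter> (\<Union>i\<in>{..n}. cball (c i) (1 / Suc k))"
      by (auto simp: dist_commute)
    also have "closed \<dots>"
      using A by (intro closed_Int closed_UN) auto
    finally have "closed (?A n)" .
    with n A show "\<exists>A'. (closed A' \<and> A' \<subseteq> G \<and> a < outer_measure_of P (p ` A')) \<and> ?Q k A A'"
      by (intro exI[of _ "?A n"]) blast
  qed
  then obtain A where A: "\<And>k. closed (A k)" "\<And>k. A k \<subseteq> G" "\<And>k. a < outer_measure_of P (p ` A k)"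
    and step: "\<And>k. ?Q k (A k) (A (Suc k))"
    by blast
  have "A (Suc k) \<subseteq> A k" for k using step[of k] by blast
  then have dec: "decseq A" by (rule decseq_SucI)
  define K where "K = (\<Inter>k. A k)"
  \<comment> \<open>Late members of the sequence lie in a finitely covered set and early ones are
    finitely many, so the closure of the range is totally bounded and complete.\<close>
  have conv: "\<exists>l\<in>K. \<exists>r. strict_mono (r::nat \<Rightarrow> nat) \<and> (z \<circ> r) \<longlonglongrightarrow> l" if z: "\<And>k. z k \<in> A k" for z
  proof -
    let ?S = "closure (range z)"
    have "\<exists>F. finite F \<and> ?S \<subseteq> (\<Union>x\<in>F. ball x e)" if "e > 0" for e
    proof -
      obtain k where k: "1 / real (Suc k) < e" using nat_approx_posE[OF \<open>e > 0\<close>] by auto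
      obtain n where n: "A (Suc k) = {z\<in>A k. \<exists>i\<le>n. dist z (c i) \<le> 1 / Suc k}"
        using step[of k] by blast
      let ?F = "z ` {..k} \<union> c ` {..n}"
      have "z m \<in> (\<Union>x\<in>?F. cball x (1 / Suc k))" for m
      proof (cases "m \<le> k")
        case False
        then have "z m \<in> A (Suc k)"
          using z[of m] dec unfolding decseq_def by (metis not_less_eq_eq subsetD)
        then show ?thesis unfolding n by (auto simp: dist_commute)
      next
        case True
        then show ?thesis by (intro UN_I[of "z m"]) auto
      qed
      then have "range z \<subseteq> (\<Union>x\<in>?F. cball x (1 / Suc k))" by blast
      then have "?S \<subseteq> (\<Union>x\<in>?F. cball x (1 / Suc k))"
        by (rule closure_minimal) (intro closed_UN, auto)
      also have "\<dots> \<subseteq> (\<Union>x\<in>?F. ball x e)"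
        using k by (intro UN_mono) auto
      finally show ?thesis by (intro exI[of _ ?F]) auto
    qed
    then have "compact ?S"
      by (subst compact_eq_totally_bounded) (auto simp: complete_eq_closed)
    then have "seq_compact ?S" by (rule compact_imp_seq_compact)
    then obtain l r where r: "strict_mono (r::nat \<Rightarrow> nat)" and l: "(z \<circ> r) \<longlonglongrightarrow> l"
      using seq_compactE[of ?S z] closure_subset[of "range z"] by (metis rangeI subsetD)
    have "l \<in> A k" for k
    proof (rule Lim_in_closed_set[OF A(1) _ sequentially_bot l])
      show "\<forall>\<^sub>F i in sequentially. (z \<circ> r) i \<in> A k"
        unfolding eventually_sequentially
      proof (intro exI[of _ k] allI impI)
        fix i assume "k \<le> i"
        then have "k \<le> r i" using seq_suble[OF r, of i] by simp
        then show "(z \<circ> r) i \<in> A k"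
          using z[of "r i"] dec unfolding decseq_def comp_def by blast
      qed
    qed
    then show ?thesis using r l unfolding K_def by blast
  qed
  have "compact K"
    unfolding compact_def
  proof (intro allI impI)
    fix f :: "nat \<Rightarrow> 'z" assume "\<forall>n. f n \<in> K"
    then show "\<exists>l\<in>K. \<exists>r. strict_mono r \<and> (f \<circ> r) \<longlonglongrightarrow> l"
      by (intro conv) (auto simp: K_def)
  qed
  \<comment> \<open>This interchange of image and nested intersection replaces the images by closed
    sets, to which continuity from above applies.\<close>
  have sub: "(\<Inter>k. closure (p ` A k)) \<subseteq> p ` K"
  proof
    fix w assume w: "w \<in> (\<Inter>k. closure (p ` A k))"
    have "\<exists>z\<in>A k. dist (p z) w < 1 / Suc k" for k
    proof -
      have "w \<in> closure (p ` A k)" using w by blast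
      then show ?thesis
        unfolding closure_approachable by (metis imageE of_nat_0_less_iff zero_less_Suc zero_less_divide_1_iff)
    qed
    then obtain z where z: "\<And>k. z k \<in> A k" "\<And>k. dist (p (z k)) w < 1 / Suc k" by metis
    obtain l r where l: "l \<in> K" and r: "strict_mono (r::nat \<Rightarrow> nat)" and lim: "(z \<circ> r) \<longlonglongrightarrow> l"
      using conv[OF z(1)] by blast
    have 1: "(\<lambda>i. p ((z \<circ> r) i)) \<longlonglongrightarrow> p l"
      by (rule continuous_on_tendsto_compose[OF p lim]) auto
    have "(\<lambda>k. dist (p (z k)) w) \<longlonglongrightarrow> 0"
      by (rule tendsto_sandwich[OF _ _ tendsto_const LIMSEQ_Suc[OF lim_1_over_n]])
         (use z(2) in \<open>auto intro!: always_eventually less_imp_le\<close>)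
    then have "(\<lambda>k. p (z k)) \<longlonglongrightarrow> w" by (subst tendsto_dist_iff)
    from LIMSEQ_subseq_LIMSEQ[OF this r] have "(\<lambda>i. p ((z \<circ> r) i)) \<longlonglongrightarrow> w" by (simp add: comp_def)
    with 1 have "p l = w" by (rule LIMSEQ_unique)
    with l show "w \<in> p ` K" by blast
  qed
  have sets_cl: "closure B \<in> sets P" for B unfolding P(2) by simp
  have "a \<le> emeasure P (closure (p ` A k))" for k
  proof -
    have "a \<le> outer_measure_of P (p ` A k)" using A(3)[of k] by simp
    also have "\<dots> \<le> outer_measure_of P (closure (p ` A k))"
      by (intro outer_measure_of_mono closure_subset)
    finally show ?thesis using sets_cl by simp
  qed
  then have "a \<le> (INF k. emeasure P (closure (p ` A k)))" by (rule INF_greatest)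
  also have "\<dots> = emeasure P (\<Inter>k. closure (p ` A k))"
  proof (rule INF_emeasure_decseq)
    show "decseq (\<lambda>k. closure (p ` A k))"
      by (intro decseq_SucI closure_mono image_mono decseq_SucD[OF dec])
  qed (auto simp: sets_cl)
  also have "\<dots> \<le> emeasure P (p ` K)"
  proof (rule emeasure_mono[OF sub])
    have "compact (p ` K)"
      using \<open>compact K\<close> p by (intro compact_continuous_image) (auto intro: continuous_on_subset)
    then show "p ` K \<in> sets P" unfolding P(2) by (intro borel_closed compact_imp_closed)
  qed
  finally show ?thesis
    using \<open>compact K\<close> A(2) by (intro exI[of _ K]) (auto simp: K_def)
qed

text \<open>At each stage the first small ball is taken that still meets the part of the fibre
  selected so far. Images of compact sets are closed, so these choices are Borel; by compactness the
  shrinking pieces of a fibre have a common point.\<close>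

lemma compact_measurable_selection:
  fixes p :: "'z::metric_space \<Rightarrow> 'w::metric_space" and c :: "nat \<Rightarrow> 'z"
  assumes K: "compact K" and dense: "\<And>z e. z \<in> K \<Longrightarrow> 0 < e \<Longrightarrow> \<exists>i. dist (c i) z < e"
    and p: "continuous_on UNIV p"
  shows "\<exists>s\<in>borel_measurable borel. \<forall>w\<in>p ` K. s w \<in> K \<and> p (s w) = w"
proof -
  \<comment> \<open>The list records the chosen centres, latest first. Its length fixes the next
    radius, so that the diameters tend to 0.\<close>
  define A where "A = rec_list K (\<lambda>i l B. B \<inter> cball (c i) (1 / Suc (length l)))"
  have A: "A [] = K" "A (i # l) = A l \<inter> cball (c i) (1 / Suc (length l))" for i l
    unfolding A_def by simp_all
  have compact_A: "compact (A l)" for l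
    by (induction l) (auto simp: A K intro: compact_Int_closed)
  have closed_pA: "closed (p ` A l)" for l
    using compact_A p by (intro compact_imp_closed compact_continuous_image) (auto intro: continuous_on_subset)
  define I where "I = rec_nat (\<lambda>w. []) (\<lambda>j f w. (LEAST i. w \<in> p ` A (i # f w)) # f w)"
  have I: "I 0 w = []" "I (Suc j) w = (LEAST i. w \<in> p ` A (i # I j w)) # I j w" for j w
    unfolding I_def by simp_all
  have len: "length (I j w) = j" for j w by (induction j) (simp_all add: I)
  have I_meas: "I j \<in> borel \<rightarrow>\<^sub>M count_space UNIV" for j
  proof (induction j)
    case (Suc j)
    have "(\<lambda>w. (LEAST i. w \<in> p ` A (i # I j w)) # I j w) \<in> borel \<rightarrow>\<^sub>M count_space UNIV"
    proof (rule measurable_compose_countable[OF _ Suc])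
      fix l
      have "Measurable.pred borel (\<lambda>w. w \<in> p ` A (i # l))" for i
        using borel_closed[OF closed_pA[of "i # l"]] by (simp add: pred_def)
      then have "(\<lambda>w. LEAST i. w \<in> p ` A (i # l)) \<in> borel \<rightarrow>\<^sub>M count_space UNIV"
        by (rule measurable_Least)
      then show "(\<lambda>w. (LEAST i. w \<in> p ` A (i # l)) # l) \<in> borel \<rightarrow>\<^sub>M count_space UNIV"
        by (rule measurable_compose) simp
    qed
    then show ?case by (simp add: I(2)[abs_def])
  qed (simp add: I(1)[abs_def])
  have nonempty: "w \<in> p ` A (I j w)" if w: "w \<in> p ` K" for j w
  proof (induction j)
    case (Suc j)
    then obtain z where z: "z \<in> A (I j w)" "p z = w" by blast
    have "A l \<subseteq> K" for l by (induction l) (auto simp: A)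
    then obtain i where "dist (c i) z < 1 / Suc j"
      using dense[of z "1 / Suc j"] z by auto
    then have "z \<in> A (i # I j w)"
      using z by (simp add: A len)
    then have "\<exists>i. w \<in> p ` A (i # I j w)" using z by blast
    then show ?case unfolding I by (rule LeastI_ex)
  qed (use w in \<open>simp add: A I\<close>)
  have A_Suc: "A (I (Suc j) w) \<subseteq> A (I j w)" for j w by (simp add: A I)
  have ex: "\<exists>z. p z = w \<and> (\<forall>j. z \<in> A (I j w))" if w: "w \<in> p ` K" for w
  proof -
    have "\<forall>j. \<exists>z. z \<in> A (I j w) \<and> p z = w"
      using nonempty[OF w] by blast
    then obtain z where z: "\<And>j. z j \<in> A (I j w)" "\<And>j. p (z j) = w"
      by (auto simp: choice_iff)
    have dec: "decseq (\<lambda>j. A (I j w))" by (intro decseq_SucI A_Suc)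
    then have "z j \<in> K" for j
      using z(1)[of j] decseqD[OF dec, of 0 j] by (auto simp: I A)
    then obtain l r where r: "strict_mono (r::nat \<Rightarrow> nat)" and l: "(z \<circ> r) \<longlonglongrightarrow> l"
      using K unfolding compact_def by metis
    have "l \<in> A (I j w)" for j
    proof (rule Lim_in_closed_set[OF compact_imp_closed[OF compact_A] _ sequentially_bot l])
      show "\<forall>\<^sub>F i in sequentially. (z \<circ> r) i \<in> A (I j w)"
        unfolding eventually_sequentially
      proof (intro exI[of _ j] allI impI)
        fix i assume "j \<le> i"
        then have "j \<le> r i" using seq_suble[OF r, of i] by simp
        then show "(z \<circ> r) i \<in> A (I j w)"
          using z(1)[of "r i"] decseqD[OF dec, of j "r i"] by auto
      qed
    qed
    moreover have "(\<lambda>i. p ((z \<circ> r) i)) \<longlonglongrightarrow> p l"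
      by (intro continuous_on_tendsto_compose[OF p l]) auto
    then have "p l = w" by (simp add: z LIMSEQ_const_iff)
    ultimately show ?thesis by blast
  qed
  \<comment> \<open>The choice is unique since the radii vanish; this is why \<open>s\<close> is a
    limit of the measurable approximations by centres. Off the image the value \<open>c 0\<close> is
    a placeholder.\<close>
  define s where "s w = (if w \<in> p ` K then SOME z. p z = w \<and> (\<forall>j. z \<in> A (I j w)) else c 0)" for w
  have s: "p (s w) = w" "s w \<in> A (I j w)" if "w \<in> p ` K" for w j
    using someI_ex[OF ex[OF that]] that by (simp_all add: s_def)
  have "s \<in> borel_measurable borel"
  proof (rule borel_measurable_LIMSEQ_metric)
    fix j
    have "{w \<in> space borel. w \<in> p ` K} \<in> sets borel"
      using borel_closed[OF closed_pA[of "[]"]] by (simp add: A)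
    moreover have "(\<lambda>w. c (hd (I (Suc j) w))) \<in> borel_measurable borel"
      by (rule measurable_compose[OF I_meas]) simp
    ultimately show "(\<lambda>w. if w \<in> p ` K then c (hd (I (Suc j) w)) else c 0) \<in> borel_measurable borel"
      by (intro measurable_If) auto
  next
    fix w
    show "(\<lambda>j. if w \<in> p ` K then c (hd (I (Suc j) w)) else c 0) \<longlonglongrightarrow> s w"
    proof (cases "w \<in> p ` K")
      case True
      have "dist (c (hd (I (Suc j) w))) (s w) \<le> 1 / Suc j" for j
        using s(2)[OF True, of "Suc j"] by (simp add: I A len)
      then have "(\<lambda>j. dist (c (hd (I (Suc j) w))) (s w)) \<longlonglongrightarrow> 0"
        by (intro tendsto_sandwich[OF _ _ tendsto_const LIMSEQ_Suc[OF lim_1_over_n]]) auto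
      with True show ?thesis by (simp add: tendsto_dist_iff[symmetric])
    qed (simp add: s_def)
  qed
  moreover have "s w \<in> K" if "w \<in> p ` K" for w
    using s(2)[OF that, of 0] by (simp add: I A)
  ultimately show ?thesis using s by blast
qed

text \<open>Compact sets whose images have mass at least 1 - 1 / (n + 1) exhaust \<open>P\<close> up
  to a null set. The selections on them are patched by using the least n whose image contains the
  point.\<close>

lemma ex_measurable_lift:
  fixes p :: "'z::complete_space \<Rightarrow> 'w::metric_space" and c :: "nat \<Rightarrow> 'z"
  assumes G: "closed G" and dense: "\<And>z e. z \<in> G \<Longrightarrow> 0 < e \<Longrightarrow> \<exists>i. dist (c i) z < e"
    and p: "continuous_on UNIV p" and surj: "p ` G = UNIV"
    and P: "prob_space P" "sets P = sets borel"
  shows "\<exists>s\<in>borel_measurable borel. AE w in P. s w \<in> G \<and> p (s w) = w"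
proof -
  interpret prob_space P by fact
  have spP: "space P = UNIV" using sets_eq_imp_space_eq[OF P(2)] by simp
  have "\<exists>K\<subseteq>G. compact K \<and> ennreal (1 - 1 / Suc n) \<le> emeasure P (p ` K)" for n
  proof (rule ex_compact_lift[OF G dense p surj finite_measure_axioms P(2)])
    have "emeasure P UNIV = 1" using emeasure_space_1 spP by simp
    then show "ennreal (1 - 1 / Suc n) < emeasure P UNIV"
      by (simp add: ennreal_less_one_iff)
  qed
  then obtain K where K: "\<And>n. K n \<subseteq> G" "\<And>n. compact (K n)"
    "\<And>n. ennreal (1 - 1 / Suc n) \<le> emeasure P (p ` K n)"
    by metis
  have "\<exists>s\<in>borel_measurable borel. \<forall>w\<in>p ` K n. s w \<in> K n \<and> p (s w) = w" for n
    by (rule compact_measurable_selection[OF K(2) dense p]) (use K(1) in auto)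
  then obtain s where s: "\<And>n. s n \<in> borel_measurable borel"
    "\<And>n w. w \<in> p ` K n \<Longrightarrow> s n w \<in> K n \<and> p (s n w) = w"
    by metis
  have closed_pK: "closed (p ` K n)" for n
    using K(2) p by (intro compact_imp_closed compact_continuous_image) (auto intro: continuous_on_subset)
  have sets_pK: "p ` K n \<in> sets P" for n unfolding P(2) by (rule borel_closed[OF closed_pK])
  define N where "N w = (LEAST n. w \<in> p ` K n)" for w
  have "(\<lambda>w. s (N w) w) \<in> borel_measurable borel"
  proof (rule measurable_compose_countable[OF s(1)])
    have "Measurable.pred borel (\<lambda>w. w \<in> p ` K n)" for n
      using borel_closed[OF closed_pK[of n]] by (simp add: pred_def)
    then show "N \<in> borel \<rightarrow>\<^sub>M count_space UNIV"
      unfolding N_def[abs_def] by (rule measurable_Least)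
  qed
  moreover have "AE w in P. w \<in> (\<Union>n. p ` K n)"
  proof (rule AE_prob_1)
    have "1 - 1 / real (Suc n) \<le> prob (\<Union>n. p ` K n)" for n
    proof -
      have "1 - 1 / real (Suc n) \<le> prob (p ` K n)"
        using K(3)[of n] by (simp add: emeasure_eq_measure)
      also have "\<dots> \<le> prob (\<Union>n. p ` K n)"
        using sets_pK by (intro finite_measure_mono) auto
      finally show ?thesis .
    qed
    moreover have "(\<lambda>n. 1 - 1 / real (Suc n)) \<longlonglongrightarrow> 1 - 0"
      by (intro tendsto_intros LIMSEQ_Suc[OF lim_1_over_n])
    ultimately have "1 - 0 \<le> prob (\<Union>n. p ` K n)"
      by (intro LIMSEQ_le_const2) auto
    then show "prob (\<Union>n. p ` K n) = 1"
      using prob_le_1[of "\<Union>n. p ` K n"] by linarith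
  qed
  then have "AE w in P. s (N w) w \<in> G \<and> p (s (N w) w) = w"
  proof eventually_elim
    case (elim w)
    then have "\<exists>n. w \<in> p ` K n" by blast
    then have "w \<in> p ` K (N w)" unfolding N_def by (rule LeastI_ex)
    from s(2)[OF this] K(1) show ?case by blast
  qed
  ultimately show ?thesis by (intro bexI[of _ "\<lambda>w. s (N w) w"])
qed

section \<open>Geodesics as points of a function space\<close>

abbreviation clamp01 :: "real \<Rightarrow> real" where
  "clamp01 t \<equiv> max 0 (min 1 t)"

text \<open>
  Geodesics are extended to the whole line by constants, which makes them points of a complete
  space of bounded continuous functions.
\<close>

definition geodesics :: "(real \<Rightarrow>\<^sub>C 'a::metric_space) set" where
  "geodesics = {\<gamma> :: real \<Rightarrow>\<^sub>C 'a. \<forall>s t. dist (\<gamma> s) (\<gamma> t) = \<bar>clamp01 s - clamp01 t\<bar> * dist (\<gamma> 0) (\<gamma> 1)}"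

lemma continuous_on_eval_bcontfun: "continuous_on UNIV (\<lambda>\<gamma>::real \<Rightarrow>\<^sub>C 'a::metric_space. \<gamma> t)"
proof (rule continuous_onI)
  fix \<gamma> :: "real \<Rightarrow>\<^sub>C 'a" and e :: real assume "e > 0"
  then show "\<exists>d>0. \<forall>\<gamma>'\<in>UNIV. dist \<gamma>' \<gamma> < d \<longrightarrow> dist (\<gamma>' t) (\<gamma> t) \<le> e"
    by (intro exI[of _ e]) (auto intro: order.trans[OF dist_bounded] less_imp_le)
qed

lemma closed_geodesics: "closed (geodesics :: (real \<Rightarrow>\<^sub>C 'a::metric_space) set)"
  unfolding geodesics_def
  by (intro closed_Collect_all closed_Collect_eq continuous_intros continuous_on_eval_bcontfun)

lemma endpoints_geodesics:
  assumes "geodesic_space TYPE('a::metric_space)"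
  shows "(\<lambda>\<gamma>::real \<Rightarrow>\<^sub>C 'a. (\<gamma> 0, \<gamma> 1)) ` geodesics = UNIV"
proof -
  have "(x, y) \<in> (\<lambda>\<gamma>::real \<Rightarrow>\<^sub>C 'a. (\<gamma> 0, \<gamma> 1)) ` geodesics" for x y
  proof -
    obtain f :: "real \<Rightarrow> 'a" where f: "f 0 = x" "f 1 = y"
      "\<And>s t. s \<in> {0..1} \<Longrightarrow> t \<in> {0..1} \<Longrightarrow> dist (f s) (f t) = \<bar>s - t\<bar> * dist x y"
      using assms unfolding geodesic_space_def by blast
    have d: "dist (f (clamp01 s)) (f (clamp01 t)) = \<bar>clamp01 s - clamp01 t\<bar> * dist x y" for s t
      by (intro f) auto
    have "continuous_on UNIV (\<lambda>t. f (clamp01 t))"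
    proof (rule continuous_on_iff[THEN iffD2], intro ballI allI impI)
      fix t e :: real assume "e > 0"
      have "dist (f (clamp01 t')) (f (clamp01 t)) < e" if "dist t' t < e / (dist x y + 1)" for t'
      proof -
        have "\<bar>clamp01 t' - clamp01 t\<bar> \<le> dist t' t" by (auto simp: dist_real_def)
        then have "dist (f (clamp01 t')) (f (clamp01 t)) \<le> dist t' t * (dist x y + 1)"
          unfolding d by (intro mult_mono) auto
        also have "\<dots> < e"
          using that by (simp add: pos_less_divide_eq add_nonneg_pos)
        finally show ?thesis .
      qed
      moreover have "e / (dist x y + 1) > 0"
        using \<open>e > 0\<close> by (simp add: add_nonneg_pos)
      ultimately show "\<exists>d>0. \<forall>t'\<in>UNIV. dist t' t < d \<longrightarrow> dist (f (clamp01 t')) (f (clamp01 t)) < e"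
        by blast
    qed
    moreover have "bounded (range (\<lambda>t. f (clamp01 t)))"
      unfolding bounded_def
    proof (intro exI[of _ x] exI[of _ "dist x y"] ballI)
      fix z assume "z \<in> range (\<lambda>t. f (clamp01 t))"
      then obtain t where z: "z = f (clamp01 t)" by blast
      have "dist (f 0) (f (clamp01 t)) = \<bar>0 - clamp01 t\<bar> * dist x y"
        by (rule f) auto
      also have "\<dots> \<le> 1 * dist x y" by (intro mult_right_mono) auto
      finally show "dist x z \<le> dist x y" by (simp add: z f)
    qed
    ultimately have "(\<lambda>t. f (clamp01 t)) \<in> bcontfun"
      by (simp add: bcontfun_def)
    then obtain \<gamma> :: "real \<Rightarrow>\<^sub>C 'a" where \<gamma>: "(\<lambda>t. f (clamp01 t)) = apply_bcontfun \<gamma>"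
      by (rule bcontfunE)
    then have g: "\<gamma> t = f (clamp01 t)" for t by metis
    have "\<gamma> \<in> geodesics"
      unfolding geodesics_def by (auto simp: g d f(1,2))
    moreover have "(\<gamma> 0, \<gamma> 1) = (x, y)" by (simp add: g f)
    ultimately show ?thesis by (metis (no_types, lifting) image_eqI)
  qed
  then show ?thesis by auto
qed

text \<open>The whole space of bounded continuous functions is in general not separable. A geodesic,
  however, is Lipschitz and thus determined up to a small error by finitely many sample values, each
  rounded to some \<open>q i\<close>. Such patterns are countable, and one geodesic is chosen for
  every realised pattern.\<close>

lemma separable_geodesics:
  fixes q :: "nat \<Rightarrow> 'a::metric_space"
  assumes "dense_sequence q"
  shows "\<exists>c::nat \<Rightarrow> (real \<Rightarrow>\<^sub>C 'a). \<forall>\<gamma>\<in>geodesics. \<forall>e>0. \<exists>i. dist (c i) \<gamma> < e"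
proof -
  interpret dense_sequence q by fact
  define R where "R = (\<lambda>(m, n, l) (\<gamma>::real \<Rightarrow>\<^sub>C 'a). \<gamma> \<in> geodesics \<and> dist (\<gamma> 0) (\<gamma> 1) * (1 / real (Suc n)) < 1 / real (Suc m) \<and>
     (\<forall>k\<le>Suc n. dist (\<gamma> (real k / real (Suc n))) (q (l ! k)) < 1 / real (Suc m)))"
  \<comment> \<open>For patterns that no geodesic realises the value is arbitrary; the sequence only
    has to come close to each geodesic.\<close>
  define c where "c i = (SOME \<gamma>. R (from_nat i :: nat \<times> nat \<times> nat list) \<gamma>)" for i
  have "\<exists>i. dist (c i) \<gamma> < e" if \<gamma>: "\<gamma> \<in> geodesics" and "e > 0" for \<gamma> e
  proof -
    obtain m where m: "1 / real (Suc m) < e / 5"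
      using nat_approx_posE[of "e/5"] \<open>e > 0\<close> by auto
    obtain n where n: "dist (\<gamma> 0) (\<gamma> 1) * (1 / real (Suc n)) < 1 / real (Suc m)"
    proof -
      have "(\<lambda>n. dist (\<gamma> 0) (\<gamma> 1) * (1 / real (Suc n))) \<longlonglongrightarrow> dist (\<gamma> 0) (\<gamma> 1) * 0"
        by (intro tendsto_intros LIMSEQ_Suc[OF lim_1_over_n])
      then have "\<forall>\<^sub>F n in sequentially. dist (\<gamma> 0) (\<gamma> 1) * (1 / real (Suc n)) < 1 / real (Suc m)"
        by (rule order_tendstoD) simp
      then show ?thesis using that by (auto simp: eventually_sequentially)
    qed
    have "\<exists>i. dist (\<gamma> (real k / real (Suc n))) (q i) < 1 / real (Suc m)" for k :: nat
      using dense[of "1 / real (Suc m)" "\<gamma> (real k / real (Suc n))"] by (simp add: dist_commute)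
    then obtain i where i: "\<And>k. dist (\<gamma> (real k / real (Suc n))) (q (i k)) < 1 / real (Suc m)" by metis
    define l where "l = map i [0..<Suc (Suc n)]"
    have "R (m, n, l) \<gamma>"
      unfolding R_def l_def using \<gamma> n i by (simp del: upt_Suc add: nth_map)
    then have "R (m, n, l) (c (to_nat (m, n, l)))"
      unfolding c_def by (auto intro: someI)
    then obtain \<delta> where \<delta>: "\<delta> = c (to_nat (m, n, l))" "R (m, n, l) \<delta>" by blast
    \<comment> \<open>One unit each for moving along the two geodesics from t to the preceding
      sample time, and two units for comparing both samples with the same centre.\<close>
    have "dist (\<delta> t) (\<gamma> t) \<le> 4 * (1 / real (Suc m))" for t
    proof -
      define k where "k = nat \<lfloor>real (Suc n) * clamp01 t\<rfloor>"
      have k1: "real k \<le> real (Suc n) * clamp01 t"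
        unfolding k_def by (simp add: of_nat_nat)
      have k2: "real (Suc n) * clamp01 t < real k + 1"
        unfolding k_def by linarith
      have "real (Suc n) * clamp01 t \<le> real (Suc n)" by (simp add: mult_left_le)
      then have kn: "k \<le> Suc n" using k1 by linarith
      have kt: "\<bar>clamp01 t - clamp01 (real k / real (Suc n))\<bar> \<le> 1 / real (Suc n)"
      proof -
        have "clamp01 (real k / real (Suc n)) = real k / real (Suc n)" using kn by (simp add: divide_le_eq)
        moreover have "k / Suc n \<le> clamp01 t" using k1 by (simp add: divide_le_eq mult.commute)
        moreover have "clamp01 t < (real k + 1) / real (Suc n)" using k2 by (simp add: less_divide_eq mult.commute)
        ultimately show ?thesis unfolding add_divide_distrib by linarith
      qed
      have near: "dist (\<eta> t) (\<eta> (real k / real (Suc n))) \<le> 1 / real (Suc m)" if "R (m, n, l) \<eta>" for \<eta>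
      proof -
        have "dist (\<eta> t) (\<eta> (real k / real (Suc n))) = \<bar>clamp01 t - clamp01 (real k / real (Suc n))\<bar> * dist (\<eta> 0) (\<eta> 1)"
          using that unfolding R_def geodesics_def by blast
        also have "\<dots> \<le> (1 / real (Suc n)) * dist (\<eta> 0) (\<eta> 1)"
          using kt by (intro mult_right_mono) auto
        also have "\<dots> \<le> 1 / real (Suc m)"
          using that unfolding R_def by (simp add: mult.commute)
        finally show ?thesis .
      qed
      have "dist (\<delta> (real k / real (Suc n))) (q (l ! k)) < 1 / real (Suc m)" "dist (\<gamma> (real k / real (Suc n))) (q (l ! k)) < 1 / real (Suc m)"
        using \<delta>(2) \<open>R (m, n, l) \<gamma>\<close> kn unfolding R_def by auto
      then have "dist (\<delta> (real k / real (Suc n))) (\<gamma> (real k / real (Suc n))) \<le> 2 * (1 / real (Suc m))"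
        using dist_triangle2[of "\<delta> (real k / real (Suc n))" "\<gamma> (real k / real (Suc n))" "q (l ! k)"] by linarith
      moreover have "dist (\<delta> t) (\<gamma> t) \<le> dist (\<delta> t) (\<delta> (real k / real (Suc n))) + dist (\<delta> (real k / real (Suc n))) (\<gamma> (real k / real (Suc n))) + dist (\<gamma> t) (\<gamma> (real k / real (Suc n)))"
        using dist_triangle[of "\<delta> t" "\<gamma> t" "\<delta> (real k / real (Suc n))"]
          dist_triangle2[of "\<delta> (real k / real (Suc n))" "\<gamma> t" "\<gamma> (real k / real (Suc n))"] by linarith
      ultimately show ?thesis
        using near[OF \<delta>(2)] near[OF \<open>R (m, n, l) \<gamma>\<close>] by linarith
    qed
    then have "dist \<delta> \<gamma> \<le> 4 * (1 / real (Suc m))" by (rule dist_bound)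
    also have "\<dots> < e" using m \<open>e > 0\<close> by linarith
    finally show ?thesis using \<delta>(1) by blast
  qed
  then show ?thesis by blast
qed

text \<open>Joint measurability in the pair and the time is what Fubini's theorem later requires. It
  follows from measurability at each fixed time and continuity in time.\<close>

theorem ex_geodesic_selection:
  fixes q :: "nat \<Rightarrow> 'a::complete_space" and \<sigma> :: "('a \<times> 'a) measure"
  assumes q: "dense_sequence q" and geo: "geodesic_space TYPE('a)"
    and \<sigma>: "prob_space \<sigma>" "sets \<sigma> = sets borel"
  shows "\<exists>e :: 'a \<times> 'a \<Rightarrow> real \<Rightarrow> 'a. (\<lambda>p. e (fst p) (snd p)) \<in> borel_measurable (borel \<Otimes>\<^sub>M borel) \<and>
    (AE w in \<sigma>. e w 0 = fst w \<and> e w 1 = snd w \<and>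
      (\<forall>s\<in>{0..1}. \<forall>t\<in>{0..1}. dist (e w s) (e w t) = \<bar>s - t\<bar> * dist (fst w) (snd w)))"
proof -
  obtain c :: "nat \<Rightarrow> (real \<Rightarrow>\<^sub>C 'a)" where c: "\<And>\<gamma> e. \<gamma> \<in> geodesics \<Longrightarrow> 0 < e \<Longrightarrow> \<exists>i. dist (c i) \<gamma> < e"
    using separable_geodesics[OF q] by blast
  have "\<exists>s\<in>borel_measurable borel. AE w in \<sigma>. s w \<in> geodesics \<and> (s w 0, s w 1) = w"
  proof (rule ex_measurable_lift[OF closed_geodesics _ _ endpoints_geodesics[OF geo] \<sigma>])
    show "\<exists>i. dist (c i) \<gamma> < e" if "\<gamma> \<in> geodesics" "0 < e" for \<gamma> e
      using that by (rule c)
  qed (intro continuous_intros continuous_on_eval_bcontfun)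
  then obtain s where s [measurable]: "s \<in> borel_measurable borel"
    and AE: "AE w in \<sigma>. s w \<in> geodesics \<and> (s w 0, s w 1) = w" by blast
  have eval: "(\<lambda>w. s w t) \<in> borel_measurable borel" for t
    by (rule measurable_compose[OF s borel_measurable_continuous_onI[OF continuous_on_eval_bcontfun]])
  have "(\<lambda>p. s (fst p) (snd p)) \<in> borel_measurable (borel \<Otimes>\<^sub>M borel)"
  proof (rule borel_measurable_LIMSEQ_metric)
    fix n
    \<comment> \<open>Rounding the time down to a multiple of 1 / (n + 1) leaves countably many
      values, on each of which the map is measurable in the pair alone.\<close>
    show "(\<lambda>p. s (fst p) (of_int \<lfloor>real (Suc n) * snd p\<rfloor> / real (Suc n))) \<in> borel_measurable (borel \<Otimes>\<^sub>M borel)"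
    proof (rule measurable_compose_countable[where g = "\<lambda>p. \<lfloor>real (Suc n) * snd p\<rfloor>"])
      show "(\<lambda>p. s (fst p) (of_int i / real (Suc n))) \<in> borel_measurable (borel \<Otimes>\<^sub>M borel)" for i
        by (rule measurable_compose[OF measurable_fst eval])
    qed measurable
  next
    fix p :: "('a \<times> 'a) \<times> real"
    have "(\<lambda>n. of_int \<lfloor>real (Suc n) * snd p\<rfloor> / real (Suc n)) \<longlonglongrightarrow> snd p"
    proof (rule tendsto_sandwich)
      show "(\<lambda>n. snd p - 1 / real (Suc n)) \<longlonglongrightarrow> snd p"
        using tendsto_diff[OF tendsto_const LIMSEQ_Suc[OF lim_1_over_n], of "snd p"] by simp
      show "\<forall>\<^sub>F n in sequentially. snd p - 1 / real (Suc n) \<le> of_int \<lfloor>real (Suc n) * snd p\<rfloor> / real (Suc n)"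
      proof (intro always_eventually allI)
        fix n
        have "snd p * Suc n - 1 \<le> of_int \<lfloor>real (Suc n) * snd p\<rfloor>"
          using floor_correct[of "real (Suc n) * snd p"] by (simp add: mult.commute)
        then show "snd p - 1 / real (Suc n) \<le> of_int \<lfloor>real (Suc n) * snd p\<rfloor> / real (Suc n)"
          by (simp add: le_divide_eq left_diff_distrib)
      qed
      show "\<forall>\<^sub>F n in sequentially. of_int \<lfloor>real (Suc n) * snd p\<rfloor> / real (Suc n) \<le> snd p"
        by (intro always_eventually allI) (simp add: divide_le_eq mult.commute del: of_nat_Suc)
    qed simp
    then show "(\<lambda>n. s (fst p) (of_int \<lfloor>real (Suc n) * snd p\<rfloor> / real (Suc n))) \<longlonglongrightarrow> s (fst p) (snd p)"
      by (intro continuous_on_tendsto_compose[OF continuous_on_apply_bcontfun[of UNIV]]) auto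
  qed
  moreover have "AE w in \<sigma>. s w 0 = fst w \<and> s w 1 = snd w \<and>
      (\<forall>a\<in>{0..1}. \<forall>b\<in>{0..1}. dist (s w a) (s w b) = \<bar>a - b\<bar> * dist (fst w) (snd w))"
    using AE
  proof eventually_elim
    case (elim w)
    then have "dist (s w a) (s w b) = \<bar>clamp01 a - clamp01 b\<bar> * dist (s w 0) (s w 1)" for a b
      unfolding geodesics_def by blast
    with elim show ?case by (auto simp: prod_eq_iff)
  qed
  ultimately show ?thesis
    by (intro exI[of _ "\<lambda>w. apply_bcontfun (s w)"]) simp
qed

section \<open>Wasserstein geodesics induced by optimal couplings\<close>

lemma transport_cost_le: "\<sigma> \<in> couplings \<mu> \<nu> \<Longrightarrow> transport_cost \<mu> \<nu> \<le> coupling_cost \<sigma>"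
  unfolding transport_cost_eq_INF by (rule INF_lower)

lemma measurable_dist_sq [measurable]:
  "(\<lambda>p::'a::metric_space \<times> 'a. (dist (fst p) (snd p))\<^sup>2) \<in> borel_measurable borel"
  by (intro borel_measurable_continuous_onI continuous_intros)

lemma transport_cost_commute: "transport_cost \<mu> \<nu> = transport_cost \<nu> (\<mu> :: 'a::metric_space measure)"
proof -
  have "transport_cost \<nu> \<mu> \<le> coupling_cost \<sigma>" if "\<sigma> \<in> couplings \<mu> \<nu>" for \<mu> \<nu> :: "'a measure" and \<sigma>
  proof -
    note D = couplingsD[OF that]
    note D(2)[measurable_cong]
    have sw [measurable]: "(\<lambda>p::'a \<times> 'a. (snd p, fst p)) \<in> borel \<rightarrow>\<^sub>M borel"
      by (intro borel_measurable_continuous_onI continuous_intros)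
    let ?s = "distr \<sigma> borel (\<lambda>p. (snd p, fst p))"
    have "?s \<in> couplings \<nu> \<mu>"
      unfolding couplings_def borel_probs_def
      using prob_space.prob_space_distr[OF D(1), of "\<lambda>p. (snd p, fst p)" borel] D(3,4)
      by (auto simp: distr_distr comp_def)
    moreover have "coupling_cost ?s = coupling_cost \<sigma>"
      unfolding coupling_cost_def by (subst nn_integral_distr) (auto simp: dist_commute)
    ultimately show ?thesis using transport_cost_le by metis
  qed
  then show ?thesis
    unfolding transport_cost_eq_INF[of \<mu> \<nu>] transport_cost_eq_INF[of \<nu> \<mu>]
    by (intro antisym INF_greatest) (simp_all add: transport_cost_eq_INF)
qed

lemma distr_eqI:
  assumes [measurable]: "h \<in> M \<rightarrow>\<^sub>M K" "k \<in> N \<rightarrow>\<^sub>M K"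
    and eq: "\<And>A. A \<in> sets K \<Longrightarrow> (\<integral>\<^sup>+x. indicator A (h x) \<partial>M) = (\<integral>\<^sup>+x. indicator A (k x) \<partial>N)"
  shows "distr M K h = distr N K k"
proof (rule measure_eqI)
  fix A assume "A \<in> sets (distr M K h)"
  then have [measurable]: "A \<in> sets K" by simp
  have "(\<integral>\<^sup>+x. indicator A x \<partial>distr M K h) = (\<integral>\<^sup>+x. indicator A x \<partial>distr N K k)"
    using eq[of A] by (subst (1 2) nn_integral_distr) auto
  then show "emeasure (distr M K h) A = emeasure (distr N K k) A" by simp
qed simp

text \<open>Convexity of the square, with equality for b x = a y. With free weights it encodes the
  triangle inequality of W2 at the level of squared costs and avoids square roots.\<close>

lemma sq_add_le:
  fixes x y a b :: real
  assumes "a > 0" "b > 0" "a + b = 1"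
  shows "(x + y)\<^sup>2 \<le> x\<^sup>2 / a + y\<^sup>2 / b"
proof -
  have "x\<^sup>2 / a + y\<^sup>2 / b - (x + y)\<^sup>2 = (b * x\<^sup>2 + a * y\<^sup>2 - a * b * (x + y)\<^sup>2) / (a * b)"
    using assms by (simp add: field_simps)
  also have "b * x\<^sup>2 + a * y\<^sup>2 - a * b * (x + y)\<^sup>2 = (b * x - a * y)\<^sup>2"
  proof -
    have b: "b = 1 - a" using assms by simp
    show ?thesis unfolding b by (simp add: power2_eq_square algebra_simps)
  qed
  also have "(b * x - a * y)\<^sup>2 / (a * b) \<ge> 0" using assms by simp
  finally show ?thesis by simp
qed

text \<open>
  The couplings are glued along the cells of a partition into sets of small diameter, by means of a
  density on their product. This replaces the exact gluing, which would need disintegrations, at the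
  expense of an error that vanishes with the mesh.
\<close>

lemma (in dense_sequence) transport_cost_approximate_gluing:
  assumes \<sigma>1: "\<sigma>1 \<in> couplings \<mu> \<nu>" and \<sigma>2: "\<sigma>2 \<in> couplings \<nu> \<rho>"
    and ab: "0 < a" "0 < b" "a + b = 1" and e: "e > 0"
  shows "transport_cost \<mu> (\<rho> :: 'a measure) \<le>
    ennreal (1 + e) * (ennreal (1 / a) * coupling_cost \<sigma>1 + ennreal (1 / b) * coupling_cost \<sigma>2) + ennreal (e + e\<^sup>2)"
proof -
  let ?P = "\<sigma>1 \<Otimes>\<^sub>M \<sigma>2"
  note D1 = couplingsD[OF \<sigma>1] and D2 = couplingsD[OF \<sigma>2]
  note D1(2)[measurable_cong] D2(2)[measurable_cong]
  interpret \<sigma>1: prob_space \<sigma>1 by (rule D1)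
  interpret \<sigma>2: prob_space \<sigma>2 by (rule D2)
  interpret P: pair_prob_space \<sigma>1 \<sigma>2 by unfold_locales
  have \<nu>: "prob_space \<nu>" unfolding D1(4)[symmetric] by (rule \<sigma>1.prob_space_distr) simp
  interpret \<nu>: prob_space \<nu> by (rule \<nu>)
  have sets_\<nu> [measurable_cong]: "sets \<nu> = sets borel" unfolding D1(4)[symmetric] by simp
  \<comment> \<open>The cell of a point is the first ball of radius e / 2 containing it, so points
    in one cell have distance below e.\<close>
  define cl where "cl x = (LEAST i. dist (q i) x < e / 2)" for x
  have cl [measurable]: "cl \<in> borel \<rightarrow>\<^sub>M count_space UNIV"
    unfolding cl_def[abs_def]
  proof (rule measurable_Least)
    fix i
    show "Measurable.pred borel (\<lambda>x. dist (q i) x < e / 2)"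
      using borel_open[OF open_ball[of "q i" "e / 2"]] unfolding ball_def pred_def space_borel by simp
  qed
  have cl_near: "dist y y' < e" if "cl y = cl y'" for y y'
  proof -
    have "dist (q (cl x)) x < e / 2" for x
      unfolding cl_def by (rule LeastI_ex[OF dense]) (use e in simp)
    from this[of y] this[of y'] that show ?thesis
      using dist_triangle[of y y' "q (cl y)"] by (simp add: dist_commute)
  qed
  define w where "w n = emeasure \<nu> {y. cl y = n}" for n
  \<comment> \<open>Cells of mass 0, where 1 / w would be infinite, are together negligible since
    there are only countably many.\<close>
  have w_AE: "AE y in \<nu>. w (cl y) \<noteq> 0"
  proof -
    have "AE y in \<nu>. cl y = n \<longrightarrow> w n \<noteq> 0" for n
    proof (cases "w n = 0")
      case True
      then have "{y. cl y = n} \<in> null_sets \<nu>"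
        unfolding w_def by (auto simp: null_sets_def)
      then show ?thesis by (rule AE_not_in[THEN eventually_mono]) simp
    qed simp
    then have "AE y in \<nu>. \<forall>n. cl y = n \<longrightarrow> w n \<noteq> 0" by (subst AE_all_countable) blast
    then show ?thesis by eventually_elim simp
  qed
  have w_top: "w n \<noteq> \<top>" for n unfolding w_def by simp
  \<comment> \<open>Within each cell the two middle coordinates are coupled independently. The
    factor 1 / w normalises this product coupling, and different cells do not interact.\<close>
  define h where "h p = (if cl (snd (fst p)) = cl (fst (snd p)) then 1 / w (cl (snd (fst p))) else 0)"
    for p :: "('a \<times> 'a) \<times> ('a \<times> 'a)"
  have [measurable]: "(\<lambda>n. 1 / w n) \<in> count_space UNIV \<rightarrow>\<^sub>M borel" by simp
  have "snd \<in> \<sigma>1 \<rightarrow>\<^sub>M borel" "fst \<in> \<sigma>2 \<rightarrow>\<^sub>M borel" by measurable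
  then have cl1 [measurable]: "(\<lambda>p. cl (snd (fst p))) \<in> ?P \<rightarrow>\<^sub>M count_space UNIV"
    and cl2 [measurable]: "(\<lambda>p. cl (fst (snd p))) \<in> ?P \<rightarrow>\<^sub>M count_space UNIV"
    by (auto intro: measurable_compose[OF measurable_compose[OF measurable_fst] cl]
      measurable_compose[OF measurable_compose[OF measurable_snd] cl])
  have "Measurable.pred ?P (\<lambda>p. \<exists>n. cl (snd (fst p)) = n \<and> cl (fst (snd p)) = n)"
    by measurable
  then have [measurable]: "Measurable.pred ?P (\<lambda>p. cl (snd (fst p)) = cl (fst (snd p)))"
    by (rule back_subst[of "Measurable.pred ?P"]) auto
  have [measurable]: "(\<lambda>p. 1 / w (cl (snd (fst p)))) \<in> borel_measurable ?P"
    by (rule measurable_compose[OF cl1]) simp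
  have h [measurable]: "h \<in> borel_measurable ?P"
    unfolding h_def[abs_def] by (intro measurable_If) (auto simp: pred_def[symmetric])
  \<comment> \<open>Both couplings give the cell the same mass w, because they share the middle
    marginal. Hence \<open>h\<close> integrates to 1 in either variable.\<close>
  have frac: "(\<integral>\<^sup>+y. k * (if cl (f y) = i then 1 / w i else 0) \<partial>\<tau>) = k"
    if [measurable]: "f \<in> \<tau> \<rightarrow>\<^sub>M borel" and \<tau>: "distr \<tau> borel f = \<nu>" and w: "w i \<noteq> 0" for f \<tau> k i
  proof -
    have pred [measurable]: "{y \<in> space \<tau>. cl (f y) = i} \<in> sets \<tau>" by measurable
    have "(\<integral>\<^sup>+y. k * (if cl (f y) = i then 1 / w i else 0) \<partial>\<tau>)
        = (\<integral>\<^sup>+y. k * (1 / w i) * indicator {y \<in> space \<tau>. cl (f y) = i} y \<partial>\<tau>)"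
      by (intro nn_integral_cong) (auto split: split_indicator)
    also have "\<dots> = k * (1 / w i) * emeasure \<tau> {y \<in> space \<tau>. cl (f y) = i}"
      by (rule nn_integral_cmult_indicator[OF pred])
    also have "emeasure \<tau> {y \<in> space \<tau>. cl (f y) = i} = w i"
      unfolding w_def \<tau>[symmetric]
      by (subst emeasure_distr) (auto intro!: arg_cong2[where f=emeasure])
    also have "k * (1 / w i) * w i = k * (w i / w i)"
      by (simp add: mult.assoc ennreal_times_divide mult.commute)
    finally show ?thesis
      using w w_top by (simp add: ennreal_divide_self top.not_eq_extremum)
  qed
  have int1: "(\<integral>\<^sup>+p. f (fst p) * h p \<partial>?P) = (\<integral>\<^sup>+p. f p \<partial>\<sigma>1)"
    if [measurable]: "f \<in> borel_measurable borel" for f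
  proof -
    have "(\<integral>\<^sup>+p. f (fst p) * h p \<partial>?P) = (\<integral>\<^sup>+x. \<integral>\<^sup>+y. f x * h (x, y) \<partial>\<sigma>2 \<partial>\<sigma>1)"
      by (subst \<sigma>2.nn_integral_fst[symmetric]) auto
    also have "\<dots> = (\<integral>\<^sup>+x. f x \<partial>\<sigma>1)"
    proof (rule nn_integral_cong_AE)
      have h: "h (x, y) = (if cl (fst y) = cl (snd x) then 1 / w (cl (snd x)) else 0)" for x y
        by (auto simp: h_def)
      have "AE x in \<sigma>1. w (cl (snd x)) \<noteq> 0"
        by (rule AE_distrD[of snd \<sigma>1 borel]) (use w_AE D1(4) in auto)
      then show "AE x in \<sigma>1. (\<integral>\<^sup>+y. f x * h (x, y) \<partial>\<sigma>2) = f x"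
        by eventually_elim (simp add: h frac[OF _ D2(3)])
    qed
    finally show ?thesis .
  qed
  have int2: "(\<integral>\<^sup>+p. f (snd p) * h p \<partial>?P) = (\<integral>\<^sup>+p. f p \<partial>\<sigma>2)"
    if [measurable]: "f \<in> borel_measurable borel" for f
  proof -
    have "(\<integral>\<^sup>+p. f (snd p) * h p \<partial>?P) = (\<integral>\<^sup>+y. \<integral>\<^sup>+x. f y * h (x, y) \<partial>\<sigma>1 \<partial>\<sigma>2)"
      by (subst P.nn_integral_snd[symmetric]) auto
    also have "\<dots> = (\<integral>\<^sup>+y. f y \<partial>\<sigma>2)"
    proof (rule nn_integral_cong_AE)
      have h: "h (x, y) = (if cl (snd x) = cl (fst y) then 1 / w (cl (fst y)) else 0)" for x y
        by (simp add: h_def)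
      have "AE y in \<sigma>2. w (cl (fst y)) \<noteq> 0"
        by (rule AE_distrD[of fst \<sigma>2 borel]) (use w_AE D2(3) in auto)
      then show "AE y in \<sigma>2. (\<integral>\<^sup>+x. f y * h (x, y) \<partial>\<sigma>1) = f y"
        by eventually_elim (simp add: h frac[OF _ D1(4)])
    qed
    finally show ?thesis .
  qed
  have g [measurable]: "(\<lambda>p. (fst (fst p), snd (snd p))) \<in> ?P \<rightarrow>\<^sub>M borel"
    by measurable
  define \<sigma> where "\<sigma> = distr (density ?P h) borel (\<lambda>p. (fst (fst p), snd (snd p)))"
  have int: "(\<integral>\<^sup>+p. f p \<partial>\<sigma>) = (\<integral>\<^sup>+p. f (fst (fst p), snd (snd p)) * h p \<partial>?P)"
    if [measurable]: "f \<in> borel_measurable borel" for f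
    unfolding \<sigma>_def by (subst nn_integral_distr; (subst nn_integral_density)?) (auto simp: mult.commute)
  have sets_\<sigma> [measurable_cong]: "sets \<sigma> = sets borel" unfolding \<sigma>_def by simp
  have "distr \<sigma> borel fst = distr \<sigma>1 borel fst"
  proof (rule distr_eqI)
    fix A :: "'a set" assume [measurable]: "A \<in> sets borel"
    have "(\<integral>\<^sup>+p. indicator A (fst p) \<partial>\<sigma>) = (\<integral>\<^sup>+p. indicator A (fst (fst p)) * h p \<partial>?P)"
      by (subst int) auto
    also have "\<dots> = (\<integral>\<^sup>+p. indicator A (fst p) \<partial>\<sigma>1)" by (rule int1) measurable
    finally show "(\<integral>\<^sup>+p. indicator A (fst p) \<partial>\<sigma>) = (\<integral>\<^sup>+p. indicator A (fst p) \<partial>\<sigma>1)" .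
  qed measurable
  moreover have "distr \<sigma> borel snd = distr \<sigma>2 borel snd"
  proof (rule distr_eqI)
    fix A :: "'a set" assume [measurable]: "A \<in> sets borel"
    have "(\<integral>\<^sup>+p. indicator A (snd p) \<partial>\<sigma>) = (\<integral>\<^sup>+p. indicator A (snd (snd p)) * h p \<partial>?P)"
      by (subst int) auto
    also have "\<dots> = (\<integral>\<^sup>+p. indicator A (snd p) \<partial>\<sigma>2)" by (rule int2) measurable
    finally show "(\<integral>\<^sup>+p. indicator A (snd p) \<partial>\<sigma>) = (\<integral>\<^sup>+p. indicator A (snd p) \<partial>\<sigma>2)" .
  qed measurable
  moreover have total: "(\<integral>\<^sup>+p. h p \<partial>?P) = 1"
    using int1[of "\<lambda>_. 1"] \<sigma>1.emeasure_space_1 by simp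
  have "prob_space \<sigma>"
  proof
    have "emeasure \<sigma> (space \<sigma>) = (\<integral>\<^sup>+p. 1 \<partial>\<sigma>)" by simp
    also have "\<dots> = 1" by (subst int) (auto simp: total)
    finally show "emeasure \<sigma> (space \<sigma>) = 1" .
  qed
  ultimately have "\<sigma> \<in> couplings \<mu> \<rho>"
    by (simp add: couplings_def borel_probs_def sets_\<sigma> D1 D2)
  then have "transport_cost \<mu> \<rho> \<le> coupling_cost \<sigma>" by (rule transport_cost_le)
  also have "\<dots> = (\<integral>\<^sup>+p. ennreal ((dist (fst (fst p)) (snd (snd p)))\<^sup>2) * h p \<partial>?P)"
    unfolding coupling_cost_def by (subst int) auto
  also have "\<dots> \<le> (\<integral>\<^sup>+p. ennreal ((1 + e) / a) * (ennreal ((dist (fst (fst p)) (snd (fst p)))\<^sup>2) * h p) +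
      (ennreal ((1 + e) / b) * (ennreal ((dist (fst (snd p)) (snd (snd p)))\<^sup>2) * h p) + ennreal (e + e\<^sup>2) * h p) \<partial>?P)"
  proof (rule nn_integral_mono)
    fix p :: "('a \<times> 'a) \<times> ('a \<times> 'a)"
    obtain x y y' z where p: "p = ((x, y), (y', z))" by (metis surj_pair)
    show "ennreal ((dist (fst (fst p)) (snd (snd p)))\<^sup>2) * h p \<le> ennreal ((1 + e) / a) * (ennreal ((dist (fst (fst p)) (snd (fst p)))\<^sup>2) * h p) +
      (ennreal ((1 + e) / b) * (ennreal ((dist (fst (snd p)) (snd (snd p)))\<^sup>2) * h p) + ennreal (e + e\<^sup>2) * h p)"
    proof (cases "cl y = cl y'")
      case True
      let ?s = "dist x y + dist y' z"
      have "dist x z \<le> dist x y + dist y y' + dist y' z"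
        using dist_triangle[of x z y] dist_triangle[of y z y'] by linarith
      then have "(dist x z)\<^sup>2 \<le> (?s + e)\<^sup>2"
        using cl_near[OF True] by (intro power_mono) auto
      \<comment> \<open>The difference of the two sides is e (s - 1)^2.\<close>
      also have "\<dots> \<le> (1 + e) * ?s\<^sup>2 + (e + e\<^sup>2)"
      proof -
        have "0 \<le> e * (?s - 1)\<^sup>2" using e by simp
        then show ?thesis by (simp add: power2_eq_square algebra_simps)
      qed
      also have "\<dots> \<le> (1 + e) * ((dist x y)\<^sup>2 / a + (dist y' z)\<^sup>2 / b) + (e + e\<^sup>2)"
        using e by (intro add_right_mono mult_left_mono sq_add_le ab) auto
      finally have "ennreal ((dist x z)\<^sup>2) \<le> ennreal ((1 + e) / a * (dist x y)\<^sup>2 + ((1 + e) / b * (dist y' z)\<^sup>2 + (e + e\<^sup>2)))"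
        by (intro ennreal_leI) (simp add: algebra_simps)
      also have "\<dots> = ennreal ((1 + e) / a) * ennreal ((dist x y)\<^sup>2) + (ennreal ((1 + e) / b) * ennreal ((dist y' z)\<^sup>2) + ennreal (e + e\<^sup>2))"
        using e ab by (simp add: ennreal_plus[symmetric] ennreal_mult[symmetric] del: ennreal_plus)
      finally have "ennreal ((dist x z)\<^sup>2) * h p \<le> \<dots> * h p"
        by (rule mult_right_mono) simp
      then show ?thesis unfolding p by (simp add: distrib_right mult.assoc)
    qed (simp add: p h_def)
  qed
  also have "\<dots> = ennreal ((1 + e) / a) * coupling_cost \<sigma>1 + (ennreal ((1 + e) / b) * coupling_cost \<sigma>2 + ennreal (e + e\<^sup>2))"
  proof -
    have "(\<integral>\<^sup>+p. ennreal ((dist (fst (fst p)) (snd (fst p)))\<^sup>2) * h p \<partial>?P) = coupling_cost \<sigma>1"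
      unfolding coupling_cost_def by (rule int1) measurable
    moreover have "(\<integral>\<^sup>+p. ennreal ((dist (fst (snd p)) (snd (snd p)))\<^sup>2) * h p \<partial>?P) = coupling_cost \<sigma>2"
      unfolding coupling_cost_def by (rule int2) measurable
    ultimately show ?thesis
      by (simp add: nn_integral_add nn_integral_cmult total)
  qed
  also have "\<dots> = ennreal (1 + e) * (ennreal (1 / a) * coupling_cost \<sigma>1 + ennreal (1 / b) * coupling_cost \<sigma>2) + ennreal (e + e\<^sup>2)"
  proof -
    have "ennreal ((1 + e) / c) = ennreal (1 + e) * ennreal (1 / c)" if "c > 0" for c
      using e that by (subst ennreal_mult[symmetric]) auto
    then show ?thesis using ab by (simp add: distrib_left mult.assoc add.assoc)
  qed
  finally show ?thesis .
qed

text \<open>Approximate gluing of two optimal couplings with mesh 1 / (n + 1), and passage to the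
  limit in n. An infinite cost on the right makes the claim trivial.\<close>

lemma transport_cost_triangle:
  fixes q :: "nat \<Rightarrow> 'a::complete_space" and \<mu> \<nu> \<rho> :: "'a measure"
  assumes q: "dense_sequence q" and sets: "sets \<mu> = sets borel" "sets \<nu> = sets borel" "sets \<rho> = sets borel"
    and ab: "0 < a" "0 < b" "a + b = 1"
  shows "transport_cost \<mu> \<rho> \<le> ennreal (1 / a) * transport_cost \<mu> \<nu> + ennreal (1 / b) * transport_cost \<nu> \<rho>"
proof (cases "transport_cost \<mu> \<nu> < \<infinity> \<and> transport_cost \<nu> \<rho> < \<infinity>")
  case False
  then show ?thesis
    using ab by (auto simp: ennreal_mult_eq_top_iff top.not_eq_extremum[symmetric] ennreal_mult_top)
next
  case True
  interpret dense_sequence q by fact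
  obtain \<sigma>1 where \<sigma>1: "\<sigma>1 \<in> couplings \<mu> \<nu>" "coupling_cost \<sigma>1 = transport_cost \<mu> \<nu>"
    using ex_optimal_coupling[OF q _ sets(1,2)] True by blast
  obtain \<sigma>2 where \<sigma>2: "\<sigma>2 \<in> couplings \<nu> \<rho>" "coupling_cost \<sigma>2 = transport_cost \<nu> \<rho>"
    using ex_optimal_coupling[OF q _ sets(2,3)] True by blast
  let ?C = "ennreal (1 / a) * transport_cost \<mu> \<nu> + ennreal (1 / b) * transport_cost \<nu> \<rho>"
  have "?C < \<infinity>" using True by (simp add: ennreal_mult_less_top)
  then obtain C where C: "?C = ennreal C" "C \<ge> 0"
    by (cases ?C) auto
  have "transport_cost \<mu> \<rho> \<le> ennreal ((1 + 1 / Suc n) * C + (1 / Suc n + (1 / Suc n)\<^sup>2))" for n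
  proof -
    have "transport_cost \<mu> \<rho> \<le> ennreal (1 + 1 / Suc n) * ?C + ennreal (1 / Suc n + (1 / Suc n)\<^sup>2)"
      using transport_cost_approximate_gluing[OF \<sigma>1(1) \<sigma>2(1) ab, of "1 / Suc n"]
      unfolding \<sigma>1(2) \<sigma>2(2) by simp
    also have "\<dots> = ennreal ((1 + 1 / Suc n) * C + (1 / Suc n + (1 / Suc n)\<^sup>2))"
      unfolding C(1) using C(2) by (subst ennreal_mult[symmetric]; (subst ennreal_plus[symmetric])?) auto
    finally show ?thesis .
  qed
  moreover have "(\<lambda>n. ennreal ((1 + 1 / Suc n) * C + (1 / Suc n + (1 / Suc n)\<^sup>2))) \<longlonglongrightarrow> ennreal ((1 + 0) * C + (0 + 0\<^sup>2))"
    by (intro tendsto_ennrealI tendsto_intros LIMSEQ_Suc[OF lim_1_over_n])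
  ultimately have "transport_cost \<mu> \<rho> \<le> ennreal ((1 + 0) * C + (0 + 0\<^sup>2))"
    by (intro LIMSEQ_le_const) auto
  then show ?thesis using C by simp
qed

section \<open>Optimality of parts of an optimal coupling\<close>

text \<open>The mixture is the law of a two-stage experiment, a Bernoulli choice followed by a
  sample, so the Giry monad supplies the measure and its integrals.\<close>

lemma ex_mixture:
  assumes M1: "prob_space M1" "sets M1 = sets N" and M0: "prob_space M0" "sets M0 = sets N"
    and c: "0 \<le> c" "c \<le> 1"
  shows "\<exists>M. prob_space M \<and> sets M = sets N \<and>
    (\<forall>f\<in>borel_measurable N. (\<integral>\<^sup>+x. f x \<partial>M) = ennreal c * (\<integral>\<^sup>+x. f x \<partial>M1) + ennreal (1 - c) * (\<integral>\<^sup>+x. f x \<partial>M0))"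
proof (intro exI conjI ballI)
  let ?K = "\<lambda>b. if b then M1 else M0"
  let ?M = "measure_pmf (bernoulli_pmf c) \<bind> ?K"
  have K: "?K \<in> measure_pmf (bernoulli_pmf c) \<rightarrow>\<^sub>M subprob_algebra N"
    using assms by (auto simp: measurable_pmf_measure1 space_subprob_algebra prob_space_imp_subprob_space)
  show sets: "sets ?M = sets N" by (rule sets_bind[OF sets_kernel[OF K]]) auto
  have eq: "(\<integral>\<^sup>+x. f x \<partial>?M) = ennreal c * (\<integral>\<^sup>+x. f x \<partial>M1) + ennreal (1 - c) * (\<integral>\<^sup>+x. f x \<partial>M0)"
    if f: "f \<in> borel_measurable N" for f
    by (subst nn_integral_bind[OF f K]) (use c in \<open>simp add: mult.commute\<close>)
  then show "(\<integral>\<^sup>+x. f x \<partial>?M) = ennreal c * (\<integral>\<^sup>+x. f x \<partial>M1) + ennreal (1 - c) * (\<integral>\<^sup>+x. f x \<partial>M0)"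
    if "f \<in> borel_measurable N" for f using that .
  show "prob_space ?M"
  proof
    have "emeasure ?M (space ?M) = (\<integral>\<^sup>+x. 1 \<partial>?M)" by simp
    also have "\<dots> = ennreal c + ennreal (1 - c)"
      by (subst eq) (use prob_space.emeasure_space_1[OF M1(1)] prob_space.emeasure_space_1[OF M0(1)] in auto)
    also have "\<dots> = 1" using c by (simp add: ennreal_plus[symmetric] del: ennreal_plus)
    finally show "emeasure ?M (space ?M) = 1" .
  qed
qed

lemma uniform_measure_coupling:
  fixes \<sigma> :: "('a::metric_space \<times> 'a) measure"
  assumes "prob_space \<sigma>" "sets \<sigma> = sets borel" "emeasure \<sigma> A \<noteq> 0"
  shows "uniform_measure \<sigma> A \<in> couplings (distr (uniform_measure \<sigma> A) borel fst) (distr (uniform_measure \<sigma> A) borel snd)"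
  using assms prob_space.finite_measure[OF assms(1)]
  by (auto simp: couplings_def borel_probs_def finite_measure.emeasure_finite intro!: prob_space_uniform_measure)

text \<open>A cheaper coupling of the conditioned marginals could be substituted for the part of
  \<sigma> on \<open>A\<close>. Together with the unchanged part on the complement it would couple
  \<mu> and \<nu> more cheaply than \<sigma>.\<close>

lemma restriction_optimal:
  fixes \<sigma> :: "('a::metric_space \<times> 'a) measure"
  assumes \<sigma>: "\<sigma> \<in> couplings \<mu> \<nu>" and opt: "coupling_cost \<sigma> = transport_cost \<mu> \<nu>" and fin: "coupling_cost \<sigma> < \<infinity>"
    and A: "A \<in> sets borel" "emeasure \<sigma> A \<noteq> 0"
  defines "\<sigma>' \<equiv> uniform_measure \<sigma> A"
  shows "coupling_cost \<sigma>' = transport_cost (distr \<sigma>' borel fst) (distr \<sigma>' borel snd)" "coupling_cost \<sigma>' < \<infinity>"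
proof -
  note D = couplingsD[OF \<sigma>]
  note D(2)[measurable_cong]
  note A(1)[measurable]
  interpret \<sigma>: prob_space \<sigma> by (rule D)
  have sp: "space \<sigma> = UNIV" using sets_eq_imp_space_eq[OF D(2)] by simp
  have sets': "sets \<sigma>' = sets borel" unfolding \<sigma>'_def by (simp add: D)
  note sets'[measurable_cong]
  define c where "c = measure \<sigma> A"
  have c: "0 < c" "c \<le> 1" "emeasure \<sigma> A = ennreal c"
    using A by (auto simp: c_def \<sigma>.emeasure_eq_measure zero_less_measure_iff)
  have scale: "ennreal c * (\<integral>\<^sup>+p. f p \<partial>\<sigma>') = (\<integral>\<^sup>+p. f p * indicator A p \<partial>\<sigma>)"
    if [measurable]: "f \<in> borel_measurable borel" for f
  proof -
    have "(\<integral>\<^sup>+p. f p \<partial>\<sigma>') = (\<integral>\<^sup>+p. f p * indicator A p \<partial>\<sigma>) / ennreal c"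
      unfolding \<sigma>'_def by (subst nn_integral_uniform_measure) (use c A in auto)
    then show ?thesis
      using c ennreal_mult_divide_eq[of "ennreal c" "\<integral>\<^sup>+p. f p * indicator A p \<partial>\<sigma>"]
      by (simp add: ennreal_times_divide mult.commute)
  qed
  have "ennreal c * coupling_cost \<sigma>' \<le> coupling_cost \<sigma>"
    unfolding coupling_cost_def by (subst scale) (auto intro!: nn_integral_mono split: split_indicator)
  then have "ennreal c * coupling_cost \<sigma>' < \<infinity>" using fin by (rule le_less_trans)
  then show fin': "coupling_cost \<sigma>' < \<infinity>"
    using c by (auto simp: ennreal_mult_less_top)
  have le: "coupling_cost \<sigma>' \<le> coupling_cost \<theta>"
    if \<theta>: "\<theta> \<in> couplings (distr \<sigma>' borel fst) (distr \<sigma>' borel snd)" for \<theta>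
  proof -
    note T = couplingsD[OF \<theta>]
    note T(2)[measurable_cong]
    have cA: "measure \<sigma> (-A) = 1 - c"
      using \<sigma>.prob_compl[of A] by (simp add: c_def sp Compl_eq_Diff_UNIV)
    have cA': "emeasure \<sigma> (-A) = ennreal (1 - c)"
      by (simp add: \<sigma>.emeasure_eq_measure cA)
    \<comment> \<open>For c = 1 the complement is null and cannot be normalised; \<theta> then
      stands in as a probability measure of weight 0.\<close>
    define M0 where "M0 = (if c = 1 then \<theta> else uniform_measure \<sigma> (-A))"
    have M0: "prob_space M0" "sets M0 = sets borel"
      using T cA' c by (auto simp: M0_def D intro!: prob_space_uniform_measure)
    have rest: "ennreal (1 - c) * (\<integral>\<^sup>+p. f p \<partial>M0) = (\<integral>\<^sup>+p. f p * indicator (-A) p \<partial>\<sigma>)"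
      if [measurable]: "f \<in> borel_measurable borel" for f
    proof (cases "c = 1")
      case True
      then have "-A \<in> null_sets \<sigma>" using cA' by (auto simp: null_sets_def)
      then show ?thesis using True by (simp add: nn_integral_null_set)
    next
      case False
      then have c1: "1 - c > 0" using c by simp
      have "(\<integral>\<^sup>+p. f p \<partial>M0) = (\<integral>\<^sup>+p. f p * indicator (-A) p \<partial>\<sigma>) / ennreal (1 - c)"
        unfolding M0_def using False by (simp, subst nn_integral_uniform_measure) (use c1 cA' in auto)
      then show ?thesis
        using c1 ennreal_mult_divide_eq[of "ennreal (1 - c)" "\<integral>\<^sup>+p. f p * indicator (-A) p \<partial>\<sigma>"]
        by (simp add: ennreal_times_divide mult.commute)
    qed
    obtain M where M: "prob_space M" "sets M = sets borel" and
      int: "\<And>f. f \<in> borel_measurable borel \<Longrightarrow> (\<integral>\<^sup>+x. f x \<partial>M) = ennreal c * (\<integral>\<^sup>+x. f x \<partial>\<theta>) + ennreal (1 - c) * (\<integral>\<^sup>+x. f x \<partial>M0)"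
      using ex_mixture[OF T(1,2) M0, of c] c by auto
    note M(2)[measurable_cong]
    have split: "(\<integral>\<^sup>+p. f p \<partial>\<sigma>) = (\<integral>\<^sup>+p. f p * indicator A p \<partial>\<sigma>) + (\<integral>\<^sup>+p. f p * indicator (-A) p \<partial>\<sigma>)"
      if [measurable]: "f \<in> borel_measurable borel" for f
      by (subst nn_integral_add[symmetric]) (auto intro!: nn_integral_cong split: split_indicator)
    have marg: "distr M borel h = distr \<sigma> borel h"
      if [measurable]: "h \<in> borel \<rightarrow>\<^sub>M borel" and h: "distr \<theta> borel h = distr \<sigma>' borel h" for h :: "'a \<times> 'a \<Rightarrow> 'a"
    proof (rule distr_eqI)
      fix B :: "'a set" assume [measurable]: "B \<in> sets borel"
      have "(\<integral>\<^sup>+p. indicator B (h p) \<partial>\<theta>) = (\<integral>\<^sup>+x. indicator B x \<partial>distr \<theta> borel h)"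
        by (subst nn_integral_distr) auto
      also have "\<dots> = (\<integral>\<^sup>+p. indicator B (h p) \<partial>\<sigma>')"
        unfolding h by (subst nn_integral_distr) auto
      finally have \<theta>\<sigma>': "(\<integral>\<^sup>+p. indicator B (h p) \<partial>\<theta>) = (\<integral>\<^sup>+p. indicator B (h p) \<partial>\<sigma>')" .
      have "(\<integral>\<^sup>+p. indicator B (h p) \<partial>M)
          = ennreal c * (\<integral>\<^sup>+p. indicator B (h p) \<partial>\<sigma>') + ennreal (1 - c) * (\<integral>\<^sup>+p. indicator B (h p) \<partial>M0)"
        unfolding \<theta>\<sigma>'[symmetric] by (rule int) measurable
      also have "\<dots> = (\<integral>\<^sup>+p. indicator B (h p) \<partial>\<sigma>)"
        by (subst scale; (subst rest)?; (subst split)?) auto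
      finally show "(\<integral>\<^sup>+p. indicator B (h p) \<partial>M) = (\<integral>\<^sup>+p. indicator B (h p) \<partial>\<sigma>)" .
    qed measurable
    have "M \<in> couplings \<mu> \<nu>"
      using M marg[OF measurable_fst_borel T(3)] marg[OF measurable_snd_borel T(4)] D
      by (simp add: couplings_def borel_probs_def)
    then have "coupling_cost \<sigma> \<le> coupling_cost M"
      unfolding opt by (rule transport_cost_le)
    moreover have "coupling_cost M = ennreal c * coupling_cost \<theta> + (\<integral>\<^sup>+p. ennreal ((dist (fst p) (snd p))\<^sup>2) * indicator (-A) p \<partial>\<sigma>)"
      unfolding coupling_cost_def by (subst int; (subst rest)?) auto
    moreover have eq\<sigma>: "coupling_cost \<sigma> = ennreal c * coupling_cost \<sigma>' + (\<integral>\<^sup>+p. ennreal ((dist (fst p) (snd p))\<^sup>2) * indicator (-A) p \<partial>\<sigma>)"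
      unfolding coupling_cost_def by (subst scale; (subst split)?) auto
    \<comment> \<open>Finiteness of the unchanged part allows its cancellation from both
      sides.\<close>
    moreover have "(\<integral>\<^sup>+p. ennreal ((dist (fst p) (snd p))\<^sup>2) * indicator (-A) p \<partial>\<sigma>) < \<infinity>"
      using fin unfolding eq\<sigma> by (simp add: ennreal_add_eq_top less_top)
    ultimately have "ennreal c * coupling_cost \<sigma>' \<le> ennreal c * coupling_cost \<theta>"
      by (auto simp: ennreal_add_left_cancel_le add.commute)
    then show ?thesis
      using c by (simp add: ennreal_mult_le_mult_iff)
  qed
  have "\<sigma>' \<in> couplings (distr \<sigma>' borel fst) (distr \<sigma>' borel snd)"
    unfolding \<sigma>'_def by (rule uniform_measure_coupling) (use D A in auto)
  then show "coupling_cost \<sigma>' = transport_cost (distr \<sigma>' borel fst) (distr \<sigma>' borel snd)"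
    using le by (intro antisym transport_cost_le) (auto simp: transport_cost_eq_INF intro: INF_greatest)
qed

section \<open>Geodesics of measures from geodesics of points\<close>

definition geodesic_family :: "('a::metric_space \<times> 'a) measure \<Rightarrow> ('a \<times> 'a \<Rightarrow> real \<Rightarrow> 'a) \<Rightarrow> bool" where
  "geodesic_family \<sigma> e \<longleftrightarrow> (\<forall>t. (\<lambda>w. e w t) \<in> borel_measurable borel) \<and>
    (AE w in \<sigma>. e w 0 = fst w \<and> e w 1 = snd w \<and>
      (\<forall>s\<in>{0..1}. \<forall>t\<in>{0..1}. dist (e w s) (e w t) = \<bar>s - t\<bar> * dist (fst w) (snd w)))"

text \<open>Evaluating the geodesics at two times couples the measures there and bounds the cost
  above by (s - t)^2 W. Were it smaller, the triangle inequality would push the total cost below W,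
  which is optimal.\<close>

theorem displacement_geodesic:
  fixes q :: "nat \<Rightarrow> 'a::complete_space" and \<sigma> :: "('a \<times> 'a) measure"
  assumes q: "dense_sequence q" and \<sigma>: "\<sigma> \<in> couplings \<mu> \<nu>"
    and opt: "coupling_cost \<sigma> = transport_cost \<mu> \<nu>" and fin: "coupling_cost \<sigma> < \<infinity>"
    and e: "geodesic_family \<sigma> e"
  defines "\<Gamma> \<equiv> \<lambda>t. distr \<sigma> borel (\<lambda>w. e w t)"
  shows "\<Gamma> \<in> wasserstein_geodesics" "\<Gamma> 0 = \<mu>" "\<Gamma> 1 = \<nu>"
proof -
  interpret dense_sequence q by fact
  note D = couplingsD[OF \<sigma>]
  note D(2)[measurable_cong]
  interpret \<sigma>: prob_space \<sigma> by (rule D)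
  have em [measurable]: "(\<lambda>w. e w t) \<in> borel_measurable borel" for t
    using e by (simp add: geodesic_family_def)
  have AE: "AE w in \<sigma>. e w 0 = fst w \<and> e w 1 = snd w \<and>
      (\<forall>s\<in>{0..1}. \<forall>t\<in>{0..1}. dist (e w s) (e w t) = \<bar>s - t\<bar> * dist (fst w) (snd w))"
    using e by (simp add: geodesic_family_def)
  have probs: "\<Gamma> t \<in> borel_probs" for t
    unfolding \<Gamma>_def borel_probs_def by (auto intro!: \<sigma>.prob_space_distr)
  have sets\<Gamma>: "sets (\<Gamma> t) = sets borel" for t unfolding \<Gamma>_def by simp
  show \<Gamma>0: "\<Gamma> 0 = \<mu>"
    unfolding \<Gamma>_def D(3)[symmetric] by (rule distr_cong_AE) (use AE in auto)
  show \<Gamma>1: "\<Gamma> 1 = \<nu>"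
    unfolding \<Gamma>_def D(4)[symmetric] by (rule distr_cong_AE) (use AE in auto)
  obtain W where W: "coupling_cost \<sigma> = ennreal W" "0 \<le> W"
    using fin by (cases "coupling_cost \<sigma>") auto
  have upper: "transport_cost (\<Gamma> s) (\<Gamma> t) \<le> ennreal ((s - t)\<^sup>2 * W)" if "s \<in> {0..1}" "t \<in> {0..1}" for s t
  proof -
    let ?s = "distr \<sigma> borel (\<lambda>w. (e w s, e w t))"
    have "?s \<in> couplings (\<Gamma> s) (\<Gamma> t)"
      unfolding couplings_def borel_probs_def \<Gamma>_def
      by (auto simp: distr_distr comp_def intro!: \<sigma>.prob_space_distr)
    then have "transport_cost (\<Gamma> s) (\<Gamma> t) \<le> coupling_cost ?s" by (rule transport_cost_le)
    also have "\<dots> = (\<integral>\<^sup>+w. ennreal ((dist (e w s) (e w t))\<^sup>2) \<partial>\<sigma>)"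
      unfolding coupling_cost_def by (subst nn_integral_distr) auto
    also have "\<dots> = (\<integral>\<^sup>+w. ennreal ((s - t)\<^sup>2) * ennreal ((dist (fst w) (snd w))\<^sup>2) \<partial>\<sigma>)"
    proof (rule nn_integral_cong_AE)
      show "AE w in \<sigma>. ennreal ((dist (e w s) (e w t))\<^sup>2) = ennreal ((s - t)\<^sup>2) * ennreal ((dist (fst w) (snd w))\<^sup>2)"
        using AE by eventually_elim (use that in \<open>simp add: power_mult_distrib ennreal_mult\<close>)
    qed
    also have "\<dots> = ennreal ((s - t)\<^sup>2) * coupling_cost \<sigma>"
      unfolding coupling_cost_def by (rule nn_integral_cmult) measurable
    also have "\<dots> = ennreal ((s - t)\<^sup>2 * W)"
      using W by (simp add: ennreal_mult)
    finally show ?thesis .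
  qed
  define T where "T s t = enn2real (transport_cost (\<Gamma> s) (\<Gamma> t))" for s t
  have T: "transport_cost (\<Gamma> s) (\<Gamma> t) = ennreal (T s t)" "0 \<le> T s t" "T s t \<le> (s - t)\<^sup>2 * W"
    if "s \<in> {0..1}" "t \<in> {0..1}" for s t
  proof -
    have "transport_cost (\<Gamma> s) (\<Gamma> t) < \<top>"
      using upper[OF that] by (rule le_less_trans) simp
    then show "transport_cost (\<Gamma> s) (\<Gamma> t) = ennreal (T s t)" unfolding T_def by simp
    then show "T s t \<le> (s - t)\<^sup>2 * W" using upper[OF that] W by simp
  qed (simp add: T_def)
  have tri: "T r t \<le> T r s / a + T s t / b"
    if "r \<in> {0..1}" "s \<in> {0..1}" "t \<in> {0..1}" "0 < a" "0 < b" "a + b = 1" for r s t a b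
  proof -
    have "ennreal (T r t) \<le> ennreal (1 / a) * ennreal (T r s) + ennreal (1 / b) * ennreal (T s t)"
      using transport_cost_triangle[OF q sets\<Gamma> sets\<Gamma> sets\<Gamma> that(4-6), of r t s] T(1) that by simp
    also have "\<dots> = ennreal (T r s / a + T s t / b)"
      using that T(2) by (simp add: ennreal_mult[symmetric] ennreal_plus[symmetric] del: ennreal_plus)
    finally show ?thesis
      using that T(2) by (subst (asm) ennreal_le_iff) auto
  qed
  have T01: "T 0 1 = W" unfolding T_def \<Gamma>0 \<Gamma>1 opt[symmetric] W using W by simp
  have from0: "T 0 t = t\<^sup>2 * W" if t: "t \<in> {0..1}" for t
  proof (cases "t = 0 \<or> t = 1")
    case True
    then show ?thesis using T01 T[of 0 0] by auto
  next
    case False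
    then have t': "0 < t" "t < 1" using t by auto
    \<comment> \<open>Weights equal to the durations t and 1 - t make the weighted triangle
      inequality sharp at constant speed.\<close>
    have "W \<le> T 0 t / t + T t 1 / (1 - t)"
      using tri[of 0 t 1 t "1 - t"] t' by (simp add: T01)
    also have "\<dots> \<le> T 0 t / t + (1 - t)\<^sup>2 * W / (1 - t)"
      using T(3)[of t 1] t' by (intro add_left_mono divide_right_mono) (auto simp: power2_commute)
    also have "(1 - t)\<^sup>2 * W / (1 - t) = (1 - t) * W"
      using t' by (simp add: power2_eq_square)
    finally have "t * W \<le> T 0 t / t" by (simp add: algebra_simps)
    then have "t\<^sup>2 * W \<le> T 0 t"
      using t' by (simp add: le_divide_eq power2_eq_square algebra_simps)
    then show ?thesis using T(3)[of 0 t] t by auto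
  qed
  have ordered: "T s t = (s - t)\<^sup>2 * W" if st: "0 \<le> s" "s \<le> t" "t \<le> 1" for s t
  proof (cases "s = 0 \<or> s = t")
    case True
    then show ?thesis using from0[of t] T[of t t] st by auto
  next
    case False
    then have s: "0 < s" "s < t" "t > 0" using st by auto
    \<comment> \<open>The same choice on [0, t]: the weights are the fractions of time spent before
      and after s.\<close>
    have "t\<^sup>2 * W \<le> T 0 s / (s / t) + T s t / ((t - s) / t)"
      using tri[of 0 s t "s / t" "(t - s) / t"] from0[of t] s st by (simp add: add_divide_distrib[symmetric])
    also have "T 0 s / (s / t) = s * t * W"
      using from0[of s] s st by (simp add: power2_eq_square)
    finally have "t * (t - s) * W \<le> T s t * t / (t - s)" by (simp add: power2_eq_square algebra_simps)
    then have "t * ((t - s)\<^sup>2 * W) \<le> t * T s t"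
      using s by (simp add: le_divide_eq power2_eq_square algebra_simps)
    then have "(t - s)\<^sup>2 * W \<le> T s t" using s by simp
    then show ?thesis using T(3)[of s t] s st by (auto simp: power2_commute)
  qed
  have T_eq: "T s t = (s - t)\<^sup>2 * W" if "s \<in> {0..1}" "t \<in> {0..1}" for s t
  proof (cases "s \<le> t")
    case False
    then have "T t s = (t - s)\<^sup>2 * W" using ordered[of t s] that by simp
    moreover have "T s t = T t s" unfolding T_def by (simp add: transport_cost_commute)
    ultimately show ?thesis by (simp add: power2_commute)
  qed (use that ordered in auto)
  have W2: "W2 (\<Gamma> s) (\<Gamma> t) = ennreal (\<bar>s - t\<bar> * sqrt W)" if "s \<in> {0..1}" "t \<in> {0..1}" for s t
    using T(1)[OF that] T_eq[OF that] W that by (simp add: W2_def real_sqrt_mult)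
  have "((\<lambda>s. W2 (\<Gamma> s) (\<Gamma> t)) \<longlongrightarrow> 0) (at t within {0..1})" if t: "t \<in> {0..1}" for t
  proof -
    have "((\<lambda>s. ennreal (\<bar>s - t\<bar> * sqrt W)) \<longlongrightarrow> ennreal (\<bar>t - t\<bar> * sqrt W)) (at t within {0..1})"
      by (intro tendsto_ennrealI tendsto_intros)
    moreover have "\<forall>\<^sub>F s in at t within {0..1}. ennreal (\<bar>s - t\<bar> * sqrt W) = W2 (\<Gamma> s) (\<Gamma> t)"
      unfolding eventually_at_filter using W2 t by simp
    ultimately show ?thesis by (simp add: tendsto_cong)
  qed
  then show "\<Gamma> \<in> wasserstein_geodesics"
    unfolding wasserstein_geodesics_def
    using probs W2 W by (auto simp: ennreal_mult)
qed

section \<open>Density bounds from displacement convexity\<close>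

lemma null_set_if_integral_le:
  fixes f g :: "'a \<Rightarrow> real"
  assumes [measurable]: "f \<in> borel_measurable M" "g \<in> borel_measurable M" "E \<in> sets M"
    and less: "\<And>x. x \<in> E \<Longrightarrow> 0 \<le> f x \<and> f x < g x"
    and le: "(\<integral>\<^sup>+x. ennreal (g x) * indicator E x \<partial>M) \<le> (\<integral>\<^sup>+x. ennreal (f x) * indicator E x \<partial>M)"
    and fin: "(\<integral>\<^sup>+x. ennreal (f x) * indicator E x \<partial>M) \<noteq> \<infinity>"
  shows "E \<in> null_sets M"
proof -
  have fg: "AE x in M. ennreal (f x) * indicator E x \<le> ennreal (g x) * indicator E x"
  proof (intro AE_I2)
    show "ennreal (f x) * indicator E x \<le> ennreal (g x) * indicator E x" for x
      using less[of x] by (cases "x \<in> E") (simp_all add: ennreal_leI)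
  qed
  have "AE x in M. ennreal (g x) * indicator E x \<le> ennreal (f x) * indicator E x"
  proof (rule ccontr)
    assume n: "\<not> ?thesis"
    have "(\<integral>\<^sup>+x. ennreal (f x) * indicator E x \<partial>M) < (\<integral>\<^sup>+x. ennreal (g x) * indicator E x \<partial>M)"
      by (rule nn_integral_less) (use fin fg n in auto)
    with le show False by simp
  qed
  then have "AE x in M. x \<notin> E"
  proof eventually_elim
    case (elim x)
    then show ?case using less[of x] by (auto simp: ennreal_le_iff split: split_indicator_asm)
  qed
  then show ?thesis
    using AE_iff_null_sets[OF assms(3)] by simp
qed

section \<open>Lebesgue decompositions and their densities\<close>

context
  fixes m :: "'a measure" and \<mu> :: "'a measure"
  assumes m: "sigma_finite_measure m" and \<mu>: "prob_space \<mu>" and sets_\<mu>: "sets \<mu> = sets m"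
begin

interpretation m: sigma_finite_measure m by (rule m)
interpretation \<mu>: prob_space \<mu> by (rule \<mu>)

lemma ex_real_density:
  assumes \<nu>: "finite_measure \<nu>" "sets \<nu> = sets m" and ac: "absolutely_continuous m \<nu>"
  shows "\<exists>\<rho>. \<rho> \<in> borel_measurable m \<and> (\<forall>x. 0 \<le> \<rho> x) \<and> density m (\<lambda>x. ennreal (\<rho> x)) = \<nu>"
proof -
  interpret \<nu>: finite_measure \<nu> by fact
  obtain f where f [measurable]: "f \<in> borel_measurable m" and d: "density m f = \<nu>"
    using m.Radon_Nikodym[OF ac \<nu>(2)] by blast
  have "(\<integral>\<^sup>+x. f x \<partial>m) = emeasure \<nu> (space m)"
    unfolding d[symmetric] by (simp add: emeasure_density cong: nn_integral_cong)
  then have "(\<integral>\<^sup>+x. f x \<partial>m) \<noteq> \<infinity>" by (simp add: \<nu>.emeasure_finite)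
  then have "AE x in m. f x \<noteq> \<infinity>" by (intro nn_integral_PInf_AE) auto
  then have "density m (\<lambda>x. ennreal (enn2real (f x))) = density m f"
    by (intro density_cong) (auto simp: top.not_eq_extremum)
  with d show ?thesis
    by (intro exI[of _ "\<lambda>x. enn2real (f x)"]) auto
qed

text \<open>\<open>S\<close> is an m-null set of largest \<mu>-mass and carries the singular part.
  The rest is absolutely continuous, since a further null set with positive mass could be added to
  \<open>S\<close>.\<close>

lemma ex_lebesgue_decomposition: "\<exists>\<rho> \<mu>s. lebesgue_decomposition m \<mu> \<rho> \<mu>s"
proof -
  let ?s = "SUP S\<in>null_sets m. emeasure \<mu> S"
  have ne: "null_sets m \<noteq> {}" by (metis empty_iff null_sets.empty_sets)
  obtain f :: "nat \<Rightarrow> ennreal" where f: "range f \<subseteq> emeasure \<mu> ` null_sets m" "?s = (SUP n. f n)"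
    using ennreal_Sup_countable_SUP[of "emeasure \<mu> ` null_sets m"] ne by auto
  then have "\<forall>n. \<exists>S\<in>null_sets m. f n = emeasure \<mu> S" by blast
  then obtain T where T: "\<And>n. T n \<in> null_sets m" "\<And>n. f n = emeasure \<mu> (T n)"
    by (auto simp: Bex_def choice_iff)
  define S where "S = (\<Union>n. T n)"
  have S: "S \<in> null_sets m" unfolding S_def using T(1) by auto
  then have Sm [measurable]: "S \<in> sets m" by auto
  have sup: "emeasure \<mu> A \<le> emeasure \<mu> S" if "A \<in> null_sets m" for A
  proof -
    have "emeasure \<mu> A \<le> ?s" using that by (rule SUP_upper)
    also have "\<dots> \<le> emeasure \<mu> S"
      unfolding f(2) T(2) by (intro SUP_least emeasure_mono) (auto simp: S_def sets_\<mu> intro: Sm[unfolded S_def])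
    finally show ?thesis .
  qed
  let ?\<nu> = "density \<mu> (indicator (space m - S))"
  let ?\<mu>s = "density \<mu> (indicator S)"
  note sets_\<mu>[measurable_cong]
  have e\<nu>: "emeasure ?\<nu> A = emeasure \<mu> (A - S)" if "A \<in> sets m" for A
  proof -
    have "A \<subseteq> space m" using that sets.sets_into_space by blast
    have "emeasure ?\<nu> A = emeasure \<mu> ((space m - S) \<inter> A)"
      using that by (subst emeasure_density) (auto simp: sets_\<mu> indicator_inter_arith[symmetric] simp flip: nn_integral_indicator)
    also have "(space m - S) \<inter> A = A - S" using \<open>A \<subseteq> space m\<close> by auto
    finally show ?thesis .
  qed
  have e\<mu>s: "emeasure ?\<mu>s A = emeasure \<mu> (S \<inter> A)" if "A \<in> sets m" for A
    using that by (subst emeasure_density) (auto simp: sets_\<mu> indicator_inter_arith[symmetric] simp flip: nn_integral_indicator)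
  have "absolutely_continuous m ?\<nu>"
    unfolding absolutely_continuous_def
  proof
    fix A assume A: "A \<in> null_sets m"
    then have "A \<union> S \<in> null_sets m" using S by auto
    from sup[OF this] have "emeasure \<mu> S + emeasure \<mu> (A - S) \<le> emeasure \<mu> S + 0"
      using A by (subst plus_emeasure) (auto simp: sets_\<mu> Un_commute)
    then have "emeasure \<mu> (A - S) = 0"
      by (simp add: ennreal_add_left_cancel_le \<mu>.emeasure_finite del: add_0_right)
    then show "A \<in> null_sets ?\<nu>" using A e\<nu> by (auto simp: null_sets_def sets_\<mu>)
  qed
  moreover have "finite_measure ?\<nu>"
    by (intro finite_measureI) (simp add: e\<nu> sets_eq_imp_space_eq[OF sets_\<mu>] \<mu>.emeasure_finite)
  ultimately obtain \<rho> where \<rho>: "\<rho> \<in> borel_measurable m" "\<forall>x. 0 \<le> \<rho> x" "density m (\<lambda>x. ennreal (\<rho> x)) = ?\<nu>"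
    using ex_real_density[of ?\<nu>] by (auto simp: sets_\<mu>)
  have "lebesgue_decomposition m \<mu> \<rho> ?\<mu>s"
    unfolding lebesgue_decomposition_def
  proof (intro conjI ballI \<rho>(1,2))
    have "space m - S \<in> null_sets ?\<mu>s"
      using e\<mu>s[of "space m - S"] by (auto simp: null_sets_def sets_\<mu> Int_Diff)
    then show "\<exists>S\<in>null_sets m. space m - S \<in> null_sets ?\<mu>s" using S by blast
    fix A assume A: "A \<in> sets m"
    then have "emeasure \<mu> A = emeasure \<mu> (A - S) + emeasure \<mu> (S \<inter> A)"
      by (subst plus_emeasure) (auto simp: sets_\<mu> intro!: arg_cong2[where f=emeasure])
    then show "emeasure \<mu> A = emeasure (density m (\<lambda>x. ennreal (\<rho> x))) A + emeasure ?\<mu>s A"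
      using A by (simp add: \<rho> e\<nu> e\<mu>s)
  qed (simp add: sets_\<mu>)
  then show ?thesis by blast
qed

lemma ac_density_decomposition: "\<exists>\<mu>s. lebesgue_decomposition m \<mu> (ac_density m \<mu>) \<mu>s"
  unfolding ac_density_def using ex_lebesgue_decomposition by (rule someI_ex)

lemma singular_part_decomposition: "\<exists>\<rho>. lebesgue_decomposition m \<mu> \<rho> (singular_part m \<mu>)"
proof -
  have "\<exists>\<mu>s \<rho>. lebesgue_decomposition m \<mu> \<rho> \<mu>s" using ex_lebesgue_decomposition by blast
  then show ?thesis unfolding singular_part_def by (rule someI_ex)
qed

lemma ac_density_measurable [measurable]: "ac_density m \<mu> \<in> borel_measurable m"
  and ac_density_nonneg: "0 \<le> ac_density m \<mu> x"
  using ac_density_decomposition by (auto simp: lebesgue_decomposition_def)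

lemma integral_ac_density_le:
  assumes [measurable]: "A \<in> sets m"
  shows "(\<integral>\<^sup>+x. ennreal (ac_density m \<mu> x) * indicator A x \<partial>m) \<le> emeasure \<mu> A"
  using ac_density_decomposition assms
  by (auto simp: lebesgue_decomposition_def emeasure_density)

text \<open>\<open>ac_density\<close> and \<open>singular_part\<close> come from separate choices
  and need not belong to one decomposition, so the conclusion is stated for every
  decomposition.\<close>

lemma decomposition_absolutely_continuous:
  assumes dec: "lebesgue_decomposition m \<mu> \<rho> \<mu>s" and ac: "absolutely_continuous m \<mu>"
  shows "\<mu>s = null_measure m" "density m (\<lambda>x. ennreal (\<rho> x)) = \<mu>"
proof -
  from dec obtain S where S: "S \<in> null_sets m" "space m - S \<in> null_sets \<mu>s" and sets_\<mu>s: "sets \<mu>s = sets m"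
    and eq: "\<And>A. A \<in> sets m \<Longrightarrow> emeasure \<mu> A = emeasure (density m (\<lambda>x. ennreal (\<rho> x))) A + emeasure \<mu>s A"
    unfolding lebesgue_decomposition_def by blast
  have "emeasure \<mu> S = 0" using ac S unfolding absolutely_continuous_def by auto
  then have "emeasure \<mu>s S = 0" using eq[of S] S(1) by (simp add: null_setsD2)
  then have "S \<in> null_sets \<mu>s" using S(1) by (auto simp: null_sets_def sets_\<mu>s)
  then have "S \<union> (space m - S) \<in> null_sets \<mu>s" using S(2) by (rule null_sets.Un)
  moreover have "S \<subseteq> space m" using S(1) sets.sets_into_space by blast
  ultimately have sp0: "space m \<in> null_sets \<mu>s" by (simp add: Un_absorb1)
  have z: "emeasure \<mu>s A = 0" if "A \<in> sets m" for A
  proof -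
    have "A \<in> null_sets \<mu>s"
      by (rule null_sets_subset[OF sp0]) (use that sets_\<mu>s sets.sets_into_space[OF that] in auto)
    then show ?thesis by (rule null_setsD1)
  qed
  show "\<mu>s = null_measure m"
    by (rule measure_eqI) (simp_all add: sets_\<mu>s z)
  show "density m (\<lambda>x. ennreal (\<rho> x)) = \<mu>"
    by (rule measure_eqI) (simp_all add: sets_\<mu> eq z)
qed

lemma ac_density_density:
  assumes "absolutely_continuous m \<mu>"
  shows "density m (\<lambda>x. ennreal (ac_density m \<mu> x)) = \<mu>"
  using ac_density_decomposition decomposition_absolutely_continuous(2)[OF _ assms] by blast

lemma singular_part_null:
  assumes "absolutely_continuous m \<mu>"
  shows "singular_part m \<mu> = null_measure m"
  using singular_part_decomposition decomposition_absolutely_continuous(1)[OF _ assms] by blast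

lemma absolutely_continuous_if_singular_part_null:
  assumes "singular_part m \<mu> = null_measure m"
  shows "absolutely_continuous m \<mu>"
proof -
  obtain \<rho> where "lebesgue_decomposition m \<mu> \<rho> (null_measure m)"
    using singular_part_decomposition assms by metis
  then have "emeasure \<mu> A = (\<integral>\<^sup>+x. ennreal (\<rho> x) * indicator A x \<partial>m)" if "A \<in> sets m" for A
    using that by (simp add: lebesgue_decomposition_def emeasure_density)
  then show ?thesis
    unfolding absolutely_continuous_def
    by (auto simp: null_sets_def sets_\<mu> nn_integral_null_set)
qed

lemma absolutely_continuous_if_le:
  assumes le: "\<And>A. A \<in> sets m \<Longrightarrow> emeasure \<mu> A \<le> ennreal K * emeasure m A"
  shows "absolutely_continuous m \<mu>"
  unfolding absolutely_continuous_def
proof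
  fix A assume A: "A \<in> null_sets m"
  then show "A \<in> null_sets \<mu>"
    using le[of A] by (auto simp: null_sets_def sets_\<mu>)
qed

lemma integral_ac_density:
  assumes "absolutely_continuous m \<mu>"
  shows "(\<integral>\<^sup>+x. ennreal (ac_density m \<mu> x) \<partial>m) = 1"
proof -
  have "emeasure (density m (\<lambda>x. ennreal (ac_density m \<mu> x))) (space m) = emeasure \<mu> (space \<mu>)"
    unfolding ac_density_density[OF assms] sets_eq_imp_space_eq[OF sets_\<mu>] ..
  then show ?thesis
    by (simp add: emeasure_density \<mu>.emeasure_space_1 cong: nn_integral_cong)
qed

lemma ac_density_le:
  assumes K: "K > 0" and le: "\<And>A. A \<in> sets m \<Longrightarrow> emeasure \<mu> A \<le> ennreal K * emeasure m A"
  shows "AE x in m. ac_density m \<mu> x \<le> K"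
proof -
  let ?E = "{x \<in> space m. K < ac_density m \<mu> x}"
  have E [measurable]: "?E \<in> sets m" by measurable
  have int: "(\<integral>\<^sup>+x. ennreal (ac_density m \<mu> x) * indicator ?E x \<partial>m) \<le> ennreal K * emeasure m ?E"
    using integral_ac_density_le[OF E] le[OF E] by (rule order_trans)
  have "(\<integral>\<^sup>+x. ennreal K * indicator ?E x \<partial>m) \<le> (\<integral>\<^sup>+x. ennreal (ac_density m \<mu> x) * indicator ?E x \<partial>m)"
    by (intro nn_integral_mono) (auto intro!: ennreal_leI split: split_indicator)
  also have "\<dots> \<le> emeasure \<mu> ?E" by (rule integral_ac_density_le[OF E])
  also have "\<dots> < \<infinity>" by (simp add: less_top[symmetric])
  finally have fin: "(\<integral>\<^sup>+x. ennreal K * indicator ?E x \<partial>m) < \<infinity>" .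
  have "?E \<in> null_sets m"
    by (rule null_set_if_integral_le[of "\<lambda>_. K" m "ac_density m \<mu>"])
       (use K int fin in \<open>auto simp: nn_integral_cmult_indicator\<close>)
  then have "AE x in m. x \<notin> ?E" by (rule AE_not_in)
  with AE_space show ?thesis by eventually_elim auto
qed

text \<open>A lower bound on \<open>A\<close> does not exclude a singular part. The comparison is
  therefore made off the null set that carries it; outside \<open>A\<close> the density vanishes
  with \<mu>.\<close>

lemma ac_density_ge:
  assumes K: "K > 0" and A [measurable]: "A \<in> sets m" and carrier: "emeasure \<mu> (space m - A) = 0"
    and ge: "\<And>E. E \<in> sets m \<Longrightarrow> E \<subseteq> A \<Longrightarrow> ennreal K * emeasure m E \<le> emeasure \<mu> E"
  shows "AE x in m. ac_density m \<mu> x = 0 \<or> K \<le> ac_density m \<mu> x"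
proof -
  let ?\<rho> = "ac_density m \<mu>"
  obtain \<mu>s where dec: "lebesgue_decomposition m \<mu> ?\<rho> \<mu>s" using ac_density_decomposition ..
  then obtain S where S: "S \<in> null_sets m" "space m - S \<in> null_sets \<mu>s" and sets_\<mu>s: "sets \<mu>s = sets m"
    and eq: "\<And>A. A \<in> sets m \<Longrightarrow> emeasure \<mu> A = emeasure (density m (\<lambda>x. ennreal (?\<rho> x))) A + emeasure \<mu>s A"
    unfolding lebesgue_decomposition_def by blast
  have [measurable]: "S \<in> sets m" using S(1) by auto
  let ?E = "{x \<in> A - S. ?\<rho> x < K}"
  have "?E = {x \<in> space m. x \<in> A \<and> x \<notin> S \<and> ?\<rho> x < K}"
    using sets.sets_into_space[OF A] by auto
  also have "\<dots> \<in> sets m" by measurable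
  finally have E [measurable]: "?E \<in> sets m" .
  have "emeasure \<mu>s ?E = 0"
    by (rule null_setsD1[OF null_sets_subset[OF S(2)]])
       (use E sets_\<mu>s sets.sets_into_space[OF E] in auto)
  then have \<mu>E: "emeasure \<mu> ?E = (\<integral>\<^sup>+x. ennreal (?\<rho> x) * indicator ?E x \<partial>m)"
    using eq[OF E] by (simp add: emeasure_density)
  have "?E \<in> null_sets m"
  proof (rule null_set_if_integral_le[of ?\<rho> m "\<lambda>_. K"])
    have "(\<integral>\<^sup>+x. ennreal K * indicator ?E x \<partial>m) = ennreal K * emeasure m ?E"
      by (rule nn_integral_cmult_indicator[OF E])
    also have "\<dots> \<le> emeasure \<mu> ?E" by (rule ge[OF E]) auto
    finally show "(\<integral>\<^sup>+x. ennreal K * indicator ?E x \<partial>m) \<le> (\<integral>\<^sup>+x. ennreal (?\<rho> x) * indicator ?E x \<partial>m)"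
      unfolding \<mu>E .
    show "(\<integral>\<^sup>+x. ennreal (?\<rho> x) * indicator ?E x \<partial>m) \<noteq> \<infinity>"
      unfolding \<mu>E[symmetric] using \<mu>.emeasure_finite[of ?E] by simp
  qed (auto simp: ac_density_nonneg)
  then have 1: "AE x in m. x \<notin> ?E" by (rule AE_not_in)
  have "(\<integral>\<^sup>+x. ennreal (?\<rho> x) * indicator (space m - A) x \<partial>m) = 0"
    using integral_ac_density_le[of "space m - A"] carrier by simp
  then have "AE x in m. ennreal (?\<rho> x) * indicator (space m - A) x = 0"
    by (subst (asm) nn_integral_0_iff_AE) auto
  with 1 AE_not_in[OF S(1)] AE_space show ?thesis
  proof eventually_elim
    case (elim x)
    then show ?case using ac_density_nonneg[of x] by (auto simp: not_less split: split_indicator_asm)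
  qed
qed

section \<open>Entropy bounds from density bounds\<close>

text \<open>Where the density \<rho> is positive, \<rho>^(1 - 1/N) = \<rho>^(-1/N) \<rho> is at
  least K^(-1/N) \<rho>, and \<rho> has integral 1.\<close>

lemma renyi_entropy_le:
  assumes K: "K > 0" and N: "N \<ge> 1" and le: "\<And>A. A \<in> sets m \<Longrightarrow> emeasure \<mu> A \<le> ennreal K * emeasure m A"
  shows "renyi_entropy N m \<mu> \<le> ereal (- (K powr (- 1 / N)))"
proof -
  have AE_le: "AE x in m. ac_density m \<mu> x \<le> K" by (rule ac_density_le[OF K le])
  let ?\<rho> = "ac_density m \<mu>"
  have "ennreal (K powr (- 1 / N)) = ennreal (K powr (- 1 / N)) * (\<integral>\<^sup>+x. ennreal (?\<rho> x) \<partial>m)"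
    using integral_ac_density[OF absolutely_continuous_if_le[OF le]] by simp
  also have "\<dots> = (\<integral>\<^sup>+x. ennreal (K powr (- 1 / N)) * ennreal (?\<rho> x) \<partial>m)"
    by (rule nn_integral_cmult[symmetric]) measurable
  also have "\<dots> \<le> (\<integral>\<^sup>+x. ennreal (?\<rho> x powr (1 - 1 / N)) \<partial>m)"
  proof (rule nn_integral_mono_AE)
    show "AE x in m. ennreal (K powr (- 1 / N)) * ennreal (?\<rho> x) \<le> ennreal (?\<rho> x powr (1 - 1 / N))"
      using AE_le
    proof eventually_elim
      case (elim x)
      have "K powr (- 1 / N) * ?\<rho> x \<le> ?\<rho> x powr (1 - 1 / N)"
      proof (cases "?\<rho> x = 0")
        case False
        then have pos: "0 < ?\<rho> x" using ac_density_nonneg[of x] by simp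
        have "K powr (- 1 / N) \<le> ?\<rho> x powr (- 1 / N)"
          using elim pos N by (intro powr_mono2') auto
        then have "K powr (- 1 / N) * ?\<rho> x \<le> ?\<rho> x powr (- 1 / N) * ?\<rho> x"
          using pos by (intro mult_right_mono) auto
        also have "\<dots> = ?\<rho> x powr (1 - 1 / N)"
          using pos powr_add[of "?\<rho> x" "- 1 / N" 1] by simp
        finally show ?thesis .
      qed simp
      then show ?case
        using ac_density_nonneg[of x] by (simp add: ennreal_mult[symmetric] ennreal_leI)
    qed
  qed
  finally have "enn2ereal (ennreal (K powr (- 1 / N))) \<le> enn2ereal (\<integral>\<^sup>+x. ennreal (?\<rho> x powr (1 - 1 / N)) \<partial>m)"
    unfolding less_eq_ennreal.rep_eq .
  then have "ereal (K powr (- 1 / N)) \<le> enn2ereal (\<integral>\<^sup>+x. ennreal (?\<rho> x powr (1 - 1 / N)) \<partial>m)"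
    by (simp add: enn2ereal_ennreal)
  then show ?thesis
    unfolding renyi_entropy_def by (simp flip: uminus_ereal.simps)
qed

text \<open>The opposite comparison of powers. A singular part only lowers the integral of the
  density below 1, which is the favourable direction.\<close>

lemma renyi_entropy_ge:
  assumes K: "K > 0" and N: "N \<ge> 1" and A: "A \<in> sets m" "emeasure \<mu> (space m - A) = 0"
    and ge: "\<And>E. E \<in> sets m \<Longrightarrow> E \<subseteq> A \<Longrightarrow> ennreal K * emeasure m E \<le> emeasure \<mu> E"
  shows "ereal (- (K powr (- 1 / N))) \<le> renyi_entropy N m \<mu>"
proof -
  have AE_ge: "AE x in m. ac_density m \<mu> x = 0 \<or> K \<le> ac_density m \<mu> x" by (rule ac_density_ge[OF K A ge])
  let ?\<rho> = "ac_density m \<mu>"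
  have "(\<integral>\<^sup>+x. ennreal (?\<rho> x powr (1 - 1 / N)) \<partial>m) \<le> (\<integral>\<^sup>+x. ennreal (K powr (- 1 / N)) * ennreal (?\<rho> x) \<partial>m)"
  proof (rule nn_integral_mono_AE)
    show "AE x in m. ennreal (?\<rho> x powr (1 - 1 / N)) \<le> ennreal (K powr (- 1 / N)) * ennreal (?\<rho> x)"
      using AE_ge
    proof eventually_elim
      case (elim x)
      have "?\<rho> x powr (1 - 1 / N) \<le> K powr (- 1 / N) * ?\<rho> x"
      proof (cases "?\<rho> x = 0")
        case False
        then have pos: "0 < ?\<rho> x" "K \<le> ?\<rho> x" using elim ac_density_nonneg[of x] by auto
        have "?\<rho> x powr (1 - 1 / N) = ?\<rho> x powr (- 1 / N) * ?\<rho> x"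
          using pos powr_add[of "?\<rho> x" "- 1 / N" 1] by simp
        also have "\<dots> \<le> K powr (- 1 / N) * ?\<rho> x"
          using pos N K by (intro mult_right_mono powr_mono2') auto
        finally show ?thesis .
      qed simp
      then show ?case
        using ac_density_nonneg[of x] by (simp add: ennreal_mult[symmetric] ennreal_leI)
    qed
  qed
  also have "\<dots> = ennreal (K powr (- 1 / N)) * (\<integral>\<^sup>+x. ennreal (?\<rho> x) \<partial>m)"
    by (rule nn_integral_cmult) measurable
  also have "\<dots> \<le> ennreal (K powr (- 1 / N)) * 1"
  proof (rule mult_left_mono)
    have "(\<integral>\<^sup>+x. ennreal (?\<rho> x) \<partial>m) = (\<integral>\<^sup>+x. ennreal (?\<rho> x) * indicator (space m) x \<partial>m)"
      by (auto intro: nn_integral_cong)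
    also have "\<dots> \<le> emeasure \<mu> (space m)" by (rule integral_ac_density_le) simp
    finally show "(\<integral>\<^sup>+x. ennreal (?\<rho> x) \<partial>m) \<le> 1"
      using \<mu>.emeasure_space_1 sets_eq_imp_space_eq[OF sets_\<mu>] by simp
  qed simp
  finally have "enn2ereal (\<integral>\<^sup>+x. ennreal (?\<rho> x powr (1 - 1 / N)) \<partial>m) \<le> enn2ereal (ennreal (K powr (- 1 / N)))"
    unfolding less_eq_ennreal.rep_eq by simp
  then have "enn2ereal (\<integral>\<^sup>+x. ennreal (?\<rho> x powr (1 - 1 / N)) \<partial>m) \<le> ereal (K powr (- 1 / N))"
    by (simp add: enn2ereal_ennreal)
  then show ?thesis
    unfolding renyi_entropy_def by (simp flip: uminus_ereal.simps)
qed

lemma positive_minus_negative_integral: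
  fixes f :: "'a \<Rightarrow> real"
  assumes "integrable m f"
  shows "enn2ereal (\<integral>\<^sup>+x. ennreal (f x) \<partial>m) - enn2ereal (\<integral>\<^sup>+x. ennreal (- f x) \<partial>m) = ereal (\<integral>x. f x \<partial>m)"
proof -
  obtain a where a: "(\<integral>\<^sup>+x. ennreal (f x) \<partial>m) = ennreal a" "a \<ge> 0"
    using assms unfolding real_integrable_def by (cases "\<integral>\<^sup>+x. ennreal (f x) \<partial>m") auto
  obtain b where b: "(\<integral>\<^sup>+x. ennreal (- f x) \<partial>m) = ennreal b" "b \<ge> 0"
    using assms unfolding real_integrable_def by (cases "\<integral>\<^sup>+x. ennreal (- f x) \<partial>m") auto
  show ?thesis
    using real_lebesgue_integral_def[OF assms] a b by (simp add: enn2ereal_ennreal)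
qed

lemma ac_density_integrable:
  assumes "absolutely_continuous m \<mu>"
  shows "integrable m (ac_density m \<mu>)" "(\<integral>x. ac_density m \<mu> x \<partial>m) = 1"
proof -
  show "integrable m (ac_density m \<mu>)"
    using integral_ac_density[OF assms] by (intro integrableI_nonneg) (auto simp: ac_density_nonneg)
  then show "(\<integral>x. ac_density m \<mu> x \<partial>m) = 1"
    using integral_ac_density[OF assms] by (simp add: integral_eq_nn_integral ac_density_nonneg)
qed

text \<open>The integrand is at most \<rho> ln K. Finiteness of m(B) makes it integrable: its
  negative part is at most 1 and vanishes off \<open>B\<close>, so the entropy is a genuine
  integral.\<close>

lemma shannon_entropy_le:
  assumes K: "K > 0" and le: "\<And>A. A \<in> sets m \<Longrightarrow> emeasure \<mu> A \<le> ennreal K * emeasure m A"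
    and B [measurable]: "B \<in> sets m" and finB: "emeasure m B < \<infinity>" and carrier: "emeasure \<mu> (space m - B) = 0"
  shows "shannon_entropy m \<mu> \<le> ereal (ln K)"
proof -
  have AE_le: "AE x in m. ac_density m \<mu> x \<le> K" by (rule ac_density_le[OF K le])
  let ?\<rho> = "ac_density m \<mu>"
  have ac: "absolutely_continuous m \<mu>" by (rule absolutely_continuous_if_le[OF le])
  note int\<rho> = ac_density_integrable[OF ac]
  have "(\<integral>\<^sup>+x. ennreal (?\<rho> x) * indicator (space m - B) x \<partial>m) = 0"
    using integral_ac_density_le[of "space m - B"] carrier by simp
  then have "AE x in m. ennreal (?\<rho> x) * indicator (space m - B) x = 0"
    by (subst (asm) nn_integral_0_iff_AE) auto
  with AE_space have out: "AE x in m. x \<notin> B \<longrightarrow> ?\<rho> x = 0"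
  proof eventually_elim
    case (elim x)
    then show ?case using ac_density_nonneg[of x] by (auto split: split_indicator_asm)
  qed
  have int: "integrable m (\<lambda>x. ?\<rho> x * ln (?\<rho> x))"
  proof (rule Bochner_Integration.integrable_bound)
    show "integrable m (\<lambda>x. ?\<rho> x * \<bar>ln K\<bar> + indicator B x)"
      using int\<rho>(1) finB by (intro Bochner_Integration.integrable_add integrable_mult_left) (auto simp: less_top)
    show "AE x in m. norm (?\<rho> x * ln (?\<rho> x)) \<le> norm (?\<rho> x * \<bar>ln K\<bar> + indicator B x)"
      using out AE_le
    proof eventually_elim
      case (elim x)
      show ?case
      proof (cases "?\<rho> x = 0")
        case False
        then have pos: "0 < ?\<rho> x" using ac_density_nonneg[of x] by simp
        have xB: "x \<in> B" using elim False by blast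
        have "\<bar>?\<rho> x * ln (?\<rho> x)\<bar> \<le> ?\<rho> x * \<bar>ln K\<bar> + 1"
        proof (cases "?\<rho> x \<le> 1")
          case True
          \<comment> \<open>The inequality ln y \<le> y - 1 at y = 1 / \<rho>, which bounds -\<rho>
            ln \<rho> by 1.\<close>
          have "- ln (?\<rho> x) \<le> 1 / ?\<rho> x - 1"
            using ln_le_minus_one[of "1 / ?\<rho> x"] pos by (simp add: ln_div)
          then have "?\<rho> x * (- ln (?\<rho> x)) \<le> ?\<rho> x * (1 / ?\<rho> x - 1)"
            using pos by (intro mult_left_mono) auto
          then have "- (?\<rho> x * ln (?\<rho> x)) \<le> 1" using pos by (simp add: right_diff_distrib)
          moreover have "?\<rho> x * ln (?\<rho> x) \<le> 0" using pos True by (simp add: mult_nonneg_nonpos)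
          moreover have "0 \<le> ?\<rho> x * \<bar>ln K\<bar>" using pos by simp
          ultimately show ?thesis by linarith
        next
          case False
          then have "0 \<le> ln (?\<rho> x)" "ln (?\<rho> x) \<le> ln K" using elim by auto
          then have "0 \<le> ?\<rho> x * ln (?\<rho> x)" "?\<rho> x * ln (?\<rho> x) \<le> ?\<rho> x * \<bar>ln K\<bar>"
            using pos by (auto intro!: mult_left_mono)
          then show ?thesis by linarith
        qed
        then show ?thesis using xB pos by simp
      qed simp
    qed
  qed measurable
  have "shannon_entropy m \<mu> = ereal (\<integral>x. ?\<rho> x * ln (?\<rho> x) \<partial>m)"
    unfolding shannon_entropy_def Let_def singular_part_null[OF ac]
    using positive_minus_negative_integral[OF int] by simp
  also have "(\<integral>x. ?\<rho> x * ln (?\<rho> x) \<partial>m) \<le> (\<integral>x. ?\<rho> x * ln K \<partial>m)"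
  proof (rule integral_mono_AE[OF int])
    show "integrable m (\<lambda>x. ?\<rho> x * ln K)" using int\<rho>(1) by (rule integrable_mult_left)
    show "AE x in m. ?\<rho> x * ln (?\<rho> x) \<le> ?\<rho> x * ln K"
      using AE_le
    proof eventually_elim
      case (elim x)
      then show ?case
        using ac_density_nonneg[of x] by (cases "?\<rho> x = 0") (auto intro!: mult_left_mono)
    qed
  qed
  also have "(\<integral>x. ?\<rho> x * ln K \<partial>m) = ln K" using int\<rho> by simp
  finally show ?thesis by simp
qed

text \<open>A singular part or a divergent positive part makes the entropy infinite. Otherwise
  \<rho> ln \<rho> \<ge> \<rho> ln K bounds the negative part, and integration against total mass 1
  gives the claim.\<close>

lemma shannon_entropy_ge:
  assumes K: "K > 0" and A: "A \<in> sets m" "emeasure \<mu> (space m - A) = 0"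
    and ge: "\<And>E. E \<in> sets m \<Longrightarrow> E \<subseteq> A \<Longrightarrow> ennreal K * emeasure m E \<le> emeasure \<mu> E"
  shows "ereal (ln K) \<le> shannon_entropy m \<mu>"
proof (cases "singular_part m \<mu> = null_measure m")
  case False
  then show ?thesis by (simp add: shannon_entropy_def Let_def)
next
  case True
  have AE_ge: "AE x in m. ac_density m \<mu> x = 0 \<or> K \<le> ac_density m \<mu> x" by (rule ac_density_ge[OF K A ge])
  let ?\<rho> = "ac_density m \<mu>"
  have ac: "absolutely_continuous m \<mu>" by (rule absolutely_continuous_if_singular_part_null[OF True])
  note int\<rho> = ac_density_integrable[OF ac]
  have pt: "AE x in m. ?\<rho> x * ln K \<le> ?\<rho> x * ln (?\<rho> x)"
    using AE_ge
  proof eventually_elim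
    case (elim x)
    then show ?case
      using ac_density_nonneg[of x] K by (cases "?\<rho> x = 0") (auto intro!: mult_left_mono)
  qed
  have "(\<integral>\<^sup>+x. ennreal (- (?\<rho> x * ln (?\<rho> x))) \<partial>m) \<le> (\<integral>\<^sup>+x. ennreal (?\<rho> x * \<bar>ln K\<bar>) \<partial>m)"
  proof (rule nn_integral_mono_AE)
    show "AE x in m. ennreal (- (?\<rho> x * ln (?\<rho> x))) \<le> ennreal (?\<rho> x * \<bar>ln K\<bar>)"
      using pt
    proof eventually_elim
      case (elim x)
      have "?\<rho> x * (- ln K) \<le> ?\<rho> x * \<bar>ln K\<bar>"
        using ac_density_nonneg[of x] by (intro mult_left_mono) auto
      with elim show ?case by (intro ennreal_leI) simp
    qed
  qed
  also have "\<dots> < \<infinity>"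
    using integrable_mult_left[of "\<bar>ln K\<bar>" m ?\<rho>] int\<rho>(1) unfolding real_integrable_def by (auto simp: less_top)
  finally have neg: "(\<integral>\<^sup>+x. ennreal (- (?\<rho> x * ln (?\<rho> x))) \<partial>m) < \<infinity>" .
  show ?thesis
  proof (cases "(\<integral>\<^sup>+x. ennreal (?\<rho> x * ln (?\<rho> x)) \<partial>m) = \<infinity>")
    case True
    then show ?thesis
      by (simp add: shannon_entropy_def Let_def \<open>singular_part m \<mu> = null_measure m\<close> top_ennreal.rep_eq)
  next
    case False
    have int: "integrable m (\<lambda>x. ?\<rho> x * ln (?\<rho> x))"
      unfolding real_integrable_def using False neg by auto
    have "ln K = (\<integral>x. ?\<rho> x * ln K \<partial>m)" using int\<rho> by simp
    also have "\<dots> \<le> (\<integral>x. ?\<rho> x * ln (?\<rho> x) \<partial>m)"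
      by (rule integral_mono_AE[OF integrable_mult_left[OF int\<rho>(1)] int pt])
    also have "ereal \<dots> = shannon_entropy m \<mu>"
      unfolding shannon_entropy_def Let_def \<open>singular_part m \<mu> = null_measure m\<close>
      using positive_minus_negative_integral[OF int] by simp
    finally show ?thesis by simp
  qed
qed

end

text \<open>The only properties of the entropies that the argument uses.\<close>

definition density_gauge :: "'a measure \<Rightarrow> ('a measure \<Rightarrow> ereal) \<Rightarrow> (real \<Rightarrow> real) \<Rightarrow> bool" where
  "density_gauge m F \<phi> \<longleftrightarrow>
     (\<forall>K K'. 0 < K \<longrightarrow> K < K' \<longrightarrow> \<phi> K < \<phi> K') \<and>
     (\<forall>\<mu> K B. prob_space \<mu> \<longrightarrow> sets \<mu> = sets m \<longrightarrow> 0 < K \<longrightarrow>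
        B \<in> sets m \<longrightarrow> emeasure m B < \<infinity> \<longrightarrow> emeasure \<mu> (space m - B) = 0 \<longrightarrow>
        (\<forall>A\<in>sets m. emeasure \<mu> A \<le> ennreal K * emeasure m A) \<longrightarrow> F \<mu> \<le> ereal (\<phi> K)) \<and>
     (\<forall>\<mu> K A. prob_space \<mu> \<longrightarrow> sets \<mu> = sets m \<longrightarrow> 0 < K \<longrightarrow>
        A \<in> sets m \<longrightarrow> emeasure \<mu> (space m - A) = 0 \<longrightarrow>
        (\<forall>E\<in>sets m. E \<subseteq> A \<longrightarrow> ennreal K * emeasure m E \<le> emeasure \<mu> E) \<longrightarrow> ereal (\<phi> K) \<le> F \<mu>)"

lemma density_gauge_upper:
  assumes "density_gauge m F \<phi>" "prob_space \<mu>" "sets \<mu> = sets m" "0 < K"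
    and "B \<in> sets m" "emeasure m B < \<infinity>" "emeasure \<mu> (space m - B) = 0"
    and "\<And>A. A \<in> sets m \<Longrightarrow> emeasure \<mu> A \<le> ennreal K * emeasure m A"
  shows "F \<mu> \<le> ereal (\<phi> K)"
  using assms unfolding density_gauge_def by metis

lemma density_gauge_lower:
  assumes "density_gauge m F \<phi>" "prob_space \<mu>" "sets \<mu> = sets m" "0 < K"
    and "A \<in> sets m" "emeasure \<mu> (space m - A) = 0"
    and "\<And>E. E \<in> sets m \<Longrightarrow> E \<subseteq> A \<Longrightarrow> ennreal K * emeasure m E \<le> emeasure \<mu> E"
  shows "ereal (\<phi> K) \<le> F \<mu>"
  using assms unfolding density_gauge_def by metis

text \<open>The gauge value at K is the entropy of a probability measure with constant density K on
  a set of measure 1 / K: ln K here, and -K^(-1/N) for the Renyi entropy.\<close>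

lemma density_gauge_shannon:
  assumes "sigma_finite_measure m"
  shows "density_gauge m (shannon_entropy m) ln"
  unfolding density_gauge_def
  using shannon_entropy_le[OF assms] shannon_entropy_ge[OF assms] by auto

lemma density_gauge_renyi:
  assumes "sigma_finite_measure m" "N \<ge> 1"
  shows "density_gauge m (renyi_entropy N m) (\<lambda>K. - (K powr (- 1 / N)))"
  unfolding density_gauge_def
  using renyi_entropy_le[OF assms(1) _ _ _ assms(2)] renyi_entropy_ge[OF assms(1) _ _ _ assms(2)] assms(2)
  by (auto intro!: powr_less_mono2_neg)

text \<open>A violation on \<open>A\<close> is sharpened to a set \<open>S\<close> on which the
  intermediate measure dominates C' m with C' > C. Conditioning on the geodesics through
  \<open>S\<close> then contradicts the strict monotonicity of \<phi>.\<close>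

theorem displacement_density_bound:
  fixes q :: "nat \<Rightarrow> 'a::complete_space" and \<sigma> :: "('a \<times> 'a) measure"
  assumes q: "dense_sequence q" and sets_m: "sets m = sets borel"
    and F: "density_gauge m F \<phi>" and conv: "strongly_displacement_convex F"
    and \<sigma>: "\<sigma> \<in> couplings \<mu> \<nu>" and opt: "coupling_cost \<sigma> = transport_cost \<mu> \<nu>" and fin: "coupling_cost \<sigma> < \<infinity>"
    and e: "geodesic_family \<sigma> e" and C: "0 < C"
    and B: "B \<in> sets m" "emeasure m B < \<infinity>" "emeasure \<mu> (-B) = 0" "emeasure \<nu> (-B) = 0"
    and \<mu>: "\<And>A. A \<in> sets m \<Longrightarrow> emeasure \<mu> A \<le> ennreal C * emeasure m A"
    and \<nu>: "\<And>A. A \<in> sets m \<Longrightarrow> emeasure \<nu> A \<le> ennreal C * emeasure m A"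
    and t: "t \<in> {0..1}" and A: "A \<in> sets m"
  shows "emeasure (distr \<sigma> borel (\<lambda>w. e w t)) A \<le> ennreal C * emeasure m A"
proof (rule ccontr)
  let ?\<Gamma> = "distr \<sigma> borel (\<lambda>w. e w t)"
  assume "\<not> ?thesis"
  then have gt: "ennreal C * emeasure m A < emeasure ?\<Gamma> A" by simp
  note D = couplingsD[OF \<sigma>]
  note D(2)[measurable_cong] sets_m[measurable_cong]
  interpret \<sigma>: prob_space \<sigma> by (rule D)
  have sp: "space \<sigma> = UNIV" "space m = UNIV"
    using sets_eq_imp_space_eq[OF D(2)] sets_eq_imp_space_eq[OF sets_m] by simp_all
  have em [measurable]: "(\<lambda>w. e w s) \<in> borel_measurable borel" for s
    using e by (simp add: geodesic_family_def)
  have A' [measurable]: "A \<in> sets borel" using A sets_m by simp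
  interpret \<Gamma>: prob_space ?\<Gamma> by (rule \<sigma>.prob_space_distr) measurable
  have finA: "emeasure m A < \<infinity>"
  proof (rule ccontr)
    assume "\<not> ?thesis"
    then have "ennreal C * emeasure m A = \<infinity>" using C by (simp add: ennreal_mult_eq_top_iff not_less top_unique)
    with gt show False by simp
  qed
  define a where "a = measure m A"
  have a: "emeasure m A = ennreal a" "0 \<le> a"
    using finA by (auto simp: a_def emeasure_eq_ennreal_measure less_top)
  have "C * a < measure ?\<Gamma> A"
    using gt C a by (simp add: \<Gamma>.emeasure_eq_measure ennreal_mult[symmetric] ennreal_less_iff)
  \<comment> \<open>Half of the excess mass is spread over \<open>A\<close>. The summand 1 in the
    denominator covers the case that \<open>A\<close> has measure 0.\<close>
  define C' where "C' = C + (measure ?\<Gamma> A - C * a) / (2 * (a + 1))"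
  have C': "C < C'" "C' * a < measure ?\<Gamma> A"
  proof -
    let ?d = "measure ?\<Gamma> A - C * a"
    have d: "?d > 0" using \<open>C * a < measure ?\<Gamma> A\<close> by simp
    then show "C < C'" using a unfolding C'_def by simp
    have "?d / (2 * (a + 1)) * a < ?d"
    proof -
      have "a / (2 * (a + 1)) < 1" using a by (simp add: divide_less_eq)
      then have "?d * (a / (2 * (a + 1))) < ?d * 1" using d by (intro mult_strict_left_mono)
      then show ?thesis by simp
    qed
    then show "C' * a < measure ?\<Gamma> A" unfolding C'_def by (simp add: distrib_right)
  qed
  let ?M = "density m (\<lambda>_. ennreal C')"
  have M: "emeasure ?M E = ennreal C' * emeasure m E" if "E \<in> sets m" for E
    using that by (simp add: emeasure_density_const)
  have "emeasure ?M A \<noteq> \<top>" using finA A by (simp add: M ennreal_mult_eq_top_iff less_top)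
  \<comment> \<open>In the Hahn decomposition of \<open>A\<close>, subsets of \<open>Y\<close> have
    at most C' m mass and subsets of the rest at least that. Since \<open>A\<close> as a whole has
    more, the rest is charged.\<close>
  then obtain Y where Y: "Y \<in> sets ?M" "Y \<subseteq> A"
    "\<forall>X\<in>sets ?M. X \<subseteq> Y \<longrightarrow> emeasure ?\<Gamma> X \<le> emeasure ?M X"
    "\<forall>X\<in>sets ?M. X \<subseteq> A \<longrightarrow> X \<inter> Y = {} \<longrightarrow> emeasure ?M X \<le> emeasure ?\<Gamma> X"
    using unsigned_Hahn_decomposition[of ?\<Gamma> ?M A] A sets_m \<Gamma>.emeasure_finite by auto
  define S where "S = A - Y"
  have Y' [measurable]: "Y \<in> sets borel" using Y(1) sets_m by simp
  have S [measurable]: "S \<in> sets borel" unfolding S_def by simp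
  have S_ge: "ennreal C' * emeasure m E \<le> emeasure ?\<Gamma> E" if "E \<in> sets m" "E \<subseteq> S" for E
  proof -
    have "emeasure ?M E \<le> emeasure ?\<Gamma> E"
      using Y(4) that unfolding S_def by auto
    then show ?thesis using M that by simp
  qed
  have pos: "emeasure ?\<Gamma> S \<noteq> 0"
  proof
    assume 0: "emeasure ?\<Gamma> S = 0"
    have "emeasure ?\<Gamma> A \<le> emeasure ?\<Gamma> Y + emeasure ?\<Gamma> S"
      using emeasure_subadditive[of Y ?\<Gamma> S] Y(2) unfolding S_def by (simp add: Un_absorb1)
    also have "\<dots> \<le> emeasure ?M Y" using 0 Y(1,3) by simp
    also have "\<dots> \<le> emeasure ?M A" using Y(2) A by (intro emeasure_mono) auto
    also have "\<dots> = ennreal (C' * a)" using M[OF A] a C' C by (simp add: ennreal_mult)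
    finally have "emeasure ?\<Gamma> A \<le> ennreal (C' * a)" .
    moreover have "0 \<le> C' * a" using C' C a by simp
    ultimately show False using C' by (simp add: \<Gamma>.emeasure_eq_measure ennreal_le_iff2)
  qed
  define c where "c = measure ?\<Gamma> S"
  have c: "0 < c" "emeasure ?\<Gamma> S = ennreal c"
    using pos by (auto simp: c_def \<Gamma>.emeasure_eq_measure zero_less_measure_iff)
  \<comment> \<open>All geodesics passing through \<open>S\<close> at time t are kept, so the
    intermediate measure loses none of its mass over \<open>S\<close>.\<close>
  define H where "H = (\<lambda>w. e w t) -` S"
  have H [measurable]: "H \<in> sets borel"
    using measurable_sets[OF em S, of t] by (simp add: H_def)
  have \<sigma>H: "emeasure \<sigma> H = ennreal c"
    using c(2) by (subst (asm) emeasure_distr) (auto simp: sp H_def)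
  define \<sigma>' where "\<sigma>' = uniform_measure \<sigma> H"
  have \<sigma>'0: "emeasure \<sigma> H \<noteq> 0" using \<sigma>H c by simp
  have sets': "sets \<sigma>' = sets borel" unfolding \<sigma>'_def by (simp add: D)
  note sets'[measurable_cong]
  have coup: "\<sigma>' \<in> couplings (distr \<sigma>' borel fst) (distr \<sigma>' borel snd)"
    unfolding \<sigma>'_def by (rule uniform_measure_coupling[OF D(1,2) \<sigma>'0])
  note opt' = restriction_optimal[OF \<sigma> opt fin H \<sigma>'0, folded \<sigma>'_def]
  have e': "geodesic_family \<sigma>' e"
    using e unfolding geodesic_family_def \<sigma>'_def by (auto intro: AE_uniform_measureI simp: D)
  define \<Gamma>' where "\<Gamma>' s = distr \<sigma>' borel (\<lambda>w. e w s)" for s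
  note geod = displacement_geodesic[OF q coup opt' e', folded \<Gamma>'_def]
  have prob': "prob_space \<sigma>'" by (rule couplingsD(1)[OF coup])
  have em': "emeasure (distr \<sigma>' borel h) E = emeasure \<sigma> (H \<inter> h -` E) / ennreal c"
    if [measurable]: "h \<in> borel \<rightarrow>\<^sub>M borel" and E [measurable]: "E \<in> sets borel" for h :: "'a \<times> 'a \<Rightarrow> 'a" and E
  proof -
    have hE: "h -` E \<in> sets borel" using measurable_sets[OF that] by simp
    have "emeasure (distr \<sigma>' borel h) E = emeasure \<sigma>' (h -` E)"
      by (subst emeasure_distr) (auto simp: \<sigma>'_def sp)
    also have "\<dots> = emeasure \<sigma> (H \<inter> h -` E) / emeasure \<sigma> H"
      unfolding \<sigma>'_def by (rule emeasure_uniform_measure) (use hE D in auto)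
    finally show ?thesis by (simp add: \<sigma>H)
  qed
  \<comment> \<open>At an end, conditioning can only remove mass before the division by c, so the
    upper density bound becomes \<open>C / c\<close>.\<close>
  have side: "F (distr \<sigma>' borel h) \<le> ereal (\<phi> (C / c))"
    if h [measurable]: "h \<in> borel \<rightarrow>\<^sub>M borel" and B0: "emeasure (distr \<sigma> borel h) (-B) = 0"
      and le: "\<And>A. A \<in> sets m \<Longrightarrow> emeasure (distr \<sigma> borel h) A \<le> ennreal C * emeasure m A" for h :: "'a \<times> 'a \<Rightarrow> 'a"
  proof -
    have sub: "emeasure (distr \<sigma>' borel h) E \<le> emeasure (distr \<sigma> borel h) E / ennreal c" if E: "E \<in> sets borel" for E
    proof -
      have "emeasure (distr \<sigma> borel h) E = emeasure \<sigma> (h -` E)"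
        using E by (subst emeasure_distr) (auto simp: sp)
      moreover have "emeasure \<sigma> (H \<inter> h -` E) \<le> emeasure \<sigma> (h -` E)"
        using measurable_sets[OF h E] by (intro emeasure_mono) (auto simp: D)
      ultimately show ?thesis unfolding em'[OF h E] by (simp add: divide_right_mono_ennreal)
    qed
    have "emeasure (distr \<sigma>' borel h) (space m - B) = 0"
      using sub[of "-B"] B0 B(1) sets_m by (simp add: sp Compl_eq_Diff_UNIV)
    moreover have "emeasure (distr \<sigma>' borel h) E \<le> ennreal (C / c) * emeasure m E" if "E \<in> sets m" for E
    proof -
      have "emeasure (distr \<sigma>' borel h) E \<le> ennreal C * emeasure m E / ennreal c"
        using sub[of E] divide_right_mono_ennreal[OF le[OF that], of "ennreal c"] that sets_m by auto
      also have "\<dots> = ennreal (C / c) * emeasure m E"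
        using c C by (simp add: divide_ennreal[symmetric] ennreal_divide_times ennreal_times_divide)
      finally show ?thesis .
    qed
    moreover have "prob_space (distr \<sigma>' borel h)"
      by (rule prob_space.prob_space_distr[OF prob']) measurable
    ultimately show ?thesis
      using C c sets_m by (intro density_gauge_upper[OF F _ _ _ B(1,2)]) auto
  qed
  have F0: "F (\<Gamma>' 0) \<le> ereal (\<phi> (C / c))"
    unfolding geod(2) by (rule side) (use B \<mu> D in auto)
  have F1: "F (\<Gamma>' 1) \<le> ereal (\<phi> (C / c))"
    unfolding geod(3) by (rule side) (use B \<nu> D in auto)
  have "ereal (\<phi> (C' / c)) \<le> F (\<Gamma>' t)"
  proof -
    \<comment> \<open>At time t the conditioned measure is exactly the restriction to
      \<open>S\<close> divided by c, so the lower bound survives as \<open>C' / c\<close>.\<close>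
    have rep: "emeasure (\<Gamma>' t) E = emeasure ?\<Gamma> (S \<inter> E) / ennreal c" if E: "E \<in> sets borel" for E
    proof -
      have "emeasure ?\<Gamma> (S \<inter> E) = emeasure \<sigma> (H \<inter> (\<lambda>w. e w t) -` E)"
        using E by (subst emeasure_distr) (auto simp: sp H_def vimage_Int)
      then show ?thesis unfolding \<Gamma>'_def em'[OF em E] by simp
    qed
    have "emeasure (\<Gamma>' t) (space m - S) = 0"
      using rep[of "UNIV - S"] by (simp add: sp)
    moreover have "ennreal (C' / c) * emeasure m E \<le> emeasure (\<Gamma>' t) E" if "E \<in> sets m" "E \<subseteq> S" for E
    proof -
      have "ennreal (C' / c) * emeasure m E = ennreal C' * emeasure m E / ennreal c"
        using c C C' by (simp add: divide_ennreal[symmetric] ennreal_divide_times ennreal_times_divide)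
      also have "\<dots> \<le> emeasure ?\<Gamma> E / ennreal c"
        by (rule divide_right_mono_ennreal[OF S_ge[OF that]])
      also have "\<dots> = emeasure (\<Gamma>' t) E"
        using rep[of E] that sets_m by (simp add: Int_absorb1)
      finally show ?thesis .
    qed
    moreover have "prob_space (\<Gamma>' t)"
      unfolding \<Gamma>'_def by (rule prob_space.prob_space_distr[OF prob']) measurable
    moreover have "sets (\<Gamma>' t) = sets m" unfolding \<Gamma>'_def by (simp add: sets_m)
    moreover have "S \<in> sets m" using S sets_m by simp
    ultimately show ?thesis
      using C C' c by (intro density_gauge_lower[OF F, of "\<Gamma>' t" "C' / c" S]) auto
  qed
  also have "F (\<Gamma>' t) \<le> ereal (1 - t) * F (\<Gamma>' 0) + ereal t * F (\<Gamma>' 1)"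
    using conv geod(1) t unfolding strongly_displacement_convex_def by blast
  also have "\<dots> \<le> ereal (1 - t) * ereal (\<phi> (C / c)) + ereal t * ereal (\<phi> (C / c))"
    using t by (intro add_mono ereal_mult_left_mono F0 F1) auto
  also have "\<dots> = ereal (\<phi> (C / c))" by (simp add: algebra_simps)
  finally have "\<phi> (C' / c) \<le> \<phi> (C / c)" by simp
  moreover have "\<phi> (C / c) < \<phi> (C' / c)"
    using F C C' c unfolding density_gauge_def by (simp add: divide_strict_right_mono)
  ultimately show False by simp
qed

section \<open>The Poincare inequality\<close>

lemma curve_length_geodesic:
  fixes \<gamma> :: "real \<Rightarrow> 'a::metric_space"
  assumes \<gamma>: "\<And>s t. s \<in> {0..1} \<Longrightarrow> t \<in> {0..1} \<Longrightarrow> dist (\<gamma> s) (\<gamma> t) = \<bar>s - t\<bar> * l"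
    and l: "0 \<le> l" and ab: "0 \<le> a" "a \<le> b" "b \<le> 1"
  shows "curve_length \<gamma> a b = ennreal ((b - a) * l)"
  unfolding curve_length_def
proof (rule antisym)
  show "(SUP (n, t) \<in> {(n::nat, t::nat \<Rightarrow> real). mono_on {..n} t \<and> t ` {..n} \<subseteq> {a..b}}.
        \<Sum>i<n. ennreal (dist (\<gamma> (t i)) (\<gamma> (t (Suc i))))) \<le> ennreal ((b - a) * l)"
  proof (rule SUP_least, clarify)
    fix n :: nat and t :: "nat \<Rightarrow> real"
    assume mono: "mono_on {..n} t" and sub: "t ` {..n} \<subseteq> {a..b}"
    have in_ab: "a \<le> t i \<and> t i \<le> b" if "i \<le> n" for i using sub that by auto
    have "(\<Sum>i<n. ennreal (dist (\<gamma> (t i)) (\<gamma> (t (Suc i))))) = ennreal (\<Sum>i<n. dist (\<gamma> (t i)) (\<gamma> (t (Suc i))))"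
      by (rule sum_ennreal) simp
    also have "(\<Sum>i<n. dist (\<gamma> (t i)) (\<gamma> (t (Suc i)))) = (\<Sum>i<n. (t (Suc i) - t i) * l)"
    proof (rule sum.cong[OF refl])
      fix i assume "i \<in> {..<n}"
      then have "t i \<le> t (Suc i)" "t i \<in> {0..1}" "t (Suc i) \<in> {0..1}"
        using mono_onD[OF mono, of i "Suc i"] in_ab[of i] in_ab[of "Suc i"] ab by auto
      then show "dist (\<gamma> (t i)) (\<gamma> (t (Suc i))) = (t (Suc i) - t i) * l"
        using \<gamma>[of "t i" "t (Suc i)"] by simp
    qed
    also have "\<dots> = (t n - t 0) * l"
      by (simp add: sum_distrib_right[symmetric] sum_lessThan_telescope)
    also have "\<dots> \<le> (b - a) * l"
      using in_ab[of 0] in_ab[of n] l by (intro mult_right_mono) auto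
    finally show "(\<Sum>i<n. ennreal (dist (\<gamma> (t i)) (\<gamma> (t (Suc i))))) \<le> ennreal ((b - a) * l)"
      by (simp add: ennreal_leI)
  qed
  \<comment> \<open>The partition with the two nodes a and b already attains the supremum.\<close>
  let ?t = "\<lambda>i::nat. if i = 0 then a else b"
  have "ennreal ((b - a) * l) = (\<Sum>i<1. ennreal (dist (\<gamma> (?t i)) (\<gamma> (?t (Suc i)))))"
    using \<gamma>[of a b] ab by simp
  also have "\<dots> \<le> (SUP (n, t) \<in> {(n::nat, t::nat \<Rightarrow> real). mono_on {..n} t \<and> t ` {..n} \<subseteq> {a..b}}.
        \<Sum>i<n. ennreal (dist (\<gamma> (t i)) (\<gamma> (t (Suc i)))))"
    by (rule SUP_upper2[of "(1, ?t)"]) (use ab in \<open>auto simp: mono_on_def\<close>)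
  finally show "ennreal ((b - a) * l) \<le> (SUP (n, t) \<in> {(n::nat, t::nat \<Rightarrow> real). mono_on {..n} t \<and> t ` {..n} \<subseteq> {a..b}}.
        \<Sum>i<n. ennreal (dist (\<gamma> (t i)) (\<gamma> (t (Suc i)))))" .
qed

lemma upper_gradient_geodesic:
  fixes \<gamma> :: "real \<Rightarrow> 'a::metric_space"
  assumes g: "upper_gradient g u"
    and \<gamma>: "\<And>s t. s \<in> {0..1} \<Longrightarrow> t \<in> {0..1} \<Longrightarrow> dist (\<gamma> s) (\<gamma> t) = \<bar>s - t\<bar> * dist x y"
    and ends: "\<gamma> 0 = x" "\<gamma> 1 = y"
  shows "ennreal \<bar>u x - u y\<bar> \<le> ennreal (dist x y) * (\<integral>\<^sup>+t\<in>{0..1}. g (\<gamma> t) \<partial>lborel)"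
proof -
  note len = curve_length_geodesic[OF \<gamma> zero_le_dist]
  have len01: "curve_length \<gamma> 0 1 = ennreal (dist x y)" using len[of 0 1] by simp
  have "continuous_on {0..1} \<gamma>"
  proof (rule continuous_onI)
    fix t e :: real assume t: "t \<in> {0..1}" and e: "e > 0"
    show "\<exists>d>0. \<forall>s\<in>{0..1}. dist s t < d \<longrightarrow> dist (\<gamma> s) (\<gamma> t) \<le> e"
    proof (intro exI[of _ "e / (dist x y + 1)"] conjI ballI impI)
      show "0 < e / (dist x y + 1)" using e by (simp add: add_nonneg_pos)
      fix s assume s: "s \<in> {0..1}" "dist s t < e / (dist x y + 1)"
      have "dist (\<gamma> s) (\<gamma> t) \<le> dist s t * (dist x y + 1)"
        unfolding \<gamma>[OF s(1) t] dist_real_def by (intro mult_left_mono) auto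
      also have "\<dots> \<le> e"
        using s(2) by (simp add: pos_less_divide_eq add_nonneg_pos)
      finally show "dist (\<gamma> s) (\<gamma> t) \<le> e" .
    qed
  qed
  moreover have "curve_length \<gamma> s t = ennreal (t - s) * curve_length \<gamma> 0 1" if "0 \<le> s \<and> s \<le> t \<and> t \<le> 1" for s t
    using len[of s t] that unfolding len01 by (simp add: ennreal_mult)
  ultimately have "constant_speed_curve \<gamma>"
    unfolding constant_speed_curve_def by blast
  then show ?thesis
    using g unfolding upper_gradient_def by (metis ends len01 ennreal_less_top infinity_ennreal_def)
qed

section \<open>Medians and mean oscillation\<close>

text \<open>The median is the infimum of the points where the distribution function reaches 1/2.
  Right continuity controls the mass above it, the left limit the mass below it.\<close>

lemma (in real_distribution) ex_median: "\<exists>c. prob {c<..} \<le> 1/2 \<and> 1/2 \<le> prob {c..}"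
proof -
  let ?A = "{x. 1/2 \<le> cdf M x}"
  have compl: "prob {x<..} = 1 - cdf M x" for x
  proof -
    have "prob {x<..} = prob (space M - {..x})" by (rule arg_cong[where f=prob]) auto
    then show ?thesis using prob_compl[of "{..x}"] by (simp add: cdf_def)
  qed
  have "\<forall>\<^sub>F x in at_top. 1/2 < cdf M x"
    using cdf_lim_at_top_prob by (rule order_tendstoD) simp
  then have "\<exists>x. 1/2 < cdf M x" unfolding eventually_at_top_linorder by blast
  then have ne: "?A \<noteq> {}" by (auto intro: less_imp_le)
  have "\<forall>\<^sub>F x in at_bot. cdf M x < 1/2"
    using cdf_lim_at_bot by (rule order_tendstoD) simp
  then obtain b where b: "\<And>x. x \<le> b \<Longrightarrow> cdf M x < 1/2"
    unfolding eventually_at_bot_linorder by blast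
  have bdd: "bdd_below ?A"
  proof (rule bdd_belowI[of _ b])
    fix x assume "x \<in> ?A"
    then show "b \<le> x" using b[of x] by (cases "x \<le> b") auto
  qed
  define c where "c = Inf ?A"
  have above: "1/2 \<le> cdf M x" if cx: "c < x" for x
  proof -
    obtain y where "y \<in> ?A" "y < x" using cInf_lessD[OF ne, of x] cx unfolding c_def by blast
    then show ?thesis using cdf_nondecreasing[of y x] by auto
  qed
  have below: "cdf M x \<le> 1/2" if "x < c" for x
    using cInf_lower[OF _ bdd, of x] that unfolding c_def by (cases "x \<in> ?A") auto
  have "1/2 \<le> cdf M c"
  proof (rule tendsto_lowerbound)
    show "(cdf M \<longlongrightarrow> cdf M c) (at_right c)"
      using cdf_is_right_cont[of c] by (simp add: continuous_within)
    show "\<forall>\<^sub>F x in at_right c. 1/2 \<le> cdf M x"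
      using above by (simp add: eventually_at_filter)
  qed simp
  moreover have "prob {..<c} \<le> 1/2"
  proof (rule tendsto_upperbound)
    show "(cdf M \<longlongrightarrow> prob {..<c}) (at_left c)" by (rule cdf_at_left)
    show "\<forall>\<^sub>F x in at_left c. cdf M x \<le> 1/2"
      using below by (simp add: eventually_at_filter)
  qed simp
  moreover have "prob {c..} = 1 - prob {..<c}"
  proof -
    have "prob {c..} = prob (space M - {..<c})" by (rule arg_cong[where f=prob]) auto
    then show ?thesis using prob_compl[of "{..<c}"] by simp
  qed
  ultimately show ?thesis
    by (intro exI[of _ c]) (simp add: compl)
qed

text \<open>
  The half is described by a weight because the level set of the median may have positive measure
  without containing a subset of the required mass.
\<close>

lemma ex_median_weight:
  fixes u :: "'a \<Rightarrow> real"
  assumes B [measurable]: "B \<in> sets m" and fin: "emeasure m B < \<infinity>" and pos: "emeasure m B \<noteq> 0"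
    and u [measurable]: "u \<in> borel_measurable m"
  shows "\<exists>c f. f \<in> borel_measurable m \<and> (\<forall>y. 0 \<le> f y \<and> f y \<le> 1) \<and>
    (\<forall>y. u y < c \<longrightarrow> f y = 0) \<and> (\<forall>y. c < u y \<longrightarrow> f y = 1) \<and>
    (\<integral>\<^sup>+y. ennreal (f y) * indicator B y \<partial>m) = ennreal (measure m B / 2)"
proof -
  define b where "b = measure m B"
  have b: "0 < b" "emeasure m B = ennreal b"
    using fin pos by (auto simp: b_def emeasure_eq_ennreal_measure less_top zero_less_measure_iff)
  interpret U: prob_space "uniform_measure m B"
    using fin pos by (intro prob_space_uniform_measure) auto
  let ?D = "distr (uniform_measure m B) borel u"
  interpret D: real_distribution ?D
    by (intro U.real_distribution_distr) simp
  obtain c where c: "measure ?D {c<..} \<le> 1/2" "1/2 \<le> measure ?D {c..}"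
    using D.ex_median by blast
  have D: "measure ?D E = measure m (B \<inter> {y\<in>space m. u y \<in> E}) / b" if [measurable]: "E \<in> sets borel" for E
  proof -
    have "measure ?D E = measure (uniform_measure m B) {y\<in>space m. u y \<in> E}"
      by (subst measure_distr) (auto intro!: arg_cong2[where f=measure])
    also have "\<dots> = measure m (B \<inter> {y\<in>space m. u y \<in> E}) / b"
      unfolding b_def using fin pos by (intro measure_uniform_measure) auto
    finally show ?thesis .
  qed
  let ?P = "B \<inter> {y\<in>space m. c < u y}" and ?E = "B \<inter> {y\<in>space m. u y = c}"
  have "B \<in> fmeasurable m" using fin by (intro fmeasurableI) auto
  then have fm: "?P \<in> fmeasurable m" "?E \<in> fmeasurable m"
    by (auto intro: fmeasurableI2)
  define p where "p = measure m ?P"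
  define e where "e = measure m ?E"
  have p: "p \<le> b / 2" using c(1) b by (simp add: D p_def divide_le_eq)
  have pe: "b / 2 \<le> p + e"
  proof -
    have "B \<inter> {y\<in>space m. c \<le> u y} = ?P \<union> ?E" by auto
    moreover have "measure m (?P \<union> ?E) = p + e"
      unfolding p_def e_def using fm by (intro measure_Union) (auto simp: fmeasurable_def less_top)
    ultimately show ?thesis using c(2) b by (simp add: D le_divide_eq)
  qed
  \<comment> \<open>The fraction of the level set of c that completes the mass above c to exactly b
    / 2. If the level set is null, that mass is already b / 2.\<close>
  define \<theta> where "\<theta> = (if e = 0 then 0 else (b / 2 - p) / e)"
  have e0: "0 \<le> e" unfolding e_def by simp
  have \<theta>: "0 \<le> \<theta>" "\<theta> \<le> 1" "p + \<theta> * e = b / 2"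
    using p pe e0 by (auto simp: \<theta>_def divide_le_eq)
  let ?f = "\<lambda>y. if c < u y then 1 else if u y = c then \<theta> else 0"
  have "(\<integral>\<^sup>+y. ennreal (?f y) * indicator B y \<partial>m) = (\<integral>\<^sup>+y. indicator ?P y + ennreal \<theta> * indicator ?E y \<partial>m)"
    by (intro nn_integral_cong) (auto split: split_indicator)
  also have "\<dots> = emeasure m ?P + ennreal \<theta> * emeasure m ?E"
    by (simp add: nn_integral_add nn_integral_cmult_indicator)
  also have "\<dots> = ennreal (p + \<theta> * e)"
    using fm \<theta> e0 by (simp add: emeasure_eq_measure2 p_def e_def ennreal_mult ennreal_plus)
  finally have "(\<integral>\<^sup>+y. ennreal (?f y) * indicator B y \<partial>m) = ennreal (measure m B / 2)"
    using \<theta> by (simp add: b_def)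
  then show ?thesis
    by (intro exI[of _ c] exI[of _ ?f]) (use \<theta> in auto)
qed

text \<open>|u - mean| \<le> |u - c| + |mean - c|, and the constant |mean - c| is at most the mean
  of |u - c|.\<close>

lemma mean_oscillation_le:
  fixes u :: "'a \<Rightarrow> real"
  assumes B [measurable]: "B \<in> sets m" and fin: "emeasure m B < \<infinity>" and pos: "emeasure m B \<noteq> 0"
    and u [measurable]: "u \<in> borel_measurable m"
  shows "(\<integral>\<^sup>+y\<in>B. ennreal \<bar>u y - average m u B\<bar> \<partial>m) \<le> 2 * (\<integral>\<^sup>+y\<in>B. ennreal \<bar>u y - c\<bar> \<partial>m)"
proof (cases "(\<integral>\<^sup>+y\<in>B. ennreal \<bar>u y - c\<bar> \<partial>m) = \<infinity>")
  \<comment> \<open>This also covers a \<open>u\<close> that is not integrable on \<open>B\<close>,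
    where \<open>average\<close> is only the default value of an undefined integral.\<close>
  case True
  then show ?thesis by (simp add: ennreal_mult_top)
next
  case False
  define b where "b = measure m B"
  have b: "0 < b" "emeasure m B = ennreal b"
    using fin pos by (auto simp: b_def emeasure_eq_ennreal_measure less_top zero_less_measure_iff)
  have ind: "integrable m (\<lambda>y. indicat_real B y * k)" for k
    using fin by (intro integrable_mult_left integrable_real_indicator) auto
  have int: "integrable m (\<lambda>y. indicat_real B y * (u y - c))"
  proof (rule integrableI_bounded)
    have "(\<integral>\<^sup>+y. ennreal (norm (indicat_real B y * (u y - c))) \<partial>m) = (\<integral>\<^sup>+y\<in>B. ennreal \<bar>u y - c\<bar> \<partial>m)"
      by (intro nn_integral_cong) (auto split: split_indicator)
    then show "(\<integral>\<^sup>+y. ennreal (norm (indicat_real B y * (u y - c))) \<partial>m) < \<infinity>"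
      using False by (simp add: less_top)
  qed measurable
  let ?I = "\<integral>y. indicat_real B y * \<bar>u y - c\<bar> \<partial>m"
  have int_abs: "integrable m (\<lambda>y. indicat_real B y * \<bar>u y - c\<bar>)"
    using integrable_abs[OF int] by (simp add: abs_mult)
  have I: "(\<integral>\<^sup>+y\<in>B. ennreal \<bar>u y - c\<bar> \<partial>m) = ennreal ?I"
  proof -
    have "(\<integral>\<^sup>+y\<in>B. ennreal \<bar>u y - c\<bar> \<partial>m) = (\<integral>\<^sup>+y. ennreal (indicat_real B y * \<bar>u y - c\<bar>) \<partial>m)"
      by (intro nn_integral_cong) (auto split: split_indicator)
    also have "\<dots> = ennreal ?I" using int_abs by (rule nn_integral_eq_integral) auto
    finally show ?thesis .
  qed
  have I0: "0 \<le> ?I" by (intro integral_nonneg_AE) auto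
  let ?a = "average m u B"
  have "b * (?a - c) = (\<integral>y. indicat_real B y * (u y - c) \<partial>m)"
  proof -
    have "(\<integral>y. indicat_real B y * u y \<partial>m) = (\<integral>y. indicat_real B y * (u y - c) + indicat_real B y * c \<partial>m)"
      by (intro Bochner_Integration.integral_cong) (auto simp: algebra_simps)
    also have "\<dots> = (\<integral>y. indicat_real B y * (u y - c) \<partial>m) + (\<integral>y. indicat_real B y * c \<partial>m)"
      by (rule Bochner_Integration.integral_add[OF int ind])
    also have "(\<integral>y. indicat_real B y * c \<partial>m) = b * c"
      using sets.sets_into_space[OF B] by (simp add: b_def Int_absorb2)
    finally have "(\<integral>y. indicat_real B y * u y \<partial>m) = (\<integral>y. indicat_real B y * (u y - c) \<partial>m) + b * c" .
    then show ?thesis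
      using b unfolding average_def set_lebesgue_integral_def b_def[symmetric] by (simp add: field_simps)
  qed
  also have "\<bar>\<dots>\<bar> \<le> (\<integral>y. \<bar>indicat_real B y * (u y - c)\<bar> \<partial>m)" by (rule integral_abs_bound)
  also have "\<dots> = ?I" by (simp add: abs_mult)
  finally have "b * \<bar>?a - c\<bar> \<le> ?I" using b by (simp add: abs_mult)
  have "(\<integral>\<^sup>+y\<in>B. ennreal \<bar>u y - ?a\<bar> \<partial>m) \<le> (\<integral>\<^sup>+y. ennreal (indicat_real B y * \<bar>u y - c\<bar>) + ennreal \<bar>?a - c\<bar> * indicator B y \<partial>m)"
  proof (intro nn_integral_mono)
    fix y
    have "ennreal \<bar>u y - ?a\<bar> \<le> ennreal (\<bar>u y - c\<bar> + \<bar>?a - c\<bar>)" by (intro ennreal_leI) linarith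
    then show "ennreal \<bar>u y - ?a\<bar> * indicator B y \<le> ennreal (indicat_real B y * \<bar>u y - c\<bar>) + ennreal \<bar>?a - c\<bar> * indicator B y"
      by (auto simp: ennreal_plus split: split_indicator)
  qed
  also have "\<dots> = ennreal ?I + ennreal \<bar>?a - c\<bar> * ennreal b"
    using int_abs b by (subst nn_integral_add) (auto simp: nn_integral_eq_integral nn_integral_cmult_indicator)
  also have "\<dots> = ennreal (?I + b * \<bar>?a - c\<bar>)"
    using I0 b by (simp add: ennreal_mult[symmetric] ennreal_plus[symmetric] mult.commute del: ennreal_plus)
  also have "\<dots> \<le> ennreal (2 * ?I)"
    using \<open>b * \<bar>?a - c\<bar> \<le> ?I\<close> by (intro ennreal_leI) simp
  also have "\<dots> = 2 * (\<integral>\<^sup>+y\<in>B. ennreal \<bar>u y - c\<bar> \<partial>m)"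
    unfolding I using I0 by (simp add: ennreal_mult)
  finally show ?thesis .
qed

text \<open>The map is the identity on pairs; it only moves the product measure to the Borel sets of
  pairs. The coupling serves to show that the transport cost is finite.\<close>

lemma (in dense_sequence) product_coupling:
  assumes \<mu>: "\<mu> \<in> borel_probs" and \<nu>: "\<nu> \<in> borel_probs"
  shows "distr (\<mu> \<Otimes>\<^sub>M \<nu>) borel (\<lambda>p. (fst p, snd p)) \<in> couplings \<mu> (\<nu> :: 'a measure)"
proof -
  have sets [measurable_cong]: "sets \<mu> = sets borel" "sets \<nu> = sets borel"
    using \<mu> \<nu> by (auto simp: borel_probs_def)
  interpret \<mu>: prob_space \<mu> using \<mu> by (simp add: borel_probs_def)
  interpret \<nu>: prob_space \<nu> using \<nu> by (simp add: borel_probs_def)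
  interpret P: pair_prob_space \<mu> \<nu> by unfold_locales
  have f: "fst \<in> (\<mu> \<Otimes>\<^sub>M \<nu>) \<rightarrow>\<^sub>M borel" "snd \<in> (\<mu> \<Otimes>\<^sub>M \<nu>) \<rightarrow>\<^sub>M borel"
    by measurable
  have pair: "(\<lambda>p. (fst p, snd p)) \<in> (\<mu> \<Otimes>\<^sub>M \<nu>) \<rightarrow>\<^sub>M borel"
    by (rule measurable_Pair_borel[OF f])
  have "distr (\<mu> \<Otimes>\<^sub>M \<nu>) borel fst = distr (\<mu> \<Otimes>\<^sub>M \<nu>) \<mu> fst"
    by (rule distr_cong) (simp_all add: sets)
  also have "\<dots> = \<mu>" by (rule \<nu>.distr_pair_fst)
  finally have 1: "distr (\<mu> \<Otimes>\<^sub>M \<nu>) borel fst = \<mu>" .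
  have "distr (\<mu> \<Otimes>\<^sub>M \<nu>) borel snd = \<nu>"
  proof (rule measure_eqI)
    fix A assume "A \<in> sets (distr (\<mu> \<Otimes>\<^sub>M \<nu>) borel snd)"
    then have A: "A \<in> sets borel" by simp
    have "snd -` A \<inter> space (\<mu> \<Otimes>\<^sub>M \<nu>) = space \<mu> \<times> A"
      using sets.sets_into_space[of A \<nu>] A by (auto simp: space_pair_measure sets)
    then show "emeasure (distr (\<mu> \<Otimes>\<^sub>M \<nu>) borel snd) A = emeasure \<nu> A"
      using A f(2) \<nu>.emeasure_pair_measure_Times[of "space \<mu>" \<mu> A] \<mu>.emeasure_space_1 sets.top[of \<mu>]
      by (subst emeasure_distr) (auto simp: sets)
  qed (simp add: sets)
  then have 2: "distr (distr (\<mu> \<Otimes>\<^sub>M \<nu>) borel (\<lambda>p. (fst p, snd p))) borel snd = \<nu>"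
    by (subst distr_distr[OF _ pair]) (auto simp: comp_def)
  have "distr (distr (\<mu> \<Otimes>\<^sub>M \<nu>) borel (\<lambda>p. (fst p, snd p))) borel fst = \<mu>"
    using 1 by (subst distr_distr[OF _ pair]) (auto simp: comp_def)
  with 2 P.prob_space_distr[OF pair] show ?thesis
    unfolding couplings_def borel_probs_def by (simp only: mem_Collect_eq sets_distr simp_thms)
qed


theorem theorem1p3:
  fixes m :: "'a::complete_space measure"
    and u :: "'a \<Rightarrow> real" and g :: "'a \<Rightarrow> ennreal" and x :: 'a and r :: real
  assumes "geodesic_metric_measure_space m"
    and "strongly_displacement_convex (shannon_entropy m) \<or>
         (\<exists>N::real. 1 \<le> N \<and> strongly_displacement_convex (renyi_entropy N m))"
    and "continuous_on UNIV u"
    and "upper_gradient g u"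
    and "r > 0"
    and "emeasure m (ball x r) < \<infinity>"
  shows "(\<integral>\<^sup>+ y\<in>ball x r. ennreal \<bar>u y - average m u (ball x r)\<bar> \<partial>m)
           \<le> ennreal (4 * r) * (\<integral>\<^sup>+ y\<in>ball x (2 * r). g y \<partial>m)"
proof -
  have geo: "geodesic_space TYPE('a)" and sets_m [measurable_cong]: "sets m = sets borel"
    and sf: "sigma_finite_measure m" and supp: "measure_support m = UNIV"
    using assms(1) by (auto simp: geodesic_metric_measure_space_def)
  have sp: "space m = UNIV" using sets_eq_imp_space_eq[OF sets_m] by simp
  obtain q :: "nat \<Rightarrow> 'a" where q: "dense_sequence q"
    using ex_dense_sequence[OF sf sets_m supp] by blast
  interpret dense_sequence q by (rule q)
  \<comment> \<open>From here on Shannon and Renyi entropies are treated alike.\<close>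
  obtain F \<phi> where F: "density_gauge m F \<phi>" and conv: "strongly_displacement_convex F"
    using assms(2) density_gauge_shannon[OF sf] density_gauge_renyi[OF sf] by blast
  have um [measurable]: "u \<in> borel_measurable borel"
    using assms(3) by (rule borel_measurable_continuous_onI)
  have um' [measurable]: "u \<in> borel_measurable m" by measurable
  have gm [measurable]: "g \<in> borel_measurable borel"
    using assms(4) by (simp add: upper_gradient_def)
  define B where "B = ball x r"
  have B [measurable]: "B \<in> sets m" unfolding B_def sets_m by (rule borel_open[OF open_ball])
  have finB: "emeasure m B < \<infinity>" using assms(6) by (simp add: B_def)
  have posB: "emeasure m B \<noteq> 0"
  proof -
    have "x \<in> measure_support m" by (simp add: supp)
    then have "0 < emeasure m (ball x r)"
      unfolding measure_support_def mem_Collect_eq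
      by (rule allE[of _ "ball x r"]) (simp add: assms(5))
    then show ?thesis by (simp add: B_def)
  qed
  define b where "b = measure m B"
  have b: "0 < b" "emeasure m B = ennreal b"
    using finB posB by (auto simp: b_def emeasure_eq_ennreal_measure less_top zero_less_measure_iff)
  obtain c f where f [measurable]: "f \<in> borel_measurable m" and f01: "\<And>y. 0 \<le> f y" "\<And>y. f y \<le> 1"
    and f_lo: "\<And>y. u y < c \<Longrightarrow> f y = 0" and f_hi: "\<And>y. c < u y \<Longrightarrow> f y = 1"
    and f_half: "(\<integral>\<^sup>+y. ennreal (f y) * indicator B y \<partial>m) = ennreal (b / 2)"
    using ex_median_weight[OF B finB posB um'] unfolding b_def by blast
  have f_half': "(\<integral>\<^sup>+y. ennreal (1 - f y) * indicator B y \<partial>m) = ennreal (b / 2)"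
  proof -
    have "ennreal (b / 2) + (\<integral>\<^sup>+y. ennreal (1 - f y) * indicator B y \<partial>m)
        = (\<integral>\<^sup>+y. ennreal (f y) * indicator B y + ennreal (1 - f y) * indicator B y \<partial>m)"
      unfolding f_half[symmetric] by (rule nn_integral_add[symmetric]) measurable
    also have "\<dots> = (\<integral>\<^sup>+y. indicator B y \<partial>m)"
      by (intro nn_integral_cong)
         (auto simp: f01 ennreal_plus[symmetric] simp del: ennreal_plus split: split_indicator)
    also have "\<dots> = ennreal (b / 2) + ennreal (b / 2)"
      using b by (simp add: ennreal_plus[symmetric] del: ennreal_plus)
    finally show ?thesis by (simp add: ennreal_add_left_cancel)
  qed
  \<comment> \<open>Normalises each half, of mass b / 2, and bounds both densities since the weights
    are at most 1.\<close>
  define C where "C = 2 / b"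
  have C: "0 < C" using b by (simp add: C_def)
  define \<mu> where "\<mu> h = density m (\<lambda>y. ennreal C * (ennreal (h y) * indicator B y))" for h :: "'a \<Rightarrow> real"
  have sets_\<mu>: "sets (\<mu> h) = sets borel" for h by (simp add: \<mu>_def sets_m)
  have \<mu>: "\<mu> h \<in> borel_probs" "emeasure (\<mu> h) (-B) = 0"
      "\<And>A. A \<in> sets m \<Longrightarrow> emeasure (\<mu> h) A \<le> ennreal C * emeasure m A"
    if [measurable]: "h \<in> borel_measurable m" and h01: "\<And>y. 0 \<le> h y \<and> h y \<le> 1"
      and half: "(\<integral>\<^sup>+y. ennreal (h y) * indicator B y \<partial>m) = ennreal (b / 2)" for h
  proof -
    have "emeasure (\<mu> h) (space (\<mu> h)) = (\<integral>\<^sup>+y. ennreal C * (ennreal (h y) * indicator B y) \<partial>m)"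
      unfolding \<mu>_def by (simp add: emeasure_density sp)
    also have "\<dots> = ennreal C * ennreal (b / 2)"
      by (subst nn_integral_cmult) (auto simp: half)
    also have "\<dots> = 1" using b by (simp add: C_def ennreal_mult[symmetric])
    finally show "\<mu> h \<in> borel_probs"
      by (auto simp: borel_probs_def sets_\<mu> intro: prob_spaceI)
    have dens: "(\<lambda>y. ennreal C * (ennreal (h y) * indicator B y)) \<in> borel_measurable m" by measurable
    have mB: "-B \<in> sets m" using B by (simp add: sets_m)
    have "emeasure (\<mu> h) (-B) = (\<integral>\<^sup>+y. ennreal C * (ennreal (h y) * indicator B y) * indicator (-B) y \<partial>m)"
      unfolding \<mu>_def by (rule emeasure_density[OF dens mB])
    also have "\<dots> = (\<integral>\<^sup>+y. 0 \<partial>m)" by (intro nn_integral_cong) (auto split: split_indicator)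
    finally show "emeasure (\<mu> h) (-B) = 0" by simp
    fix A assume A: "A \<in> sets m"
    have "emeasure (\<mu> h) A = (\<integral>\<^sup>+y. ennreal C * (ennreal (h y) * indicator B y) * indicator A y \<partial>m)"
      unfolding \<mu>_def by (rule emeasure_density[OF dens A])
    also have "\<dots> \<le> (\<integral>\<^sup>+y. ennreal C * indicator A y \<partial>m)"
    proof (rule nn_integral_mono)
      fix y
      have "ennreal (h y) * indicator B y \<le> 1"
        using h01[of y] by (auto split: split_indicator)
      then have "ennreal C * (ennreal (h y) * indicator B y) \<le> ennreal C * 1"
        by (rule mult_left_mono) simp
      then show "ennreal C * (ennreal (h y) * indicator B y) * indicator A y \<le> ennreal C * indicator A y"
        by (auto split: split_indicator)
    qed
    also have "\<dots> = ennreal C * emeasure m A" using A by (rule nn_integral_cmult_indicator)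
    finally show "emeasure (\<mu> h) A \<le> ennreal C * emeasure m A" .
  qed
  let ?f' = "\<lambda>y. 1 - f y"
  have f' [measurable]: "?f' \<in> borel_measurable m" by measurable
  have f01': "0 \<le> f y \<and> f y \<le> 1" "0 \<le> ?f' y \<and> ?f' y \<le> 1" for y using f01[of y] by auto
  note \<mu>0 = \<mu>[OF f f01'(1) f_half] and \<mu>1 = \<mu>[OF f' f01'(2) f_half']
  \<comment> \<open>Both marginals live on \<open>B\<close>, so transport takes place between points
    at distance below 2 r.\<close>
  have bound_cost: "AE w in \<sigma>. fst w \<in> B \<and> snd w \<in> B" if \<sigma>: "\<sigma> \<in> couplings (\<mu> f) (\<mu> ?f')" for \<sigma>
  proof -
    note D = couplingsD[OF \<sigma>]
    note D(2)[measurable_cong]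
    have "-B \<in> sets borel" using B by (simp add: sets_m)
    then have "-B \<in> null_sets (\<mu> f)" "-B \<in> null_sets (\<mu> ?f')"
      using \<mu>0(2) \<mu>1(2) by (auto simp: null_sets_def sets_\<mu>)
    then have "AE y in distr \<sigma> borel fst. y \<in> B" "AE y in distr \<sigma> borel snd. y \<in> B"
      unfolding D(3,4) by (auto dest!: AE_not_in)
    then have "AE w in \<sigma>. fst w \<in> B" "AE w in \<sigma>. snd w \<in> B"
      by (auto intro: AE_distrD[of fst \<sigma> borel] AE_distrD[of snd \<sigma> borel])
    then show ?thesis by eventually_elim simp
  qed
  have dist_B: "dist y z < 2 * r" if "y \<in> B" "z \<in> B" for y z
    using that dist_triangle3[of y z x] by (auto simp: B_def)
  have "transport_cost (\<mu> f) (\<mu> ?f') < \<infinity>"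
  proof -
    obtain \<sigma> where \<sigma>: "\<sigma> \<in> couplings (\<mu> f) (\<mu> ?f')"
      using product_coupling[OF \<mu>0(1) \<mu>1(1)] by blast
    interpret \<sigma>: prob_space \<sigma> by (rule couplingsD(1)[OF \<sigma>])
    have "transport_cost (\<mu> f) (\<mu> ?f') \<le> coupling_cost \<sigma>" using \<sigma> by (rule transport_cost_le)
    also have "\<dots> \<le> (\<integral>\<^sup>+w. ennreal ((2 * r)\<^sup>2) \<partial>\<sigma>)"
      unfolding coupling_cost_def
    proof (rule nn_integral_mono_AE)
      show "AE w in \<sigma>. ennreal ((dist (fst w) (snd w))\<^sup>2) \<le> ennreal ((2 * r)\<^sup>2)"
        using bound_cost[OF \<sigma>]
        by eventually_elim (intro ennreal_leI power_mono less_imp_le[OF dist_B], simp_all)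
    qed
    also have "\<dots> < \<infinity>" by (simp add: \<sigma>.emeasure_space_1)
    finally show ?thesis .
  qed
  then obtain \<sigma> where \<sigma>: "\<sigma> \<in> couplings (\<mu> f) (\<mu> ?f')"
    and opt: "coupling_cost \<sigma> = transport_cost (\<mu> f) (\<mu> ?f')" and fin: "coupling_cost \<sigma> < \<infinity>"
    using ex_optimal_coupling[OF q _ sets_\<mu> sets_\<mu>] by metis
  note D = couplingsD[OF \<sigma>]
  note D(2)[measurable_cong]
  interpret \<sigma>: prob_space \<sigma> by (rule D)
  obtain e :: "'a \<times> 'a \<Rightarrow> real \<Rightarrow> 'a" where
    em [measurable]: "(\<lambda>p. e (fst p) (snd p)) \<in> borel_measurable (borel \<Otimes>\<^sub>M borel)" and
    e: "AE w in \<sigma>. e w 0 = fst w \<and> e w 1 = snd w \<and>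
      (\<forall>s\<in>{0..1}. \<forall>t\<in>{0..1}. dist (e w s) (e w t) = \<bar>s - t\<bar> * dist (fst w) (snd w))"
    using ex_geodesic_selection[OF q geo D(1,2)] by blast
  have et [measurable]: "(\<lambda>w. e w t) \<in> borel_measurable borel" for t
    using measurable_compose[OF measurable_Pair[OF measurable_ident measurable_const[of t]] em] by simp
  have fam: "geodesic_family \<sigma> e" unfolding geodesic_family_def using et e by simp
  let ?B2 = "ball x (2 * r)"
  have B2 [measurable]: "?B2 \<in> sets m" unfolding sets_m by (rule borel_open[OF open_ball])
  \<comment> \<open>The nearer end of the geodesic is at most half its length, thus less than r,
    away from the point at time t, and that end is itself within r of x. Inside the doubled ball the
    density bound replaces the intermediate measure by C m.\<close>
  have inner: "(\<integral>\<^sup>+w. g (e w t) \<partial>\<sigma>) \<le> ennreal C * (\<integral>\<^sup>+y\<in>?B2. g y \<partial>m)" if t: "t \<in> {0..1}" for t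
  proof -
    let ?\<Gamma> = "distr \<sigma> borel (\<lambda>w. e w t)"
    have "AE w in \<sigma>. e w t \<in> ?B2"
      using e bound_cost[OF \<sigma>]
    proof eventually_elim
      case (elim w)
      let ?d = "dist (fst w) (snd w)"
      have d: "?d < 2 * r" "dist x (fst w) < r" "dist x (snd w) < r"
        using elim dist_B by (auto simp: B_def)
      have d0: "dist (fst w) (e w t) = t * ?d" and d1: "dist (snd w) (e w t) = (1 - t) * ?d"
        using elim t by (metis (no_types, opaque_lifting) abs_minus_commute abs_of_nonneg atLeastAtMost_iff diff_ge_0_iff_ge diff_zero le_numeral_extra(3,4) zero_le_one)+
      show ?case
      proof (cases "t \<le> 1/2")
        case True
        then have "t * ?d \<le> 1/2 * ?d" by (intro mult_right_mono) auto
        then show ?thesis using d d0 dist_triangle[of x "e w t" "fst w"] by simp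
      next
        case False
        then have "(1 - t) * ?d \<le> 1/2 * ?d" by (intro mult_right_mono) auto
        then show ?thesis using d d1 dist_triangle[of x "e w t" "snd w"] by simp
      qed
    qed
    then have "(\<integral>\<^sup>+w. g (e w t) \<partial>\<sigma>) = (\<integral>\<^sup>+w. g (e w t) * indicator ?B2 (e w t) \<partial>\<sigma>)"
      by (intro nn_integral_cong_AE) (auto elim!: eventually_mono)
    also have "\<dots> = (\<integral>\<^sup>+y\<in>?B2. g y \<partial>?\<Gamma>)"
      using B2 by (subst nn_integral_distr) (auto simp: sets_m)
    also have "\<dots> \<le> (\<integral>\<^sup>+y\<in>?B2. g y \<partial>density m (\<lambda>_. ennreal C))"
    proof (rule nn_integral_mono_measure)
      have "emeasure ?\<Gamma> A \<le> emeasure (density m (\<lambda>_. ennreal C)) A" for A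
      proof (cases "A \<in> sets m")
        case True
        have "emeasure ?\<Gamma> A \<le> ennreal C * emeasure m A"
          by (rule displacement_density_bound[OF q sets_m F conv \<sigma> opt fin fam C B finB \<mu>0(2) \<mu>1(2) \<mu>0(3) \<mu>1(3) t True])
        then show ?thesis using True by (simp add: emeasure_density_const)
      qed (simp add: emeasure_notin_sets sets_m)
      then show "?\<Gamma> \<le> density m (\<lambda>_. ennreal C)"
        by (simp add: le_measure_iff sets_m sp le_fun_def)
    qed (simp add: sets_m)
    also have "\<dots> = ennreal C * (\<integral>\<^sup>+y\<in>?B2. g y \<partial>m)"
      by (subst nn_integral_density) (auto simp: nn_integral_cmult)
    finally show ?thesis .
  qed
  \<comment> \<open>Exchanging the integrals over geodesics and over time lets the density bound act
    at each fixed time.\<close>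
  have key: "(\<integral>\<^sup>+w. ennreal \<bar>u (fst w) - u (snd w)\<bar> \<partial>\<sigma>) \<le> ennreal (2 * r) * (ennreal C * (\<integral>\<^sup>+y\<in>?B2. g y \<partial>m))"
  proof -
    interpret P: pair_sigma_finite \<sigma> lborel by unfold_locales
    have [measurable]: "(\<lambda>p. g (e (fst p) (snd p)) * indicator {0..1} (snd p)) \<in> borel_measurable (\<sigma> \<Otimes>\<^sub>M lborel)"
    proof -
      have "(\<lambda>p. e (fst p) (snd p)) \<in> \<sigma> \<Otimes>\<^sub>M lborel \<rightarrow>\<^sub>M borel"
        using em by (simp cong: measurable_cong_sets sets_pair_measure_cong add: D(2))
      then show ?thesis by measurable
    qed
    have "(\<integral>\<^sup>+w. ennreal \<bar>u (fst w) - u (snd w)\<bar> \<partial>\<sigma>)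
        \<le> (\<integral>\<^sup>+w. ennreal (2 * r) * (\<integral>\<^sup>+t\<in>{0..1}. g (e w t) \<partial>lborel) \<partial>\<sigma>)"
    proof (rule nn_integral_mono_AE)
      show "AE w in \<sigma>. ennreal \<bar>u (fst w) - u (snd w)\<bar> \<le> ennreal (2 * r) * (\<integral>\<^sup>+t\<in>{0..1}. g (e w t) \<partial>lborel)"
        using e bound_cost[OF \<sigma>]
      proof eventually_elim
        case (elim w)
        have "ennreal \<bar>u (fst w) - u (snd w)\<bar> \<le> ennreal (dist (fst w) (snd w)) * (\<integral>\<^sup>+t\<in>{0..1}. g (e w t) \<partial>lborel)"
          by (rule upper_gradient_geodesic[OF assms(4)]) (use elim in auto)
        also have "\<dots> \<le> ennreal (2 * r) * (\<integral>\<^sup>+t\<in>{0..1}. g (e w t) \<partial>lborel)"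
          by (intro mult_right_mono ennreal_leI less_imp_le[OF dist_B]) (use elim in simp_all)
        finally show ?case .
      qed
    qed
    also have "\<dots> = ennreal (2 * r) * (\<integral>\<^sup>+w. (\<integral>\<^sup>+t\<in>{0..1}. g (e w t) \<partial>lborel) \<partial>\<sigma>)"
      by (rule nn_integral_cmult) measurable
    also have "(\<integral>\<^sup>+w. (\<integral>\<^sup>+t\<in>{0..1}. g (e w t) \<partial>lborel) \<partial>\<sigma>) = (\<integral>\<^sup>+t. (\<integral>\<^sup>+w. g (e w t) * indicator {0..1} t \<partial>\<sigma>) \<partial>lborel)"
      by (rule P.Fubini'[symmetric]) (simp add: case_prod_unfold)
    also have "\<dots> \<le> (\<integral>\<^sup>+t. ennreal C * (\<integral>\<^sup>+y\<in>?B2. g y \<partial>m) * indicator {0..1} t \<partial>(lborel :: real measure))"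
      by (intro nn_integral_mono) (use inner in \<open>auto split: split_indicator\<close>)
    also have "\<dots> = ennreal C * (\<integral>\<^sup>+y\<in>?B2. g y \<partial>m)"
      by (subst nn_integral_cmult_indicator) auto
    finally show ?thesis by (simp add: mult_left_mono)
  qed
  have int_\<mu>: "(\<integral>\<^sup>+y. ennreal \<bar>u y - c\<bar> \<partial>\<mu> h) = ennreal C * (\<integral>\<^sup>+y. ennreal \<bar>u y - c\<bar> * ennreal (h y) * indicator B y \<partial>m)"
    if [measurable]: "h \<in> borel_measurable m" for h
    unfolding \<mu>_def by (subst nn_integral_density) (auto simp: nn_integral_cmult[symmetric] ac_simps)
  \<comment> \<open>The weights f and 1 - f add up to 1, so the two normalised halves together give
    C times m on \<open>B\<close>.\<close>
  have "ennreal C * (\<integral>\<^sup>+y\<in>B. ennreal \<bar>u y - c\<bar> \<partial>m) = (\<integral>\<^sup>+y. ennreal \<bar>u y - c\<bar> \<partial>\<mu> f) + (\<integral>\<^sup>+y. ennreal \<bar>u y - c\<bar> \<partial>\<mu> ?f')"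
  proof -
    have "(\<integral>\<^sup>+y\<in>B. ennreal \<bar>u y - c\<bar> \<partial>m) = (\<integral>\<^sup>+y. ennreal \<bar>u y - c\<bar> * ennreal (f y) * indicator B y + ennreal \<bar>u y - c\<bar> * ennreal (?f' y) * indicator B y \<partial>m)"
    proof (rule nn_integral_cong)
      fix y
      have "ennreal (f y) + ennreal (?f' y) = 1"
        using f01'[of y] by (simp add: ennreal_plus[symmetric] del: ennreal_plus)
      then show "ennreal \<bar>u y - c\<bar> * indicator B y = ennreal \<bar>u y - c\<bar> * ennreal (f y) * indicator B y + ennreal \<bar>u y - c\<bar> * ennreal (?f' y) * indicator B y"
        by (metis distrib_left distrib_right mult.right_neutral)
    qed
    also have "\<dots> = (\<integral>\<^sup>+y. ennreal \<bar>u y - c\<bar> * ennreal (f y) * indicator B y \<partial>m) + (\<integral>\<^sup>+y. ennreal \<bar>u y - c\<bar> * ennreal (?f' y) * indicator B y \<partial>m)"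
      by (rule nn_integral_add) measurable
    finally show ?thesis by (simp add: int_\<mu>[OF f] int_\<mu>[OF f'] distrib_left)
  qed
  also have "\<dots> = (\<integral>\<^sup>+w. ennreal \<bar>u (fst w) - c\<bar> \<partial>\<sigma>) + (\<integral>\<^sup>+w. ennreal \<bar>u (snd w) - c\<bar> \<partial>\<sigma>)"
    unfolding D(3,4)[symmetric] by (subst (1 2) nn_integral_distr) auto
  also have "\<dots> = (\<integral>\<^sup>+w. ennreal \<bar>u (fst w) - c\<bar> + ennreal \<bar>u (snd w) - c\<bar> \<partial>\<sigma>)"
    by (rule nn_integral_add[symmetric]) measurable
  \<comment> \<open>Here the median enters: almost surely u \<ge> c at the start and u \<le> c at
    the end, so the two deviations from c add up without cancellation.\<close>
  also have "\<dots> = (\<integral>\<^sup>+w. ennreal \<bar>u (fst w) - u (snd w)\<bar> \<partial>\<sigma>)"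
  proof (rule nn_integral_cong_AE)
    have f_lo': "c \<le> u y" if "ennreal (f y) \<noteq> 0" for y
      using that f_lo[of y] by (cases "u y < c") auto
    have f_hi': "u y \<le> c" if "ennreal (?f' y) \<noteq> 0" for y
      using that f_hi[of y] by (cases "c < u y") auto
    have hi: "AE y in \<mu> f. c \<le> u y"
      unfolding \<mu>_def by (subst AE_density) (measurable, rule AE_I2, rule impI, rule f_lo', auto)
    have lo: "AE y in \<mu> ?f'. u y \<le> c"
      unfolding \<mu>_def by (subst AE_density) (measurable, rule AE_I2, rule impI, rule f_hi', auto)
    have "AE w in \<sigma>. c \<le> u (fst w)"
      using hi unfolding D(3)[symmetric] by (rule AE_distrD[rotated]) measurable
    moreover have "AE w in \<sigma>. u (snd w) \<le> c"
      using lo unfolding D(4)[symmetric] by (rule AE_distrD[rotated]) measurable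
    ultimately show "AE w in \<sigma>. ennreal \<bar>u (fst w) - c\<bar> + ennreal \<bar>u (snd w) - c\<bar> = ennreal \<bar>u (fst w) - u (snd w)\<bar>"
      by eventually_elim (simp add: ennreal_plus[symmetric] del: ennreal_plus)
  qed
  also note key
  also have "ennreal (2 * r) * (ennreal C * (\<integral>\<^sup>+y\<in>?B2. g y \<partial>m)) = ennreal C * (ennreal (2 * r) * (\<integral>\<^sup>+y\<in>?B2. g y \<partial>m))"
    by (simp add: ac_simps)
  \<comment> \<open>The density bound C occurs on both sides and cancels, so the estimate does not
    depend on m(B).\<close>
  finally have "(\<integral>\<^sup>+y\<in>B. ennreal \<bar>u y - c\<bar> \<partial>m) \<le> ennreal (2 * r) * (\<integral>\<^sup>+y\<in>?B2. g y \<partial>m)"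
    using C by (simp add: ennreal_mult_le_mult_iff)
  then have "2 * (\<integral>\<^sup>+y\<in>B. ennreal \<bar>u y - c\<bar> \<partial>m) \<le> 2 * (ennreal (2 * r) * (\<integral>\<^sup>+y\<in>?B2. g y \<partial>m))"
    by (rule mult_left_mono) simp
  also have "\<dots> = ennreal (4 * r) * (\<integral>\<^sup>+y\<in>?B2. g y \<partial>m)"
  proof -
    have "ennreal (4 * r) = 2 * ennreal (2 * r)"
      using assms(5) ennreal_mult[of 2 "2 * r"] by simp
    then show ?thesis by (simp add: mult.assoc)
  qed
  finally show ?thesis
    using mean_oscillation_le[OF B finB posB um', of c] unfolding B_def by (rule order_trans[rotated])
qed

end
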